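(* Let $\mathcal A=\mathcal B\ltimes_\eta\mathsf F$ be an image-nilpotent $\eta$-extension, let $n\ge1$, and let $(\mathcal X,\mathcal Y)$ be an $\mathsf F$-compatible right $n$-cotorsion pair in $\mathcal B$. Then $\bigl(\mathsf T(\mathcal X),\mathsf U^{-1}(\mathcal Y)\bigr)$ is a right $n$-cotorsion pair in $\mathcal A$, and $\mathsf U^{-1}(\mathcal Y)=\mathsf T(\mathcal X)^{\perp_{[1,n]}}$. More precisely, let $A\in\mathcal A$ have $\eta$-Loewy length $m$. For every $0\le r<m$ choose a short exact sequence $$0\to C_r(A)\to Y_r\xrightarrow{\pi_r}X_r\to0,\qquad Y_r\in\mathcal Y,\quad X_r\in\mathcal X^\vee_{n-1},$$ and let $$0\to\mathsf Z(C_r(A))\to E_r\to\mathsf T(X_r)\to0$$ be its lift (defined in the context). Then there is a short exact sequence $0\to A\to D_A\to Q_A\to0$ in $\mathcal A$ with $D_A\in\mathsf U^{-1}(\mathcal Y)$ and $Q_A\in\mathsf T(\mathcal X)^\vee_{n-1}$. Moreover, $D_A$ and $Q_A$ admit filtrations $$0=D_m\subseteq D_{m-1}\subseteq\cdots\subseteq D_0=D_A,\qquad 0=Q_m\subseteq Q_{m-1}\subseteq\cdots\subseteq Q_0=Q_A$$ such that $D_r/D_{r+1}\cong E_r$ and $Q_r/Q_{r+1}\cong\mathsf T(X_r)$ for $0\le r<m$.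
   Context: Conventions: abelian categories under consideration (in particular $\mathcal B$ and $\mathcal A$) have enough projective and enough injective objects; subcategories (classes of objects, viewed as full subcategories) are full, additive and closed under isomorphisms. $\operatorname{Ext}^i(\mathcal X,\mathcal Y)=0$ means vanishing for all $X\in\mathcal X$, $Y\in\mathcal Y$; $L_i\mathsf F$ denotes the $i$-th left derived functor. Let $\mathcal B$ be an abelian category, $\mathsf F:\mathcal B\to\mathcal B$ a covariant right exact additive functor, and $\eta:\mathsf F^2\to\mathsf F$ a natural transformation that is associative, i.e. $\eta\circ\mathsf F\eta=\eta\circ\eta\mathsf F$. The $\eta$-extension $\mathcal A=\mathcal B\ltimes_\eta\mathsf F$ is the category whose objects are pairs $(B,f)$ with $f:\mathsf F(B)\to B$ satisfying $f\,\mathsf F(f)=f\,\eta_B$, and whose morphisms $(B,f)\to(B',f')$ are morphisms $\alpha:B\to B'$ with $\alpha f=f'\mathsf F(\alpha)$. It is abelian, with exactness detected in $\mathcal B$. Functors: $\mathsf U(X,f)=X$; $\mathsf Z(X)=(X,0)$; $\mathsf C(X,f)=\operatorname{Coker}f$; $\mathsf T(X)=\bigl(X\oplus\mathsf F(X),\left(\begin{smallmatrix}0&0\\1&\eta_X\end{smallmatrix}\right)\bigr)$. $\mathsf T(\mathcal X)$ is the class of objects isomorphic to $\mathsf T(X)$ with $X\in\mathcal X$, and $\mathsf U^{-1}(\mathcal Y)=\{(Y,g)\in\mathcal A\mid Y\in\mathcal Y\}$. For $A=(B,f)$ with image factorization $f=i_Aq_A$ ($q_A:\mathsf F(B)\twoheadrightarrow\operatorname{Im}f$,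 $i_A:\operatorname{Im}f\rightarrowtail B$), put $\mathsf I(A)=(\operatorname{Im}f,\,q_A\mathsf F(i_A))\in\mathcal A$; $\mathsf I^0(A)=A$, $\mathsf I^{r+1}(A)=\mathsf I(\mathsf I^r(A))$; $C_r(A)=\mathsf C(\mathsf I^r(A))$. The $\eta$-Loewy length of $A$ is $\min\{d\ge0\mid\mathsf I^d(A)=0\}$ (or $\infty$). $\mathcal A$ is image-nilpotent if every object has finite $\eta$-Loewy length. For a class $\mathcal M$ in an abelian category $\mathcal E$: $\mathcal M^\vee_m$ is the class of objects $N$ admitting an exact sequence $0\to N\to M^0\to\cdots\to M^m\to0$ with all $M^j\in\mathcal M$; $\mathcal M^{\perp_{[1,n]}}=\{N\in\mathcal E\mid\operatorname{Ext}^i_{\mathcal E}(M,N)=0\ \forall M\in\mathcal M,\ 1\le i\le n\}$. A pair $(\mathcal X,\mathcal Y)$ of classes in $\mathcal E$ is a right $n$-cotorsion pair if: $\mathcal Y$ is closed under direct summands; $\operatorname{Ext}^i_{\mathcal E}(\mathcal X,\mathcal Y)=0$ for $1\le i\le n$; and every $E\in\mathcal E$ admits a short exact sequence $0\to E\to Y_E\to X_E\to0$ with $Y_E\in\mathcal Y$, $X_E\in\mathcal X^\vee_{n-1}$. A right $n$-cotorsion pair $(\mathcal X,\mathcal Y)$ in $\mathcal B$ is $\mathsf F$-compatible if: (1) $L_i\mathsf F(\mathcal X)=0$ for $1\le i\le n+1$; (2) $L_1\mathsf F(\mathcal X^\vee_{n-1})=0$ and $\mathsf F(\mathcal X^\vee_{n-1})\subseteq\mathcal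 Y$; (3) $\operatorname{Ext}^{n+1}_{\mathcal B}(\mathcal X,\mathcal Y)=0$; (4) $\mathsf T(\mathcal X)^\vee_{n-1}$ is extension-closed in $\mathcal A$. Lift: for a short exact sequence $0\to B\xrightarrow{i}Y\xrightarrow{\pi}X\to0$ in $\mathcal B$ with $Y\in\mathcal Y$, $X\in\mathcal X^\vee_{n-1}$, its lift is the short exact sequence $0\to\mathsf Z(B)\xrightarrow{u}E\xrightarrow{v}\mathsf T(X)\to0$ in $\mathcal A$ with $E=\bigl(Y\oplus\mathsf F(X),\left(\begin{smallmatrix}0&0\\\mathsf F(\pi)&\eta_X\end{smallmatrix}\right)\bigr)$, $u=\binom{i}{0}$, $v=\left(\begin{smallmatrix}\pi&0\\0&1\end{smallmatrix}\right)$. *)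

theory Defs
  imports Complex_Main "HOL-Library.Extended_Nat" "HOL-Algebra.Elementary_Groups"
begin

section \<open>Abelian categories\<close>

text \<open>Categories are given by sets of objects and arrows inside the types \<open>'o\<close> and \<open>'m\<close>; the
  additive structure on the hom-sets is part of the data. \<open>g \<cdot> f\<close> means first \<open>f\<close>, then \<open>g\<close>.\<close>

record ('o, 'm) cat =
  Obj :: "'o set"
  Arr :: "'m set"
  Dom :: "'m \<Rightarrow> 'o"
  Cod :: "'m \<Rightarrow> 'o"
  Id :: "'o \<Rightarrow> 'm"
  Comp :: "'m \<Rightarrow> 'm \<Rightarrow> 'm" (infixr "\<cdot>\<index>" 70)
  Add :: "'m \<Rightarrow> 'm \<Rightarrow> 'm" (infixl "\<boxplus>\<index>" 65)
  Zero :: "'o \<Rightarrow> 'o \<Rightarrow> 'm"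

definition Hom :: "('o, 'm) cat \<Rightarrow> 'o \<Rightarrow> 'o \<Rightarrow> 'm set" where
  "Hom C a b = {f \<in> Arr C. Dom C f = a \<and> Cod C f = b}"

definition hom_group :: "('o, 'm) cat \<Rightarrow> 'o \<Rightarrow> 'o \<Rightarrow> 'm monoid" where
  "hom_group C a b = \<lparr>carrier = Hom C a b, mult = Add C, one = Zero C a b\<rparr>"

locale category =
  fixes C :: "('o, 'm) cat" (structure)
  assumes dom_obj: "f \<in> Arr C \<Longrightarrow> Dom C f \<in> Obj C"
    and cod_obj: "f \<in> Arr C \<Longrightarrow> Cod C f \<in> Obj C"
    and id_hom: "a \<in> Obj C \<Longrightarrow> Id C a \<in> Hom C a a"
    and comp_hom: "f \<in> Hom C a b \<Longrightarrow> g \<in> Hom C b c \<Longrightarrow> g \<cdot> f \<in> Hom C a c"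
    and comp_assoc: "f \<in> Hom C a b \<Longrightarrow> g \<in> Hom C b c \<Longrightarrow> h \<in> Hom C c d \<Longrightarrow>
      (h \<cdot> g) \<cdot> f = h \<cdot> (g \<cdot> f)"
    and comp_id_right: "f \<in> Hom C a b \<Longrightarrow> f \<cdot> Id C a = f"
    and comp_id_left: "f \<in> Hom C a b \<Longrightarrow> Id C b \<cdot> f = f"

locale preadditive_category = category +
  assumes hom_comm_group: "a \<in> Obj C \<Longrightarrow> b \<in> Obj C \<Longrightarrow> comm_group (hom_group C a b)"
    and comp_add_right: "f \<in> Hom C a b \<Longrightarrow> f' \<in> Hom C a b \<Longrightarrow> g \<in> Hom C b c \<Longrightarrow>
      g \<cdot> (f \<boxplus> f') = (g \<cdot> f) \<boxplus> (g \<cdot> f')"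
    and comp_add_left: "f \<in> Hom C a b \<Longrightarrow> g \<in> Hom C b c \<Longrightarrow> g' \<in> Hom C b c \<Longrightarrow>
      (g \<boxplus> g') \<cdot> f = (g \<cdot> f) \<boxplus> (g' \<cdot> f)"

definition is_zero :: "('o, 'm) cat \<Rightarrow> 'o \<Rightarrow> bool" where
  "is_zero C z \<longleftrightarrow> z \<in> Obj C \<and>
    (\<forall>a\<in>Obj C. (\<exists>!f. f \<in> Hom C z a) \<and> (\<exists>!f. f \<in> Hom C a z))"

definition is_mono :: "('o, 'm) cat \<Rightarrow> 'm \<Rightarrow> bool" where
  "is_mono C f \<longleftrightarrow> f \<in> Arr C \<and>
    (\<forall>a. \<forall>s\<in>Hom C a (Dom C f). \<forall>t\<in>Hom C a (Dom C f). f \<cdot>\<^bsub>C\<^esub> s = f \<cdot>\<^bsub>C\<^esub> t \<longrightarrow> s = t)"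

definition is_epi :: "('o, 'm) cat \<Rightarrow> 'm \<Rightarrow> bool" where
  "is_epi C f \<longleftrightarrow> f \<in> Arr C \<and>
    (\<forall>b. \<forall>s\<in>Hom C (Cod C f) b. \<forall>t\<in>Hom C (Cod C f) b. s \<cdot>\<^bsub>C\<^esub> f = t \<cdot>\<^bsub>C\<^esub> f \<longrightarrow> s = t)"

definition isomorphic :: "('o, 'm) cat \<Rightarrow> 'o \<Rightarrow> 'o \<Rightarrow> bool" where
  "isomorphic C a b \<longleftrightarrow> a \<in> Obj C \<and> b \<in> Obj C \<and>
    (\<exists>f\<in>Hom C a b. \<exists>g\<in>Hom C b a. g \<cdot>\<^bsub>C\<^esub> f = Id C a \<and> f \<cdot>\<^bsub>C\<^esub> g = Id C b)"

definition is_biprod :: "('o, 'm) cat \<Rightarrow> 'o \<Rightarrow> 'o \<Rightarrow> 'o \<times> 'm \<times> 'm \<times> 'm \<times> 'm \<Rightarrow> bool" where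
  "is_biprod C a b = (\<lambda>(s, i1, i2, p1, p2). a \<in> Obj C \<and> b \<in> Obj C \<and> s \<in> Obj C \<and>
     i1 \<in> Hom C a s \<and> i2 \<in> Hom C b s \<and> p1 \<in> Hom C s a \<and> p2 \<in> Hom C s b \<and>
     p1 \<cdot>\<^bsub>C\<^esub> i1 = Id C a \<and> p2 \<cdot>\<^bsub>C\<^esub> i2 = Id C b \<and>
     p1 \<cdot>\<^bsub>C\<^esub> i2 = Zero C b a \<and> p2 \<cdot>\<^bsub>C\<^esub> i1 = Zero C a b \<and>
     (i1 \<cdot>\<^bsub>C\<^esub> p1) \<boxplus>\<^bsub>C\<^esub> (i2 \<cdot>\<^bsub>C\<^esub> p2) = Id C s)"

definition is_kernel :: "('o, 'm) cat \<Rightarrow> 'm \<Rightarrow> 'm \<Rightarrow> bool" where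
  "is_kernel C k f \<longleftrightarrow> k \<in> Arr C \<and> f \<in> Arr C \<and> Cod C k = Dom C f \<and>
     f \<cdot>\<^bsub>C\<^esub> k = Zero C (Dom C k) (Cod C f) \<and>
     (\<forall>a. \<forall>t\<in>Hom C a (Dom C f). f \<cdot>\<^bsub>C\<^esub> t = Zero C a (Cod C f) \<longrightarrow>
        (\<exists>!u. u \<in> Hom C a (Dom C k) \<and> k \<cdot>\<^bsub>C\<^esub> u = t))"

definition is_cokernel :: "('o, 'm) cat \<Rightarrow> 'm \<Rightarrow> 'm \<Rightarrow> bool" where
  "is_cokernel C c f \<longleftrightarrow> c \<in> Arr C \<and> f \<in> Arr C \<and> Dom C c = Cod C f \<and>
     c \<cdot>\<^bsub>C\<^esub> f = Zero C (Dom C f) (Cod C c) \<and>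
     (\<forall>b. \<forall>t\<in>Hom C (Cod C f) b. t \<cdot>\<^bsub>C\<^esub> f = Zero C (Dom C f) b \<longrightarrow>
        (\<exists>!u. u \<in> Hom C (Cod C c) b \<and> u \<cdot>\<^bsub>C\<^esub> c = t))"

locale abelian_category = preadditive_category +
  assumes ex_zero: "\<exists>z. is_zero C z"
    and ex_biprod: "a \<in> Obj C \<Longrightarrow> b \<in> Obj C \<Longrightarrow> \<exists>S. is_biprod C a b S"
    and ex_kernel: "f \<in> Arr C \<Longrightarrow> \<exists>k. is_kernel C k f"
    and ex_cokernel: "f \<in> Arr C \<Longrightarrow> \<exists>c. is_cokernel C c f"
    and mono_normal: "is_mono C f \<Longrightarrow> \<exists>g. is_kernel C f g"
    and epi_normal: "is_epi C f \<Longrightarrow> \<exists>g. is_cokernel C f g"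

definition biprod :: "('o, 'm) cat \<Rightarrow> 'o \<Rightarrow> 'o \<Rightarrow> 'o \<times> 'm \<times> 'm \<times> 'm \<times> 'm" where
  "biprod C a b = (SOME S. is_biprod C a b S)"

definition ker :: "('o, 'm) cat \<Rightarrow> 'm \<Rightarrow> 'm" where
  "ker C f = (SOME k. is_kernel C k f)"

definition coker_obj :: "('o, 'm) cat \<Rightarrow> 'm \<Rightarrow> 'o" where
  "coker_obj C f = Cod C (SOME c. is_cokernel C c f)"

definition is_image_fact :: "('o, 'm) cat \<Rightarrow> 'm \<Rightarrow> 'm \<times> 'm \<Rightarrow> bool" where
  "is_image_fact C f = (\<lambda>(q, i). is_epi C q \<and> is_mono C i \<and> Dom C q = Dom C f \<and>
     Cod C q = Dom C i \<and> Cod C i = Cod C f \<and> i \<cdot>\<^bsub>C\<^esub> q = f)"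

definition image_fact :: "('o, 'm) cat \<Rightarrow> 'm \<Rightarrow> 'm \<times> 'm" where
  "image_fact C f = (SOME qi. is_image_fact C f qi)"

definition exact_at :: "('o, 'm) cat \<Rightarrow> 'm \<Rightarrow> 'm \<Rightarrow> bool" where
  "exact_at C f g \<longleftrightarrow> f \<in> Arr C \<and> g \<in> Arr C \<and> Cod C f = Dom C g \<and>
     (\<exists>q i. is_image_fact C f (q, i) \<and> is_kernel C i g)"

definition ses :: "('o, 'm) cat \<Rightarrow> 'm \<Rightarrow> 'm \<Rightarrow> bool" where
  "ses C f g \<longleftrightarrow> is_mono C f \<and> is_epi C g \<and> exact_at C f g"

text \<open>An exact sequence \<open>X 0 \<rightarrow> X 1 \<rightarrow> \<dots> \<rightarrow> X k\<close>, exact at the inner terms.\<close>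

definition exact_seq :: "('o, 'm) cat \<Rightarrow> nat \<Rightarrow> (nat \<Rightarrow> 'o) \<Rightarrow> (nat \<Rightarrow> 'm) \<Rightarrow> bool" where
  "exact_seq C k X d \<longleftrightarrow> (\<forall>i\<le>k. X i \<in> Obj C) \<and> (\<forall>i<k. d i \<in> Hom C (X i) (X (Suc i))) \<and>
     (\<forall>i. Suc i < k \<longrightarrow> exact_at C (d i) (d (Suc i)))"

definition projective :: "('o, 'm) cat \<Rightarrow> 'o \<Rightarrow> bool" where
  "projective C p \<longleftrightarrow> p \<in> Obj C \<and>
     (\<forall>e. is_epi C e \<longrightarrow> (\<forall>f\<in>Hom C p (Cod C e). \<exists>g\<in>Hom C p (Dom C e). e \<cdot>\<^bsub>C\<^esub> g = f))"

definition injective :: "('o, 'm) cat \<Rightarrow> 'o \<Rightarrow> bool" where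
  "injective C j \<longleftrightarrow> j \<in> Obj C \<and>
     (\<forall>k. is_mono C k \<longrightarrow> (\<forall>f\<in>Hom C (Dom C k) j. \<exists>g\<in>Hom C (Cod C k) j. g \<cdot>\<^bsub>C\<^esub> k = f))"

definition enough_projectives :: "('o, 'm) cat \<Rightarrow> bool" where
  "enough_projectives C \<longleftrightarrow> (\<forall>a\<in>Obj C. \<exists>e. is_epi C e \<and> Cod C e = a \<and> projective C (Dom C e))"

definition enough_injectives :: "('o, 'm) cat \<Rightarrow> bool" where
  "enough_injectives C \<longleftrightarrow> (\<forall>a\<in>Obj C. \<exists>k. is_mono C k \<and> Dom C k = a \<and> injective C (Cod C k))"

section \<open>Functors and natural transformations\<close>

record ('o, 'm, 'p, 'n) funct =
  FO :: "'o \<Rightarrow> 'p"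
  FM :: "'m \<Rightarrow> 'n"

definition is_functor :: "('o, 'm) cat \<Rightarrow> ('p, 'n) cat \<Rightarrow> ('o, 'm, 'p, 'n) funct \<Rightarrow> bool" where
  "is_functor C D F \<longleftrightarrow> (\<forall>a\<in>Obj C. FO F a \<in> Obj D \<and> FM F (Id C a) = Id D (FO F a)) \<and>
     (\<forall>a b. \<forall>f\<in>Hom C a b. FM F f \<in> Hom D (FO F a) (FO F b)) \<and>
     (\<forall>a b c. \<forall>f\<in>Hom C a b. \<forall>g\<in>Hom C b c. FM F (g \<cdot>\<^bsub>C\<^esub> f) = FM F g \<cdot>\<^bsub>D\<^esub> FM F f)"

definition additive_functor :: "('o, 'm) cat \<Rightarrow> ('p, 'n) cat \<Rightarrow> ('o, 'm, 'p, 'n) funct \<Rightarrow> bool" where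
  "additive_functor C D F \<longleftrightarrow> is_functor C D F \<and>
     (\<forall>a b. \<forall>f\<in>Hom C a b. \<forall>g\<in>Hom C a b. FM F (f \<boxplus>\<^bsub>C\<^esub> g) = FM F f \<boxplus>\<^bsub>D\<^esub> FM F g)"

definition right_exact :: "('o, 'm) cat \<Rightarrow> ('p, 'n) cat \<Rightarrow> ('o, 'm, 'p, 'n) funct \<Rightarrow> bool" where
  "right_exact C D F \<longleftrightarrow> (\<forall>f g. ses C f g \<longrightarrow> exact_at D (FM F f) (FM F g) \<and> is_epi D (FM F g))"

definition funct_comp ::
  "('p, 'n, 'q, 'l) funct \<Rightarrow> ('o, 'm, 'p, 'n) funct \<Rightarrow> ('o, 'm, 'q, 'l) funct" where
  "funct_comp G F = \<lparr>FO = FO G \<circ> FO F, FM = FM G \<circ> FM F\<rparr>"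

definition nat_trans :: "('o, 'm) cat \<Rightarrow> ('p, 'n) cat \<Rightarrow> ('o, 'm, 'p, 'n) funct \<Rightarrow>
    ('o, 'm, 'p, 'n) funct \<Rightarrow> ('o \<Rightarrow> 'n) \<Rightarrow> bool" where
  "nat_trans C D F G \<eta> \<longleftrightarrow> (\<forall>a\<in>Obj C. \<eta> a \<in> Hom D (FO F a) (FO G a)) \<and>
     (\<forall>a b. \<forall>f\<in>Hom C a b. \<eta> b \<cdot>\<^bsub>D\<^esub> FM F f = FM G f \<cdot>\<^bsub>D\<^esub> \<eta> a)"

section \<open>Ext groups and left derived functors\<close>

text \<open>\<open>P 0 \<leftarrow> P 1 \<leftarrow> \<dots>\<close> with \<open>d i : P (i + 1) \<rightarrow> P i\<close> and augmentation \<open>e : P 0 \<rightarrow> x\<close>.\<close>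

definition is_proj_res ::
  "('o, 'm) cat \<Rightarrow> 'o \<Rightarrow> (nat \<Rightarrow> 'o) \<times> (nat \<Rightarrow> 'm) \<times> 'm \<Rightarrow> bool" where
  "is_proj_res C x = (\<lambda>(P, d, e). (\<forall>i. projective C (P i)) \<and>
     (\<forall>i. d i \<in> Hom C (P (Suc i)) (P i)) \<and> e \<in> Hom C (P 0) x \<and>
     is_epi C e \<and> exact_at C (d 0) e \<and> (\<forall>i. exact_at C (d (Suc i)) (d i)))"

definition proj_res :: "('o, 'm) cat \<Rightarrow> 'o \<Rightarrow> (nat \<Rightarrow> 'o) \<times> (nat \<Rightarrow> 'm) \<times> 'm" where
  "proj_res C x = (SOME R. is_proj_res C x R)"

definition res_obj :: "('o, 'm) cat \<Rightarrow> 'o \<Rightarrow> nat \<Rightarrow> 'o" where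
  "res_obj C x = fst (proj_res C x)"

definition res_diff :: "('o, 'm) cat \<Rightarrow> 'o \<Rightarrow> nat \<Rightarrow> 'm" where
  "res_diff C x = fst (snd (proj_res C x))"

definition ext_cocycles :: "('o, 'm) cat \<Rightarrow> nat \<Rightarrow> 'o \<Rightarrow> 'o \<Rightarrow> 'm set" where
  "ext_cocycles C i x y = {\<phi> \<in> Hom C (res_obj C x i) y.
     \<phi> \<cdot>\<^bsub>C\<^esub> res_diff C x i = Zero C (res_obj C x (Suc i)) y}"

fun ext_coboundaries :: "('o, 'm) cat \<Rightarrow> nat \<Rightarrow> 'o \<Rightarrow> 'o \<Rightarrow> 'm set" where
  "ext_coboundaries C 0 x y = {Zero C (res_obj C x 0) y}"
| "ext_coboundaries C (Suc i) x y = (\<lambda>\<psi>. \<psi> \<cdot>\<^bsub>C\<^esub> res_diff C x i) ` Hom C (res_obj C x i) y"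

definition Ext :: "('o, 'm) cat \<Rightarrow> nat \<Rightarrow> 'o \<Rightarrow> 'o \<Rightarrow> 'm set monoid" where
  "Ext C i x y = (hom_group C (res_obj C x i) y)\<lparr>carrier := ext_cocycles C i x y\<rparr>
     Mod ext_coboundaries C i x y"

definition Ext_vanishes :: "('o, 'm) cat \<Rightarrow> nat \<Rightarrow> 'o set \<Rightarrow> 'o set \<Rightarrow> bool" where
  "Ext_vanishes C i X Y \<longleftrightarrow> (\<forall>x\<in>X. \<forall>y\<in>Y. trivial_group (Ext C i x y))"

text \<open>For \<open>g \<cdot> f = 0\<close>: the cokernel of the arrow induced by \<open>f\<close> into the kernel of \<open>g\<close>.\<close>

definition homology :: "('o, 'm) cat \<Rightarrow> 'm \<Rightarrow> 'm \<Rightarrow> 'o" where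
  "homology C f g = coker_obj C
     (THE u. u \<in> Hom C (Dom C f) (Dom C (ker C g)) \<and> ker C g \<cdot>\<^bsub>C\<^esub> u = f)"

fun left_derived :: "('o, 'm) cat \<Rightarrow> ('p, 'n) cat \<Rightarrow> ('o, 'm, 'p, 'n) funct \<Rightarrow> nat \<Rightarrow> 'o \<Rightarrow> 'p" where
  "left_derived C D F 0 x = coker_obj D (FM F (res_diff C x 0))"
| "left_derived C D F (Suc i) x =
     homology D (FM F (res_diff C x (Suc i))) (FM F (res_diff C x i))"

section \<open>Classes of objects and right cotorsion pairs\<close>

definition additive_subcat :: "('o, 'm) cat \<Rightarrow> 'o set \<Rightarrow> bool" where
  "additive_subcat C M \<longleftrightarrow> M \<subseteq> Obj C \<and> (\<exists>z\<in>M. is_zero C z) \<and>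
     (\<forall>a\<in>M. \<forall>b\<in>M. \<forall>s i1 i2 p1 p2. is_biprod C a b (s, i1, i2, p1, p2) \<longrightarrow> s \<in> M) \<and>
     (\<forall>a\<in>M. \<forall>b. isomorphic C a b \<longrightarrow> b \<in> M)"

definition summand_closed :: "('o, 'm) cat \<Rightarrow> 'o set \<Rightarrow> bool" where
  "summand_closed C M \<longleftrightarrow>
     (\<forall>a b s i1 i2 p1 p2. is_biprod C a b (s, i1, i2, p1, p2) \<and> s \<in> M \<longrightarrow> a \<in> M)"

definition extension_closed :: "('o, 'm) cat \<Rightarrow> 'o set \<Rightarrow> bool" where
  "extension_closed C M \<longleftrightarrow>
     (\<forall>f g. ses C f g \<and> Dom C f \<in> M \<and> Cod C g \<in> M \<longrightarrow> Cod C f \<in> M)"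

text \<open>The class \<open>M\<^sup>\<or>\<^sub>m\<close>; the exact sequence is indexed as
  \<open>X 0 = 0\<close>, \<open>X 1 = N\<close>, \<open>X (j + 2) = M\<^sup>j\<close> for \<open>j \<le> m\<close>, \<open>X (m + 3) = 0\<close>.\<close>

definition coresolved :: "('o, 'm) cat \<Rightarrow> 'o set \<Rightarrow> nat \<Rightarrow> 'o set" where
  "coresolved C M m = {N \<in> Obj C. \<exists>X d. exact_seq C (m + 3) X d \<and> is_zero C (X 0) \<and> X 1 = N \<and>
     (\<forall>j\<le>m. X (j + 2) \<in> M) \<and> is_zero C (X (m + 3))}"

definition perp :: "('o, 'm) cat \<Rightarrow> 'o set \<Rightarrow> nat \<Rightarrow> 'o set" where
  "perp C M n = {N \<in> Obj C. \<forall>i\<in>{1..n}. Ext_vanishes C i M {N}}"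

definition right_cotorsion_pair :: "('o, 'm) cat \<Rightarrow> nat \<Rightarrow> 'o set \<Rightarrow> 'o set \<Rightarrow> bool" where
  "right_cotorsion_pair C n X Y \<longleftrightarrow> additive_subcat C X \<and> additive_subcat C Y \<and>
     summand_closed C Y \<and>
     (\<forall>i\<in>{1..n}. Ext_vanishes C i X Y) \<and>
     (\<forall>a\<in>Obj C. \<exists>f g. ses C f g \<and> Dom C f = a \<and> Cod C f \<in> Y \<and> Cod C g \<in> coresolved C X (n - 1))"

section \<open>The eta-extension\<close>

definition eta_datum :: "('o, 'm) cat \<Rightarrow> ('o, 'm, 'o, 'm) funct \<Rightarrow> ('o \<Rightarrow> 'm) \<Rightarrow> bool" where
  "eta_datum B F \<eta> \<longleftrightarrow> abelian_category B \<and> additive_functor B B F \<and> right_exact B B F \<and>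
     nat_trans B B (funct_comp F F) F \<eta> \<and>
     (\<forall>b\<in>Obj B. \<eta> b \<cdot>\<^bsub>B\<^esub> FM F (\<eta> b) = \<eta> b \<cdot>\<^bsub>B\<^esub> \<eta> (FO F b))"

definition eta_obj ::
  "('o, 'm) cat \<Rightarrow> ('o, 'm, 'o, 'm) funct \<Rightarrow> ('o \<Rightarrow> 'm) \<Rightarrow> ('o \<times> 'm) set" where
  "eta_obj B F \<eta> = {(b, f). b \<in> Obj B \<and> f \<in> Hom B (FO F b) b \<and> f \<cdot>\<^bsub>B\<^esub> FM F f = f \<cdot>\<^bsub>B\<^esub> \<eta> b}"

text \<open>An arrow of the extension is a triple (source, underlying arrow of \<open>B\<close>, target).\<close>

definition eta_ext :: "('o, 'm) cat \<Rightarrow> ('o, 'm, 'o, 'm) funct \<Rightarrow> ('o \<Rightarrow> 'm) \<Rightarrow>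
    ('o \<times> 'm, ('o \<times> 'm) \<times> 'm \<times> ('o \<times> 'm)) cat" where
  "eta_ext B F \<eta> = \<lparr>
     Obj = eta_obj B F \<eta>,
     Arr = {((b, f), \<alpha>, (b', f')). (b, f) \<in> eta_obj B F \<eta> \<and> (b', f') \<in> eta_obj B F \<eta> \<and>
              \<alpha> \<in> Hom B b b' \<and> \<alpha> \<cdot>\<^bsub>B\<^esub> f = f' \<cdot>\<^bsub>B\<^esub> FM F \<alpha>},
     Dom = (\<lambda>(x, \<alpha>, y). x),
     Cod = (\<lambda>(x, \<alpha>, y). y),
     Id = (\<lambda>x. (x, Id B (fst x), x)),
     Comp = (\<lambda>(y, \<beta>, z) (x, \<alpha>, y'). (x, \<beta> \<cdot>\<^bsub>B\<^esub> \<alpha>, z)),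
     Add = (\<lambda>(x, \<alpha>, y) (x', \<alpha>', y'). (x, \<alpha> \<boxplus>\<^bsub>B\<^esub> \<alpha>', y)),
     Zero = (\<lambda>x y. (x, Zero B (fst x) (fst y), y))\<rparr>"

definition Z_obj :: "('o, 'm) cat \<Rightarrow> ('o, 'm, 'o, 'm) funct \<Rightarrow> 'o \<Rightarrow> 'o \<times> 'm" where
  "Z_obj B F x = (x, Zero B (FO F x) x)"

definition C_obj :: "('o, 'm) cat \<Rightarrow> 'o \<times> 'm \<Rightarrow> 'o" where
  "C_obj B a = coker_obj B (snd a)"

text \<open>Matrices out of \<open>F (x \<oplus> F x) = F x \<oplus> F (F x)\<close> are written out with the \<open>F\<close>-images of the
  projections of the chosen biproduct.\<close>

definition T_obj :: "('o, 'm) cat \<Rightarrow> ('o, 'm, 'o, 'm) funct \<Rightarrow> ('o \<Rightarrow> 'm) \<Rightarrow> 'o \<Rightarrow> 'o \<times> 'm" where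
  "T_obj B F \<eta> x = (case biprod B x (FO F x) of (s, i1, i2, p1, p2) \<Rightarrow>
     (s, (i2 \<cdot>\<^bsub>B\<^esub> FM F p1) \<boxplus>\<^bsub>B\<^esub> (i2 \<cdot>\<^bsub>B\<^esub> \<eta> x \<cdot>\<^bsub>B\<^esub> FM F p2)))"

definition T_class ::
  "('o, 'm) cat \<Rightarrow> ('o, 'm, 'o, 'm) funct \<Rightarrow> ('o \<Rightarrow> 'm) \<Rightarrow> 'o set \<Rightarrow> ('o \<times> 'm) set" where
  "T_class B F \<eta> X = {a. \<exists>x\<in>X. isomorphic (eta_ext B F \<eta>) a (T_obj B F \<eta> x)}"

definition U_inv ::
  "('o, 'm) cat \<Rightarrow> ('o, 'm, 'o, 'm) funct \<Rightarrow> ('o \<Rightarrow> 'm) \<Rightarrow> 'o set \<Rightarrow> ('o \<times> 'm) set" where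
  "U_inv B F \<eta> Y = {a \<in> Obj (eta_ext B F \<eta>). fst a \<in> Y}"

definition I_obj :: "('o, 'm) cat \<Rightarrow> ('o, 'm, 'o, 'm) funct \<Rightarrow> 'o \<times> 'm \<Rightarrow> 'o \<times> 'm" where
  "I_obj B F a = (case image_fact B (snd a) of (q, i) \<Rightarrow> (Dom B i, q \<cdot>\<^bsub>B\<^esub> FM F i))"

definition C_iter :: "('o, 'm) cat \<Rightarrow> ('o, 'm, 'o, 'm) funct \<Rightarrow> nat \<Rightarrow> 'o \<times> 'm \<Rightarrow> 'o" where
  "C_iter B F r a = C_obj B ((I_obj B F ^^ r) a)"

text \<open>The infimum of the empty set is \<open>\<infinity>\<close>.\<close>

definition loewy_length ::
  "('o, 'm) cat \<Rightarrow> ('o, 'm, 'o, 'm) funct \<Rightarrow> ('o \<Rightarrow> 'm) \<Rightarrow> 'o \<times> 'm \<Rightarrow> enat" where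
  "loewy_length B F \<eta> a = Inf {enat d | d. is_zero (eta_ext B F \<eta>) ((I_obj B F ^^ d) a)}"

definition image_nilpotent ::
  "('o, 'm) cat \<Rightarrow> ('o, 'm, 'o, 'm) funct \<Rightarrow> ('o \<Rightarrow> 'm) \<Rightarrow> bool" where
  "image_nilpotent B F \<eta> \<longleftrightarrow> (\<forall>a\<in>Obj (eta_ext B F \<eta>). loewy_length B F \<eta> a < \<infinity>)"

definition F_compatible :: "('o, 'm) cat \<Rightarrow> ('o, 'm, 'o, 'm) funct \<Rightarrow> ('o \<Rightarrow> 'm) \<Rightarrow>
    nat \<Rightarrow> 'o set \<Rightarrow> 'o set \<Rightarrow> bool" where
  "F_compatible B F \<eta> n X Y \<longleftrightarrow>
     (\<forall>i\<in>{1..n + 1}. \<forall>x\<in>X. is_zero B (left_derived B B F i x)) \<and>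
     (\<forall>x\<in>coresolved B X (n - 1). is_zero B (left_derived B B F 1 x) \<and> FO F x \<in> Y) \<and>
     Ext_vanishes B (n + 1) X Y \<and>
     extension_closed (eta_ext B F \<eta>) (coresolved (eta_ext B F \<eta>) (T_class B F \<eta> X) (n - 1))"

text \<open>The lift, as its pair of arrows \<open>(u, v)\<close>, of the sequence with arrows
  \<open>j : b \<rightarrow> y\<close> and \<open>p : y \<rightarrow> x\<close>.\<close>

definition lift_seq :: "('o, 'm) cat \<Rightarrow> ('o, 'm, 'o, 'm) funct \<Rightarrow> ('o \<Rightarrow> 'm) \<Rightarrow> 'm \<Rightarrow> 'm \<Rightarrow>
    (('o \<times> 'm) \<times> 'm \<times> ('o \<times> 'm)) \<times> (('o \<times> 'm) \<times> 'm \<times> ('o \<times> 'm))" where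
  "lift_seq B F \<eta> j p =
     (let b = Dom B j; y = Dom B p; x = Cod B p;
          (s, i1, i2, p1, p2) = biprod B y (FO F x);
          (s', i1', i2', p1', p2') = biprod B x (FO F x);
          E = (s, (i2 \<cdot>\<^bsub>B\<^esub> FM F p \<cdot>\<^bsub>B\<^esub> FM F p1) \<boxplus>\<^bsub>B\<^esub> (i2 \<cdot>\<^bsub>B\<^esub> \<eta> x \<cdot>\<^bsub>B\<^esub> FM F p2))
      in ((Z_obj B F b, i1 \<cdot>\<^bsub>B\<^esub> j, E),
          (E, (i1' \<cdot>\<^bsub>B\<^esub> p \<cdot>\<^bsub>B\<^esub> p1) \<boxplus>\<^bsub>B\<^esub> (i2' \<cdot>\<^bsub>B\<^esub> p2), T_obj B F \<eta> x)))"

text \<open>A finite filtration \<open>0 = D m \<subseteq> \<dots> \<subseteq> D 0 = a\<close> with inclusions \<open>d r : D (r + 1) \<rightarrow> D r\<close>,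
  whose quotients \<open>D r / D (r + 1)\<close> are isomorphic to \<open>Q r\<close>.\<close>

definition has_filtration :: "('o, 'm) cat \<Rightarrow> nat \<Rightarrow> 'o \<Rightarrow> (nat \<Rightarrow> 'o) \<Rightarrow> bool" where
  "has_filtration C m a Q \<longleftrightarrow> (\<exists>D d. D 0 = a \<and> is_zero C (D m) \<and>
     (\<forall>r<m. d r \<in> Hom C (D (Suc r)) (D r) \<and> is_mono C (d r) \<and>
        isomorphic C (coker_obj C (d r)) (Q r)))"

end

theory Submission
  imports Defs
begin

text \<open>The extension is the category of algebras of the monad \<open>1 \<oplus> F\<close>, so it is abelian, exactness is
  detected in \<open>B\<close>, and \<open>T\<close> is left adjoint to the forgetful functor \<open>U\<close>. If \<open>L\<^sub>i F\<close> vanishes on \<open>x\<close>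
  for \<open>1 \<le> i \<le> n + 1\<close>, then \<open>T\<close> sends the start of a projective resolution of \<open>x\<close> to one of
  \<open>T x\<close>, hence the vanishing of \<open>Ext\<^sup>i(x, U a)\<close> implies that of \<open>Ext\<^sup>i(T x, a)\<close> for
  \<open>1 \<le> i \<le> n + 1\<close>. The sequence \<open>0 \<rightarrow> a \<rightarrow> D \<rightarrow> Q \<rightarrow> 0\<close> is built by induction on the Loewy length from
  \<open>0 \<rightarrow> I a \<rightarrow> a \<rightarrow> Z (C a) \<rightarrow> 0\<close>: the sequence for \<open>I a\<close> and the lift for \<open>Z (C a)\<close> fit into a
  three-by-three diagram, the obstruction lying in \<open>Ext\<^sup>2\<close> of a coresolved object with values
  in \<open>U\<^sup>-\<^sup>1(Y)\<close>, which vanishes by dimension shift. Membership of \<open>D\<close> in \<open>U\<^sup>-\<^sup>1(Y)\<close> and the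
  description of \<open>U\<^sup>-\<^sup>1(Y)\<close> as an orthogonal class follow from the fact that the right half of a
  right cotorsion pair is the orthogonal class of the left half, since the approximation sequence
  of an orthogonal object splits.

  Exactness is tested throughout on arrows out of projective objects, which play the role of elements.\<close>

section \<open>Preadditive and abelian categories\<close>

text \<open>The induction needs one degree more than a right n-cotorsion pair provides. The
  obstruction to gluing lies in Ext^2(\<open>T x\<close>, \<open>D\<close>) with \<open>x\<close>
  only in X^vee_(n-1); shifting along a coresolution of length n - 1 turns it into Ext^2, ...,
  Ext^(n+1) on \<open>T X\<close>. This is where L_(n+1) F and Ext^(n+1)(X, Y) enter
  \<open>F_compatible\<close>. The other clauses keep the construction in its classes:
  \<open>T\<close> preserves coresolutions because L_1 F vanishes on X^vee_(n-1), the lifts lie over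
  \<open>Y\<close> because \<open>F\<close> maps X^vee_(n-1) into \<open>Y\<close>, and
  extension-closedness keeps Q coresolved.

  Ext is defined from a chosen projective resolution, which suits none of these arguments. It is
  traded for a resolution-free predicate \<open>ext_zero\<close>: in degree one an extension
  property of arrows, in higher degrees a dimension shift. Only vanishing is carried through, so no
  long exact sequence of groups is built. Coresolutions are likewise cut into short exact sequences,
  which gives induction on their length.\<close>

context category
begin

text \<open>Typing side conditions are to be settled by the simplifier alone. Hom-set membership is
  therefore broken into equations for the two ends, together with the derivable facts that both ends
  are objects.\<close>

lemma Hom_iff [simp]:
  "f \<in> Hom C a b \<longleftrightarrow> f \<in> Arr C \<and> Dom C f = a \<and> Cod C f = b \<and> a \<in> Obj C \<and> b \<in> Obj C"
  by (auto simp: Hom_def dom_obj cod_obj)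

lemma comp_arr [simp]:
  assumes "f \<in> Arr C" "g \<in> Arr C" "Dom C g = Cod C f"
  shows "g \<cdot> f \<in> Arr C" "Dom C (g \<cdot> f) = Dom C f" "Cod C (g \<cdot> f) = Cod C g"
  using comp_hom[of f "Dom C f" "Cod C f" g "Cod C g"] assms by (auto simp: dom_obj cod_obj)

lemma comp_assoc_arr [simp]:
  assumes "f \<in> Arr C" "g \<in> Arr C" "h \<in> Arr C" "Dom C g = Cod C f" "Dom C h = Cod C g"
  shows "(h \<cdot> g) \<cdot> f = h \<cdot> (g \<cdot> f)"
  using comp_assoc[of f "Dom C f" "Cod C f" g "Cod C g" h "Cod C h"] assms
  by (auto simp: dom_obj cod_obj)

lemma id_arr [simp]:
  assumes "a \<in> Obj C"
  shows "Id C a \<in> Arr C" "Dom C (Id C a) = a" "Cod C (Id C a) = a"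
  using id_hom[OF assms] by auto

lemma comp_id_arr [simp]:
  assumes "f \<in> Arr C"
  shows "Dom C f = a \<Longrightarrow> f \<cdot> Id C a = f" "Cod C f = b \<Longrightarrow> Id C b \<cdot> f = f"
  using comp_id_right[of f "Dom C f" "Cod C f"] comp_id_left[of f "Dom C f" "Cod C f"] assms
  by (auto simp: dom_obj cod_obj)

lemmas obj_simps [simp] = dom_obj cod_obj

lemma mono_cancel:
  assumes "is_mono C f" "s \<in> Hom C a (Dom C f)" "t \<in> Hom C a (Dom C f)" "f \<cdot> s = f \<cdot> t"
  shows "s = t"
  using assms unfolding is_mono_def by blast

lemma epi_cancel:
  assumes "is_epi C f" "s \<in> Hom C (Cod C f) b" "t \<in> Hom C (Cod C f) b" "s \<cdot> f = t \<cdot> f"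
  shows "s = t"
  using assms unfolding is_epi_def by blast

lemma mono_arr: "is_mono C f \<Longrightarrow> f \<in> Arr C" and epi_arr: "is_epi C f \<Longrightarrow> f \<in> Arr C"
  by (auto simp: is_mono_def is_epi_def)

lemma kernel_factor:
  assumes "is_kernel C k f" "t \<in> Hom C a (Dom C f)" "f \<cdot> t = Zero C a (Cod C f)"
  obtains u where "u \<in> Hom C a (Dom C k)" "k \<cdot> u = t"
  using assms unfolding is_kernel_def by blast

lemma cokernel_factor:
  assumes "is_cokernel C c f" "t \<in> Hom C (Cod C f) b" "t \<cdot> f = Zero C (Dom C f) b"
  obtains u where "u \<in> Hom C (Cod C c) b" "u \<cdot> c = t"
  using assms unfolding is_cokernel_def by blast

lemma isomorphicI:
  assumes "f \<in> Hom C a b" "g \<in> Hom C b a" "g \<cdot> f = Id C a" "f \<cdot> g = Id C b"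
  shows "isomorphic C a b"
  unfolding isomorphic_def by (intro conjI bexI[of _ f] bexI[of _ g]) (use assms in auto)

lemma isomorphic_refl: "a \<in> Obj C \<Longrightarrow> isomorphic C a a"
  by (rule isomorphicI[of "Id C a" _ _ "Id C a"]) auto

lemma isomorphic_sym: "isomorphic C a b \<Longrightarrow> isomorphic C b a"
  unfolding isomorphic_def by blast

lemma isomorphic_trans:
  assumes "isomorphic C a b" "isomorphic C b c"
  shows "isomorphic C a c"
proof -
  obtain f g where f: "f \<in> Hom C a b" "g \<in> Hom C b a" "g \<cdot> f = Id C a" "f \<cdot> g = Id C b"
    using assms(1) unfolding isomorphic_def by blast
  obtain h k where h: "h \<in> Hom C b c" "k \<in> Hom C c b" "k \<cdot> h = Id C b" "h \<cdot> k = Id C c"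
    using assms(2) unfolding isomorphic_def by blast
  have "(g \<cdot> k) \<cdot> (h \<cdot> f) = g \<cdot> ((k \<cdot> h) \<cdot> f)"
    using f(1,2) h(1,2) by simp
  then have 1: "(g \<cdot> k) \<cdot> (h \<cdot> f) = Id C a"
    unfolding h(3) using f by simp
  have "(h \<cdot> f) \<cdot> (g \<cdot> k) = h \<cdot> ((f \<cdot> g) \<cdot> k)"
    using f(1,2) h(1,2) by simp
  then have 2: "(h \<cdot> f) \<cdot> (g \<cdot> k) = Id C c"
    unfolding f(4) using h by simp
  show ?thesis
    by (rule isomorphicI[OF _ _ 1 2]) (use f h in auto)
qed

text \<open>Composites are normalized to the right, so an equation for \<open>g \<cdot> f\<close> no
  longer matches inside a longer composite. This is its form with a tail \<open>x\<close>, used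
  throughout in place of reassociating.\<close>

lemma assoc_eq:
  assumes "g \<cdot> f = h" "f \<in> Arr C" "g \<in> Arr C" "x \<in> Arr C" "Dom C g = Cod C f" "Dom C f = Cod C x"
  shows "g \<cdot> (f \<cdot> x) = h \<cdot> x"
  using assms comp_assoc_arr[of x f g] by simp

end

section \<open>Arithmetic in hom-groups, and zero tests for monos and epis\<close>

context preadditive_category
begin

text \<open>The category record carries addition and zero only; the inverse is taken in the
  hom-group that the two ends of the arrow determine.\<close>

definition neg :: "'b \<Rightarrow> 'b" where
  "neg f = inv\<^bsub>hom_group C (Dom C f) (Cod C f)\<^esub> f"

lemma hom_group_simps:
  "carrier (hom_group C a b) = Hom C a b" "mult (hom_group C a b) = Add C"
  "one (hom_group C a b) = Zero C a b"
  by (simp_all add: hom_group_def)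

lemma zero_arr [simp]:
  assumes "a \<in> Obj C" "b \<in> Obj C"
  shows "Zero C a b \<in> Arr C" "Dom C (Zero C a b) = a" "Cod C (Zero C a b) = b"
proof -
  interpret G: comm_group "hom_group C a b" by (rule hom_comm_group[OF assms])
  show "Zero C a b \<in> Arr C" "Dom C (Zero C a b) = a" "Cod C (Zero C a b) = b"
    using G.one_closed unfolding hom_group_simps by auto
qed

lemma add_arr [simp]:
  assumes "f \<in> Arr C" "g \<in> Arr C" "Dom C g = Dom C f" "Cod C g = Cod C f"
  shows "f \<boxplus> g \<in> Arr C" "Dom C (f \<boxplus> g) = Dom C f" "Cod C (f \<boxplus> g) = Cod C f"
proof -
  interpret G: comm_group "hom_group C (Dom C f) (Cod C f)" by (rule hom_comm_group) (use assms in auto)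
  show "f \<boxplus> g \<in> Arr C" "Dom C (f \<boxplus> g) = Dom C f" "Cod C (f \<boxplus> g) = Cod C f"
    using G.m_closed[of f g] assms unfolding hom_group_simps by auto
qed

lemma neg_arr [simp]:
  assumes "f \<in> Arr C"
  shows "neg f \<in> Arr C" "Dom C (neg f) = Dom C f" "Cod C (neg f) = Cod C f"
    "f \<boxplus> neg f = Zero C (Dom C f) (Cod C f)" "neg f \<boxplus> f = Zero C (Dom C f) (Cod C f)"
proof -
  interpret G: comm_group "hom_group C (Dom C f) (Cod C f)" by (rule hom_comm_group) (use assms in auto)
  show "neg f \<in> Arr C" "Dom C (neg f) = Dom C f" "Cod C (neg f) = Cod C f"
    using G.inv_closed[of f] assms unfolding hom_group_simps neg_def by auto
  show "f \<boxplus> neg f = Zero C (Dom C f) (Cod C f)" "neg f \<boxplus> f = Zero C (Dom C f) (Cod C f)"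
    using G.r_inv[of f] G.l_inv[of f] assms unfolding hom_group_simps neg_def by auto
qed

lemma add_zero [simp]:
  assumes "f \<in> Arr C" "Dom C f = a" "Cod C f = b"
  shows "f \<boxplus> Zero C a b = f" "Zero C a b \<boxplus> f = f"
proof -
  interpret G: comm_group "hom_group C (Dom C f) (Cod C f)" by (rule hom_comm_group) (use assms in auto)
  show "f \<boxplus> Zero C a b = f" "Zero C a b \<boxplus> f = f"
    using G.r_one[of f] G.l_one[of f] assms unfolding hom_group_simps by auto
qed

lemma add_assoc:
  assumes "f \<in> Arr C" "g \<in> Arr C" "h \<in> Arr C" "Dom C g = Dom C f" "Cod C g = Cod C f"
    "Dom C h = Dom C f" "Cod C h = Cod C f"
  shows "(f \<boxplus> g) \<boxplus> h = f \<boxplus> (g \<boxplus> h)"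
proof -
  interpret G: comm_group "hom_group C (Dom C f) (Cod C f)" by (rule hom_comm_group) (use assms in auto)
  show ?thesis
    using G.m_assoc[of f g h] assms unfolding hom_group_simps by auto
qed

lemma add_comm:
  assumes "f \<in> Arr C" "g \<in> Arr C" "Dom C g = Dom C f" "Cod C g = Cod C f"
  shows "f \<boxplus> g = g \<boxplus> f"
proof -
  interpret G: comm_group "hom_group C (Dom C f) (Cod C f)" by (rule hom_comm_group) (use assms in auto)
  show ?thesis
    using G.m_comm[of f g] assms unfolding hom_group_simps by auto
qed

lemma add_left_comm:
  assumes "f \<in> Arr C" "g \<in> Arr C" "h \<in> Arr C" "Dom C g = Dom C f" "Cod C g = Cod C f"
    "Dom C h = Dom C f" "Cod C h = Cod C f"
  shows "f \<boxplus> (g \<boxplus> h) = g \<boxplus> (f \<boxplus> h)"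
  using assms add_assoc[of f g h] add_assoc[of g f h] add_comm[of f g] by simp

lemmas add_ac = add_assoc add_comm add_left_comm

lemma add_neg_cancel [simp]:
  assumes "f \<in> Arr C" "g \<in> Arr C" "Dom C g = Dom C f" "Cod C g = Cod C f"
  shows "f \<boxplus> (neg f \<boxplus> g) = g" "neg f \<boxplus> (f \<boxplus> g) = g"
  using assms add_assoc[of f "neg f" g] add_assoc[of "neg f" f g] by simp_all

lemma add_left_cancel:
  assumes "f \<in> Arr C" "g \<in> Arr C" "h \<in> Arr C" "Dom C g = Dom C f" "Cod C g = Cod C f"
    "Dom C h = Dom C f" "Cod C h = Cod C f"
  shows "f \<boxplus> g = f \<boxplus> h \<longleftrightarrow> g = h"
  using assms add_neg_cancel(2)[of f g] add_neg_cancel(2)[of f h] by metis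

lemma neg_unique:
  assumes "f \<in> Arr C" "g \<in> Arr C" "Dom C g = Dom C f" "Cod C g = Cod C f"
    "f \<boxplus> g = Zero C (Dom C f) (Cod C f)"
  shows "g = neg f"
  using assms add_left_cancel[of f g "neg f"] by simp

lemma neg_neg [simp]: "f \<in> Arr C \<Longrightarrow> neg (neg f) = f"
  using neg_unique[of "neg f" f] by simp

lemma sub_eq_zero:
  assumes "f \<in> Arr C" "g \<in> Arr C" "Dom C g = Dom C f" "Cod C g = Cod C f"
    "f \<boxplus> neg g = Zero C (Dom C f) (Cod C f)"
  shows "f = g"
  using assms neg_unique[of f "neg g"] by (metis neg_arr(1-3) neg_neg)

lemma comp_add_arr [simp]:
  assumes "f \<in> Arr C" "f' \<in> Arr C" "Dom C f' = Dom C f" "Cod C f' = Cod C f"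
  shows "g \<in> Arr C \<Longrightarrow> Dom C g = Cod C f \<Longrightarrow> g \<cdot> (f \<boxplus> f') = (g \<cdot> f) \<boxplus> (g \<cdot> f')"
    and "h \<in> Arr C \<Longrightarrow> Dom C f = Cod C h \<Longrightarrow> (f \<boxplus> f') \<cdot> h = (f \<cdot> h) \<boxplus> (f' \<cdot> h)"
  using comp_add_right[of f "Dom C f" "Cod C f" f' g "Cod C g"]
    comp_add_left[of h "Dom C h" "Cod C h" f "Cod C f" f'] assms by auto

text \<open>Bilinearity is assumed for sums only. Composing with 0 + 0 = 0 and cancelling in the
  hom-group yields the case of zero.\<close>

lemma comp_zero_arr [simp]:
  assumes "f \<in> Arr C"
  shows "a \<in> Obj C \<Longrightarrow> Dom C f = b \<Longrightarrow> f \<cdot> Zero C a b = Zero C a (Cod C f)"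
    and "d \<in> Obj C \<Longrightarrow> Cod C f = c \<Longrightarrow> Zero C c d \<cdot> f = Zero C (Dom C f) d"
proof -
  assume a: "a \<in> Obj C" "Dom C f = b"
  let ?z = "Zero C a b"
  have ob: "b \<in> Obj C" using a(2) assms by auto
  have "f \<cdot> (?z \<boxplus> ?z) = f \<cdot> ?z" using a ob assms by (subst add_zero) auto
  then have "(f \<cdot> ?z) \<boxplus> (f \<cdot> ?z) = (f \<cdot> ?z) \<boxplus> Zero C a (Cod C f)"
    using a ob assms by (subst (asm) comp_add_arr(1)) auto
  then show "f \<cdot> ?z = Zero C a (Cod C f)"
    using a ob assms by (subst (asm) add_left_cancel) auto
next
  assume a: "d \<in> Obj C" "Cod C f = c"
  let ?z = "Zero C c d"
  have ob: "c \<in> Obj C" using a(2) assms by auto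
  have "(?z \<boxplus> ?z) \<cdot> f = ?z \<cdot> f" using a ob assms by (subst add_zero) auto
  then have "(?z \<cdot> f) \<boxplus> (?z \<cdot> f) = (?z \<cdot> f) \<boxplus> Zero C (Dom C f) d"
    using a ob assms by (subst (asm) comp_add_arr(2)) auto
  then show "?z \<cdot> f = Zero C (Dom C f) d"
    using a ob assms by (subst (asm) add_left_cancel) auto
qed

lemma comp_neg_arr [simp]:
  assumes "f \<in> Arr C" "g \<in> Arr C" "Dom C g = Cod C f"
  shows "g \<cdot> neg f = neg (g \<cdot> f)" "neg g \<cdot> f = neg (g \<cdot> f)"
proof -
  have "g \<cdot> (f \<boxplus> neg f) = (g \<cdot> f) \<boxplus> (g \<cdot> neg f)" using assms by (subst comp_add_arr(1)) auto
  from this show "g \<cdot> neg f = neg (g \<cdot> f)" using assms by - (rule neg_unique, auto)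
  have "(g \<boxplus> neg g) \<cdot> f = (g \<cdot> f) \<boxplus> (neg g \<cdot> f)" using assms by (subst comp_add_arr(2)) auto
  from this show "neg g \<cdot> f = neg (g \<cdot> f)" using assms by - (rule neg_unique, auto)
qed

text \<open>Cancelling \<open>s\<close> against \<open>t\<close> is the zero test applied to their
  difference.\<close>

lemma mono_iff_zero:
  "is_mono C f \<longleftrightarrow> f \<in> Arr C \<and>
     (\<forall>s\<in>Arr C. Cod C s = Dom C f \<longrightarrow> f \<cdot> s = Zero C (Dom C s) (Cod C f) \<longrightarrow>
        s = Zero C (Dom C s) (Dom C f))"
  (is "_ \<longleftrightarrow> _ \<and> ?R")
proof (intro iffI conjI ballI impI)
  fix s assume f: "is_mono C f" and s: "s \<in> Arr C" "Cod C s = Dom C f"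
    "f \<cdot> s = Zero C (Dom C s) (Cod C f)"
  show "s = Zero C (Dom C s) (Dom C f)"
    by (rule mono_cancel[OF f, of _ "Dom C s"]) (use s mono_arr[OF f] in auto)
next
  assume R: "f \<in> Arr C \<and> ?R"
  show "is_mono C f"
    unfolding is_mono_def
  proof (intro conjI allI ballI impI)
    fix a s t assume st: "s \<in> Hom C a (Dom C f)" "t \<in> Hom C a (Dom C f)" "f \<cdot> s = f \<cdot> t"
    have f: "f \<in> Arr C" using R by blast
    have "f \<cdot> (s \<boxplus> neg t) = Zero C (Dom C (s \<boxplus> neg t)) (Cod C f)"
      using st f by auto
    then have "s \<boxplus> neg t = Zero C (Dom C (s \<boxplus> neg t)) (Dom C f)"
      by (rule R[THEN conjunct2, rule_format, rotated 2]) (use st f in auto)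
    from this st show "s = t" by - (rule sub_eq_zero, auto)
  qed (use R in auto)
qed (auto simp: mono_arr)

lemma epi_iff_zero:
  "is_epi C f \<longleftrightarrow> f \<in> Arr C \<and>
     (\<forall>s\<in>Arr C. Dom C s = Cod C f \<longrightarrow> s \<cdot> f = Zero C (Dom C f) (Cod C s) \<longrightarrow>
        s = Zero C (Cod C f) (Cod C s))"
  (is "_ \<longleftrightarrow> _ \<and> ?R")
proof (intro iffI conjI ballI impI)
  fix s assume f: "is_epi C f" and s: "s \<in> Arr C" "Dom C s = Cod C f"
    "s \<cdot> f = Zero C (Dom C f) (Cod C s)"
  show "s = Zero C (Cod C f) (Cod C s)"
    by (rule epi_cancel[OF f, of _ "Cod C s"]) (use s epi_arr[OF f] in auto)
next
  assume R: "f \<in> Arr C \<and> ?R"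
  show "is_epi C f"
    unfolding is_epi_def
  proof (intro conjI allI ballI impI)
    fix b s t assume st: "s \<in> Hom C (Cod C f) b" "t \<in> Hom C (Cod C f) b" "s \<cdot> f = t \<cdot> f"
    have f: "f \<in> Arr C" using R by blast
    have "(s \<boxplus> neg t) \<cdot> f = Zero C (Dom C f) (Cod C (s \<boxplus> neg t))"
      using st f by auto
    then have "s \<boxplus> neg t = Zero C (Cod C f) (Cod C (s \<boxplus> neg t))"
      by (rule R[THEN conjunct2, rule_format, rotated 2]) (use st f in auto)
    from this st show "s = t" by - (rule sub_eq_zero, auto)
  qed (use R in auto)
qed (auto simp: epi_arr)

text \<open>Since \<open>k\<close> is mono, factorizations through it are unique, and only their
  existence is left to check.\<close>

lemma is_kernelI:
  assumes "is_mono C k" "k \<in> Hom C d a" "f \<in> Hom C a b" "f \<cdot> k = Zero C d b"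
    and "\<And>c t. t \<in> Hom C c a \<Longrightarrow> f \<cdot> t = Zero C c b \<Longrightarrow> \<exists>u\<in>Hom C c d. k \<cdot> u = t"
  shows "is_kernel C k f"
  unfolding is_kernel_def
proof (intro conjI allI ballI impI)
  fix c t assume t: "t \<in> Hom C c (Dom C f)" "f \<cdot> t = Zero C c (Cod C f)"
  have "t \<in> Hom C c a" "f \<cdot> t = Zero C c b" using t assms(3) by auto
  from assms(5)[OF this] obtain u where u: "u \<in> Hom C c d" "k \<cdot> u = t" by blast
  then show "\<exists>!u. u \<in> Hom C c (Dom C k) \<and> k \<cdot> u = t"
    using assms(2) mono_cancel[OF assms(1), of _ c] by (intro ex1I[of _ u]) auto
qed (use assms in auto)

lemma is_cokernelI:
  assumes "is_epi C k" "k \<in> Hom C b d" "f \<in> Hom C a b" "k \<cdot> f = Zero C a d"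
    and "\<And>c t. t \<in> Hom C b c \<Longrightarrow> t \<cdot> f = Zero C a c \<Longrightarrow> \<exists>u\<in>Hom C d c. u \<cdot> k = t"
  shows "is_cokernel C k f"
  unfolding is_cokernel_def
proof (intro conjI allI ballI impI)
  fix c t assume t: "t \<in> Hom C (Cod C f) c" "t \<cdot> f = Zero C (Dom C f) c"
  have "t \<in> Hom C b c" "t \<cdot> f = Zero C a c" using t assms(3) by auto
  from assms(5)[OF this] obtain u where u: "u \<in> Hom C d c" "u \<cdot> k = t" by blast
  then show "\<exists>!u. u \<in> Hom C (Cod C k) c \<and> u \<cdot> k = t"
    using assms(2) epi_cancel[OF assms(1), of _ c] by (intro ex1I[of _ u]) auto
qed (use assms in auto)

lemma kernel_mono: "is_kernel C k f \<Longrightarrow> is_mono C k"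
  unfolding is_mono_def
proof (intro conjI allI ballI impI)
  fix a s t assume k: "is_kernel C k f" and st: "s \<in> Hom C a (Dom C k)" "t \<in> Hom C a (Dom C k)"
    "k \<cdot> s = k \<cdot> t"
  have kf: "k \<in> Arr C" "f \<in> Arr C" "Cod C k = Dom C f" "f \<cdot> k = Zero C (Dom C k) (Cod C f)"
    using k unfolding is_kernel_def by auto
  have "f \<cdot> (k \<cdot> s) = (f \<cdot> k) \<cdot> s" using kf(1-3) st by auto
  also have "\<dots> = Zero C a (Cod C f)" unfolding kf(4) using kf(1-3) st by auto
  finally have "\<exists>!u. u \<in> Hom C a (Dom C k) \<and> k \<cdot> u = k \<cdot> s"
    using k kf st unfolding is_kernel_def by auto
  then show "s = t" using st(1,2) st(3)[symmetric] by (elim ex1E) metis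
qed (auto simp: is_kernel_def)

lemma cokernel_epi: "is_cokernel C c f \<Longrightarrow> is_epi C c"
  unfolding is_epi_def
proof (intro conjI allI ballI impI)
  fix a s t assume k: "is_cokernel C c f" and st: "s \<in> Hom C (Cod C c) a" "t \<in> Hom C (Cod C c) a"
    "s \<cdot> c = t \<cdot> c"
  have kf: "c \<in> Arr C" "f \<in> Arr C" "Dom C c = Cod C f" "c \<cdot> f = Zero C (Dom C f) (Cod C c)"
    using k unfolding is_cokernel_def by auto
  have "(s \<cdot> c) \<cdot> f = Zero C (Dom C f) a" using kf st by auto
  then have "\<exists>!u. u \<in> Hom C (Cod C c) a \<and> u \<cdot> c = s \<cdot> c"
    using k kf(1-3) st unfolding is_cokernel_def by auto
  then show "s = t" using st(1,2) st(3)[symmetric] by (elim ex1E) metis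
qed (auto simp: is_cokernel_def)

lemma comp_mono:
  assumes "is_mono C f" "is_mono C g" "Dom C g = Cod C f"
  shows "is_mono C (g \<cdot> f)"
  unfolding is_mono_def
proof (intro conjI allI ballI impI)
  fix a s t assume st: "s \<in> Hom C a (Dom C (g \<cdot> f))" "t \<in> Hom C a (Dom C (g \<cdot> f))"
    "(g \<cdot> f) \<cdot> s = (g \<cdot> f) \<cdot> t"
  note fg = mono_arr[OF assms(1)] mono_arr[OF assms(2)] assms(3)
  have "f \<cdot> s = f \<cdot> t" using st fg by - (rule mono_cancel[OF assms(2), of _ a], auto)
  then show "s = t" using st fg by - (rule mono_cancel[OF assms(1), of _ a], auto)
qed (use assms mono_arr in auto)

lemma comp_epi:
  assumes "is_epi C f" "is_epi C g" "Dom C g = Cod C f"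
  shows "is_epi C (g \<cdot> f)"
  unfolding is_epi_def
proof (intro conjI allI ballI impI)
  fix a s t assume st: "s \<in> Hom C (Cod C (g \<cdot> f)) a" "t \<in> Hom C (Cod C (g \<cdot> f)) a"
    "s \<cdot> (g \<cdot> f) = t \<cdot> (g \<cdot> f)"
  note fg = epi_arr[OF assms(1)] epi_arr[OF assms(2)] assms(3)
  have "s \<cdot> g = t \<cdot> g" using st fg by - (rule epi_cancel[OF assms(1), of _ a], auto)
  then show "s = t" using st fg by - (rule epi_cancel[OF assms(2), of _ a], auto)
qed (use assms epi_arr in auto)

lemma mono_right:
  assumes "is_mono C (g \<cdot> f)" "f \<in> Arr C" "g \<in> Arr C" "Dom C g = Cod C f"
  shows "is_mono C f"
  unfolding is_mono_def
proof (intro conjI allI ballI impI)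
  fix a s t assume st: "s \<in> Hom C a (Dom C f)" "t \<in> Hom C a (Dom C f)" "f \<cdot> s = f \<cdot> t"
  then show "s = t" using assms by - (rule mono_cancel[OF assms(1), of _ a], auto)
qed (use assms in auto)

lemma epi_left:
  assumes "is_epi C (g \<cdot> f)" "f \<in> Arr C" "g \<in> Arr C" "Dom C g = Cod C f"
  shows "is_epi C g"
  unfolding is_epi_def
proof (intro conjI allI ballI impI)
  fix a s t assume st: "s \<in> Hom C (Cod C g) a" "t \<in> Hom C (Cod C g) a" "s \<cdot> g = t \<cdot> g"
  have "(s \<cdot> g) \<cdot> f = (t \<cdot> g) \<cdot> f" using st(3) by simp
  then have "s \<cdot> (g \<cdot> f) = t \<cdot> (g \<cdot> f)" using st(1,2) assms(2-4) by (subst (asm) (1 2) comp_assoc_arr) auto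
  then show "s = t" using assms st by - (rule epi_cancel[OF assms(1), of _ a], auto)
qed (use assms in auto)

lemma id_mono: "a \<in> Obj C \<Longrightarrow> is_mono C (Id C a)" and id_epi: "a \<in> Obj C \<Longrightarrow> is_epi C (Id C a)"
  unfolding is_mono_def is_epi_def by auto

text \<open>Every arrow into or out of \<open>z\<close> absorbs the identity of \<open>z\<close>;
  once that is zero, so is the arrow.\<close>

lemma is_zero_iff:
  "is_zero C z \<longleftrightarrow> z \<in> Obj C \<and> Id C z = Zero C z z"
proof
  assume "is_zero C z"
  then have z: "z \<in> Obj C" "\<exists>!f. f \<in> Hom C z z" unfolding is_zero_def by auto
  moreover have "Id C z \<in> Hom C z z" "Zero C z z \<in> Hom C z z" using z(1) by auto
  ultimately show "z \<in> Obj C \<and> Id C z = Zero C z z" by blast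
next
  assume z: "z \<in> Obj C \<and> Id C z = Zero C z z"
  have 1: "f = Zero C z a" if "f \<in> Hom C z a" for f a
  proof -
    have "f = f \<cdot> Id C z" using that by auto
    also have "\<dots> = Zero C z a" using z that by auto
    finally show ?thesis .
  qed
  have 2: "f = Zero C a z" if "f \<in> Hom C a z" for f a
  proof -
    have "f = Id C z \<cdot> f" using that by auto
    also have "\<dots> = Zero C a z" using z that by auto
    finally show ?thesis .
  qed
  show "is_zero C z" unfolding is_zero_def
  proof (intro conjI ballI)
    fix a assume a: "a \<in> Obj C"
    show "\<exists>!f. f \<in> Hom C z a" using 1[of _ a] a z by (intro ex1I[of _ "Zero C z a"]) auto
    show "\<exists>!f. f \<in> Hom C a z" using 2[of _ a] a z by (intro ex1I[of _ "Zero C a z"]) auto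
  qed (use z in auto)
qed

lemma zero_obj_arr:
  assumes "is_zero C z"
  shows "f \<in> Hom C z a \<Longrightarrow> f = Zero C z a" "f \<in> Hom C a z \<Longrightarrow> f = Zero C a z"
  using assms unfolding is_zero_def by (metis Hom_iff zero_arr)+

lemma ker_fact:
  assumes "is_kernel C k f" "k \<in> Hom C d a" "f \<in> Hom C a b" "t \<in> Hom C c a"
    "f \<cdot> t = Zero C c b"
  obtains u where "u \<in> Hom C c d" "k \<cdot> u = t"
  by (rule kernel_factor[OF assms(1), of t c]) (use assms that in auto)

lemma coker_fact:
  assumes "is_cokernel C k f" "k \<in> Hom C b d" "f \<in> Hom C a b" "t \<in> Hom C b c"
    "t \<cdot> f = Zero C a c"
  obtains u where "u \<in> Hom C d c" "u \<cdot> k = t"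
  by (rule cokernel_factor[OF assms(1), of t c]) (use assms that in auto)

lemma neg_zero [simp]: "a \<in> Obj C \<Longrightarrow> b \<in> Obj C \<Longrightarrow> neg (Zero C a b) = Zero C a b"
  by (rule neg_unique[symmetric]) auto

lemma sub_eq:
  assumes "f \<boxplus> neg g = h" "f \<in> Arr C" "g \<in> Arr C" "Dom C g = Dom C f" "Cod C g = Cod C f"
  shows "f = h \<boxplus> g"
  using assms(2-5) unfolding assms(1)[symmetric] by (simp add: add_assoc)

end

section \<open>Images, exactness, biproducts, pullbacks and filtrations in an abelian
  category\<close>

context abelian_category
begin

text \<open>A mono is the kernel of some \<open>g\<close>, and \<open>g\<close> factors through the
  cokernel \<open>c\<close>. Whatever \<open>c\<close> kills is then killed by \<open>g\<close> and
  factors through \<open>i\<close>.\<close>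

lemma mono_kernel_of_cokernel:
  assumes "is_mono C i" "is_cokernel C c i"
  shows "is_kernel C i c"
proof -
  obtain g where g: "is_kernel C i g" using mono_normal assms(1) by blast
  have T: "i \<in> Arr C" "g \<in> Arr C" "Cod C i = Dom C g" "c \<in> Arr C" "Dom C c = Cod C i"
    and z: "g \<cdot> i = Zero C (Dom C i) (Cod C g)" "c \<cdot> i = Zero C (Dom C i) (Cod C c)"
    using g assms(2) unfolding is_kernel_def is_cokernel_def by auto
  obtain g' where g': "g' \<in> Hom C (Cod C c) (Cod C g)" "g' \<cdot> c = g"
    by (rule cokernel_factor[OF assms(2), of g "Cod C g"]) (use T z in auto)
  show ?thesis
  proof (rule is_kernelI[OF assms(1), of "Dom C i" "Cod C i" c "Cod C c"])
    fix a t assume t: "t \<in> Hom C a (Cod C i)" "c \<cdot> t = Zero C a (Cod C c)"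
    have "g \<cdot> t = g' \<cdot> (c \<cdot> t)" using g' t(1) T by (subst comp_assoc_arr[symmetric]) auto
    then have "g \<cdot> t = Zero C a (Cod C g)" using t g' T by auto
    then show "\<exists>u\<in>Hom C a (Dom C i). i \<cdot> u = t"
      using kernel_factor[OF g, of t a] t T by (metis Hom_iff)
  qed (use T z in auto)
qed

lemma epi_cokernel_of_kernel:
  assumes "is_epi C e" "is_kernel C k e"
  shows "is_cokernel C e k"
proof -
  obtain g where g: "is_cokernel C e g" using epi_normal assms(1) by blast
  have T: "e \<in> Arr C" "g \<in> Arr C" "Dom C e = Cod C g" "k \<in> Arr C" "Cod C k = Dom C e"
    and z: "e \<cdot> g = Zero C (Dom C g) (Cod C e)" "e \<cdot> k = Zero C (Dom C k) (Cod C e)"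
    using g assms(2) unfolding is_kernel_def is_cokernel_def by auto
  obtain g' where g': "g' \<in> Hom C (Dom C g) (Dom C k)" "k \<cdot> g' = g"
    by (rule kernel_factor[OF assms(2), of g "Dom C g"]) (use T z in auto)
  show ?thesis
  proof (rule is_cokernelI[OF assms(1), of "Dom C e" "Cod C e" k "Dom C k"])
    fix a t assume t: "t \<in> Hom C (Dom C e) a" "t \<cdot> k = Zero C (Dom C k) a"
    have "t \<cdot> g = (t \<cdot> k) \<cdot> g'" using g' t(1) T by auto
    then have "t \<cdot> g = Zero C (Dom C g) a" unfolding t(2) using t(1) g' T by auto
    then show "\<exists>u\<in>Hom C (Cod C e) a. u \<cdot> e = t"
      using cokernel_factor[OF g, of t a] t T by (metis Hom_iff)
  qed (use T z in auto)
qed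

text \<open>Let \<open>f\<close> be a kernel of \<open>h\<close>. As \<open>f\<close> is epi,
  \<open>h\<close> is zero, so the identity factors through \<open>f\<close>. This gives a right
  inverse, which is two-sided because \<open>f\<close> is mono.\<close>

lemma mono_epi_iso:
  assumes "is_mono C f" "is_epi C f"
  obtains g where "g \<in> Hom C (Cod C f) (Dom C f)" "g \<cdot> f = Id C (Dom C f)" "f \<cdot> g = Id C (Cod C f)"
proof -
  obtain h where h: "is_kernel C f h" using mono_normal assms(1) by blast
  have T: "f \<in> Arr C" "h \<in> Arr C" "Dom C h = Cod C f" and z: "h \<cdot> f = Zero C (Dom C f) (Cod C h)"
    using h unfolding is_kernel_def by auto
  have "h = Zero C (Cod C f) (Cod C h)"
    using assms(2) T z unfolding epi_iff_zero by auto
  then have "h \<cdot> Id C (Cod C f) = Zero C (Cod C f) (Cod C h)"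
    using T by auto
  then obtain u where u: "u \<in> Hom C (Cod C f) (Dom C f)" "f \<cdot> u = Id C (Cod C f)"
    using kernel_factor[OF h, of "Id C (Cod C f)" "Cod C f"] T by (metis id_hom obj_simps(2))
  have "f \<cdot> (u \<cdot> f) = (f \<cdot> u) \<cdot> f" using u(1) T by simp
  also have "\<dots> = f \<cdot> Id C (Dom C f)" using u T by simp
  finally have "u \<cdot> f = Id C (Dom C f)"
    by (rule mono_cancel[OF assms(1), of _ "Dom C f", rotated 2]) (use u T in auto)
  then show ?thesis using u that by blast
qed

text \<open>The image is the kernel of the cokernel. The work is in showing that the induced
  \<open>q\<close> is epi.\<close>

lemma image_fact_exists:
  assumes f: "f \<in> Arr C"
  shows "\<exists>qi. is_image_fact C f qi"
proof -
  obtain c where c: "is_cokernel C c f" using ex_cokernel f by blast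
  have cT: "c \<in> Arr C" "Dom C c = Cod C f" and cz: "c \<cdot> f = Zero C (Dom C f) (Cod C c)"
    using c unfolding is_cokernel_def by auto
  obtain i where i: "is_kernel C i c" using ex_kernel cT by blast
  have iT: "i \<in> Arr C" "Cod C i = Cod C f" and iz: "c \<cdot> i = Zero C (Dom C i) (Cod C c)"
    using i cT unfolding is_kernel_def by auto
  obtain q where q: "q \<in> Hom C (Dom C f) (Dom C i)" "i \<cdot> q = f"
    by (rule kernel_factor[OF i, of f "Dom C f"]) (use f cT cz in auto)
  have "is_epi C q"
    unfolding epi_iff_zero
  proof (intro conjI ballI impI)
    fix t assume t: "t \<in> Arr C" "Dom C t = Cod C q" "t \<cdot> q = Zero C (Dom C q) (Cod C t)"
    obtain k where k: "is_kernel C k t" using ex_kernel t by blast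
    have kT: "k \<in> Arr C" "Cod C k = Dom C t" and kz: "t \<cdot> k = Zero C (Dom C k) (Cod C t)"
      using k unfolding is_kernel_def by auto
    obtain q' where q': "q' \<in> Hom C (Dom C f) (Dom C k)" "k \<cdot> q' = q"
      by (rule kernel_factor[OF k, of q "Dom C f"]) (use t q in auto)
    \<comment> \<open>Here \<open>f\<close> factors through the smaller subobject
      \<open>i \<cdot> k\<close>, a kernel of some \<open>h\<close>. Then \<open>h\<close> kills
      \<open>f\<close>, factors through the cokernel and kills \<open>i\<close> too. So
      \<open>i\<close> factors through \<open>i \<cdot> k\<close>, which splits \<open>k\<close> and
      forces \<open>t\<close> to vanish.\<close>
    have "is_mono C (i \<cdot> k)"
      by (rule comp_mono) (use kernel_mono k i kT q t in auto)
    then obtain h where h: "is_kernel C (i \<cdot> k) h" using mono_normal by blast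
    have hT: "h \<in> Arr C" "Dom C h = Cod C f" and hz: "h \<cdot> (i \<cdot> k) = Zero C (Dom C k) (Cod C h)"
      using h iT kT q t unfolding is_kernel_def by auto
    have "h \<cdot> f = (h \<cdot> (i \<cdot> k)) \<cdot> q'" using q q' iT kT t hT by auto
    also have "\<dots> = Zero C (Dom C f) (Cod C h)" unfolding hz using q' kT hT by auto
    finally obtain h' where h': "h' \<in> Hom C (Cod C c) (Cod C h)" "h' \<cdot> c = h"
      by (rule cokernel_factor[OF c, of h "Cod C h", rotated]) (use f hT in auto)
    have "h \<cdot> i = h' \<cdot> (c \<cdot> i)" unfolding h'(2)[symmetric] using h'(1) cT iT by auto
    also have "\<dots> = Zero C (Dom C i) (Cod C h)" unfolding iz using h' cT iT by auto
    finally obtain v where v': "v \<in> Hom C (Dom C i) (Dom C (i \<cdot> k))" "(i \<cdot> k) \<cdot> v = i"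
      by (rule kernel_factor[OF h, of i "Dom C i", rotated]) (use iT hT hz q f in auto)
    have v: "v \<in> Hom C (Dom C i) (Dom C k)" using v' iT kT q t by auto
    have "i \<cdot> (k \<cdot> v) = i \<cdot> Id C (Dom C i)" using v v'(2) iT kT q t by auto
    then have kv: "k \<cdot> v = Id C (Dom C i)"
      by (rule mono_cancel[OF kernel_mono[OF i], of _ "Dom C i", rotated 2])
        (use iT v kT q t in auto)
    have "t = t \<cdot> (k \<cdot> v)" unfolding kv using t q by auto
    also have "\<dots> = (t \<cdot> k) \<cdot> v" using t kT v by auto
    also have "\<dots> = Zero C (Cod C q) (Cod C t)" unfolding kz using v q t kT by auto
    finally show "t = Zero C (Cod C q) (Cod C t)" .
  qed (use q in auto)
  then show ?thesis
    using q f iT kernel_mono[OF i] by (intro exI[of _ "(q, i)"]) (auto simp: is_image_fact_def)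
qed

lemma image_fact_obtain:
  assumes "f \<in> Arr C"
  obtains q i where "is_epi C q" "is_mono C i" "q \<in> Hom C (Dom C f) (Dom C i)"
    "i \<in> Hom C (Dom C i) (Cod C f)" "i \<cdot> q = f" "is_image_fact C f (q, i)"
proof -
  obtain q i where qi: "is_image_fact C f (q, i)" using image_fact_exists[OF assms] by auto
  then show ?thesis using that[of q i] assms
    by (auto simp: is_image_fact_def mono_arr epi_arr)
qed

lemma exactE:
  assumes "exact_at C f g"
  obtains q i where "is_epi C q" "is_mono C i" "q \<in> Hom C (Dom C f) (Dom C i)"
    "i \<in> Hom C (Dom C i) (Cod C f)" "i \<cdot> q = f" "is_kernel C i g"
proof -
  obtain q i where qi: "is_image_fact C f (q, i)" "is_kernel C i g"
    using assms unfolding exact_at_def by blast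
  have "f \<in> Arr C" using assms unfolding exact_at_def by blast
  then show ?thesis using that[of q i] qi
    by (auto simp: is_image_fact_def mono_arr epi_arr)
qed

lemma exact_arr:
  assumes "exact_at C f g"
  shows "f \<in> Arr C" "g \<in> Arr C" "Dom C g = Cod C f" "g \<cdot> f = Zero C (Dom C f) (Cod C g)"
proof -
  show T: "f \<in> Arr C" "g \<in> Arr C" "Dom C g = Cod C f" using assms unfolding exact_at_def by auto
  obtain q i where q: "is_epi C q" "is_mono C i" "q \<in> Hom C (Dom C f) (Dom C i)"
    "i \<in> Hom C (Dom C i) (Cod C f)" "i \<cdot> q = f" "is_kernel C i g"
    by (rule exactE[OF assms])
  have z: "g \<cdot> i = Zero C (Dom C i) (Cod C g)" using q(6) unfolding is_kernel_def by blast
  have "g \<cdot> f = (g \<cdot> i) \<cdot> q" unfolding q(5)[symmetric] using q(3,4) T by auto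
  then show "g \<cdot> f = Zero C (Dom C f) (Cod C g)" unfolding z using q(3) T by auto
qed

text \<open>Exactness is formulated through an image factorization of \<open>f\<close>. When
  \<open>f\<close> is mono, its epi part \<open>q\<close> is mono as well, hence invertible, and
  \<open>f\<close> inherits the kernel property of the image.\<close>

lemma ses_kernel:
  assumes "ses C f g"
  shows "is_kernel C f g"
proof -
  have s: "is_mono C f" "is_epi C g" "exact_at C f g" using assms unfolding ses_def by auto
  obtain q i where q: "is_epi C q" "is_mono C i" "q \<in> Hom C (Dom C f) (Dom C i)"
    "i \<in> Hom C (Dom C i) (Cod C f)" "i \<cdot> q = f" "is_kernel C i g"
    by (rule exactE[OF s(3)])
  have T: "f \<in> Arr C" "g \<in> Arr C" "Dom C g = Cod C f" "g \<cdot> f = Zero C (Dom C f) (Cod C g)"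
    using exact_arr[OF s(3)] by auto
  have "is_mono C q" by (rule mono_right[of i]) (use q s T in auto)
  then obtain r where r: "r \<in> Hom C (Dom C i) (Dom C f)" "q \<cdot> r = Id C (Dom C i)"
    using mono_epi_iso[of q] q by auto
  show ?thesis
  proof (rule is_kernelI[OF s(1), of "Dom C f" "Cod C f" g "Cod C g"])
    fix a t assume t: "t \<in> Hom C a (Cod C f)" "g \<cdot> t = Zero C a (Cod C g)"
    obtain u where u: "u \<in> Hom C a (Dom C i)" "i \<cdot> u = t"
      by (rule kernel_factor[OF q(6), of t a]) (use t T in auto)
    have "f \<cdot> (r \<cdot> u) = i \<cdot> ((q \<cdot> r) \<cdot> u)" unfolding q(5)[symmetric] using q(3,4) r(1) u(1) by auto
    then have "f \<cdot> (r \<cdot> u) = t" unfolding r(2) using u by auto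
    then show "\<exists>v\<in>Hom C a (Dom C f). f \<cdot> v = t" using r(1) u(1) by (intro bexI[of _ "r \<cdot> u"]) auto
  qed (use T in auto)
qed

lemma ses_cokernel: "ses C f g \<Longrightarrow> is_cokernel C g f"
  using ses_kernel epi_cokernel_of_kernel unfolding ses_def by blast

lemma mono_exact:
  assumes "is_kernel C f g"
  shows "exact_at C f g"
proof -
  have "f \<in> Arr C" "g \<in> Arr C" "Cod C f = Dom C g" using assms unfolding is_kernel_def by auto
  then have "is_image_fact C f (Id C (Dom C f), f)"
    using kernel_mono[OF assms] id_epi unfolding is_image_fact_def by auto
  then show ?thesis using assms unfolding exact_at_def is_kernel_def by blast
qed

lemma kernel_ses: "is_kernel C f g \<Longrightarrow> is_epi C g \<Longrightarrow> ses C f g"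
  using kernel_mono mono_exact unfolding ses_def by blast

lemma cokernel_ses: "is_mono C f \<Longrightarrow> is_cokernel C g f \<Longrightarrow> ses C f g"
  using kernel_ses mono_kernel_of_cokernel cokernel_epi by blast

lemma ses_arr:
  assumes "ses C f g"
  shows "f \<in> Arr C" "g \<in> Arr C" "Dom C g = Cod C f" "g \<cdot> f = Zero C (Dom C f) (Cod C g)"
    "is_mono C f" "is_epi C g" "exact_at C f g"
  using assms exact_arr unfolding ses_def by auto

text \<open>An arrow killing \<open>f\<close> also kills its image, because the epi part of
  \<open>f\<close> cancels. No monicity of \<open>f\<close> enters, so this applies to sequences
  that are only right exact, such as the images under \<open>F\<close>.\<close>

lemma exact_cokernel:
  assumes "exact_at C f g" "is_epi C g"
  shows "is_cokernel C g f"
proof -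
  have T: "f \<in> Arr C" "g \<in> Arr C" "Dom C g = Cod C f" "g \<cdot> f = Zero C (Dom C f) (Cod C g)"
    using exact_arr[OF assms(1)] by auto
  obtain q i where q: "is_epi C q" "is_mono C i" "q \<in> Hom C (Dom C f) (Dom C i)"
    "i \<in> Hom C (Dom C i) (Cod C f)" "i \<cdot> q = f" "is_kernel C i g"
    by (rule exactE[OF assms(1)])
  have c: "is_cokernel C g i" by (rule epi_cokernel_of_kernel[OF assms(2) q(6)])
  show ?thesis
  proof (rule is_cokernelI[OF assms(2), of "Cod C f" "Cod C g" f "Dom C f"])
    fix a t assume t: "t \<in> Hom C (Cod C f) a" "t \<cdot> f = Zero C (Dom C f) a"
    have "(t \<cdot> i) \<cdot> q = Zero C (Dom C i) a \<cdot> q"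
      using t q by auto
    then have "t \<cdot> i = Zero C (Dom C i) a"
      by (rule epi_cancel[OF q(1), of _ a, rotated 2]) (use t q in auto)
    then show "\<exists>u\<in>Hom C (Cod C g) a. u \<cdot> g = t"
      using cokernel_factor[OF c, of t a] t q by (metis Hom_iff)
  qed (use T in auto)
qed

lemma epi_ses:
  assumes "is_epi C e"
  obtains k where "ses C k e"
  using ex_kernel[OF epi_arr[OF assms]] kernel_ses assms by blast

lemma mono_ses:
  assumes "is_mono C k"
  obtains e where "ses C k e"
  using ex_cokernel[OF mono_arr[OF assms]] cokernel_ses assms by blast

lemma coker_obj_spec:
  assumes "f \<in> Arr C"
  obtains c where "is_cokernel C c f" "coker_obj C f = Cod C c"
  using someI_ex[OF ex_cokernel[OF assms]] unfolding coker_obj_def by blast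

lemma cokernel_unique:
  assumes "is_cokernel C c f" "is_cokernel C c' f"
  shows "isomorphic C (Cod C c) (Cod C c')"
proof -
  have T: "c \<in> Arr C" "c' \<in> Arr C" "f \<in> Arr C" "Dom C c = Cod C f" "Dom C c' = Cod C f"
    and z: "c \<cdot> f = Zero C (Dom C f) (Cod C c)" "c' \<cdot> f = Zero C (Dom C f) (Cod C c')"
    using assms unfolding is_cokernel_def by auto
  obtain u where u: "u \<in> Hom C (Cod C c) (Cod C c')" "u \<cdot> c = c'"
    by (rule cokernel_factor[OF assms(1), of c' "Cod C c'"]) (use T z in auto)
  obtain v where v: "v \<in> Hom C (Cod C c') (Cod C c)" "v \<cdot> c' = c"
    by (rule cokernel_factor[OF assms(2), of c "Cod C c"]) (use T z in auto)
  show ?thesis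
  proof (rule isomorphicI[OF u(1) v(1)])
    show "v \<cdot> u = Id C (Cod C c)"
      by (rule epi_cancel[OF cokernel_epi[OF assms(1)], of _ "Cod C c"]) (use u v T in auto)
    show "u \<cdot> v = Id C (Cod C c')"
      by (rule epi_cancel[OF cokernel_epi[OF assms(2)], of _ "Cod C c'"]) (use u v T in auto)
  qed
qed

text \<open>Filtration quotients are phrased with the chosen cokernel \<open>coker_obj\<close>;
  uniqueness of cokernels lets any given short exact sequence compute them.\<close>

lemma coker_obj_ses: "ses C f g \<Longrightarrow> isomorphic C (coker_obj C f) (Cod C g)"
  by (metis coker_obj_spec cokernel_unique ses_arr(1) ses_cokernel)

lemma biprodE:
  assumes "is_biprod C a b (s, i1, i2, p1, p2)"
  shows "a \<in> Obj C" "b \<in> Obj C" "s \<in> Obj C" "i1 \<in> Arr C" "i2 \<in> Arr C" "p1 \<in> Arr C" "p2 \<in> Arr C"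
    "Dom C i1 = a" "Cod C i1 = s" "Dom C i2 = b" "Cod C i2 = s"
    "Dom C p1 = s" "Cod C p1 = a" "Dom C p2 = s" "Cod C p2 = b"
    "p1 \<cdot> i1 = Id C a" "p2 \<cdot> i2 = Id C b" "p1 \<cdot> i2 = Zero C b a" "p2 \<cdot> i1 = Zero C a b"
    "(i1 \<cdot> p1) \<boxplus> (i2 \<cdot> p2) = Id C s"
  using assms unfolding is_biprod_def by auto

lemma biprod_rules:
  assumes "is_biprod C a b (s, i1, i2, p1, p2)" "x \<in> Arr C"
  shows "Cod C x = a \<Longrightarrow> p1 \<cdot> (i1 \<cdot> x) = x" "Cod C x = b \<Longrightarrow> p2 \<cdot> (i2 \<cdot> x) = x"
    "Cod C x = b \<Longrightarrow> p1 \<cdot> (i2 \<cdot> x) = Zero C (Dom C x) a"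
    "Cod C x = a \<Longrightarrow> p2 \<cdot> (i1 \<cdot> x) = Zero C (Dom C x) b"
    "Cod C x = s \<Longrightarrow> (i1 \<cdot> (p1 \<cdot> x)) \<boxplus> (i2 \<cdot> (p2 \<cdot> x)) = x"
proof -
  note B = biprodE[OF assms(1)]
  show "Cod C x = a \<Longrightarrow> p1 \<cdot> (i1 \<cdot> x) = x" "Cod C x = b \<Longrightarrow> p2 \<cdot> (i2 \<cdot> x) = x"
    "Cod C x = b \<Longrightarrow> p1 \<cdot> (i2 \<cdot> x) = Zero C (Dom C x) a"
    "Cod C x = a \<Longrightarrow> p2 \<cdot> (i1 \<cdot> x) = Zero C (Dom C x) b"
    using assoc_eq[OF B(16), of x] assoc_eq[OF B(17), of x] assoc_eq[OF B(18), of x]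
      assoc_eq[OF B(19), of x] B(1-15) assms(2) by auto
  have "((i1 \<cdot> p1) \<boxplus> (i2 \<cdot> p2)) \<cdot> x = (i1 \<cdot> (p1 \<cdot> x)) \<boxplus> (i2 \<cdot> (p2 \<cdot> x))" if "Cod C x = s"
    using B(1-15) assms(2) that by simp
  then show "Cod C x = s \<Longrightarrow> (i1 \<cdot> (p1 \<cdot> x)) \<boxplus> (i2 \<cdot> (p2 \<cdot> x)) = x"
    unfolding B(20) using assms(2) by auto
qed

lemma biprod_eqI:
  assumes "is_biprod C a b (s, i1, i2, p1, p2)" "x \<in> Hom C c s" "y \<in> Hom C c s"
    "p1 \<cdot> x = p1 \<cdot> y" "p2 \<cdot> x = p2 \<cdot> y"
  shows "x = y"
proof -
  have "(i1 \<cdot> (p1 \<cdot> x)) \<boxplus> (i2 \<cdot> (p2 \<cdot> x)) = x" "(i1 \<cdot> (p1 \<cdot> y)) \<boxplus> (i2 \<cdot> (p2 \<cdot> y)) = y"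
    using biprod_rules(5)[OF assms(1)] assms(2,3) by auto
  then show ?thesis unfolding assms(4,5) by metis
qed

lemma biprod_coeqI:
  assumes "is_biprod C a b (s, i1, i2, p1, p2)" "x \<in> Hom C s c" "y \<in> Hom C s c"
    "x \<cdot> i1 = y \<cdot> i1" "x \<cdot> i2 = y \<cdot> i2"
  shows "x = y"
proof -
  note B = biprodE[OF assms(1)]
  have "z = ((z \<cdot> i1) \<cdot> p1) \<boxplus> ((z \<cdot> i2) \<cdot> p2)" if "z \<in> Hom C s c" for z
  proof -
    have "z = z \<cdot> ((i1 \<cdot> p1) \<boxplus> (i2 \<cdot> p2))" using that unfolding B(20) by auto
    also have "\<dots> = ((z \<cdot> i1) \<cdot> p1) \<boxplus> ((z \<cdot> i2) \<cdot> p2)" using that B(1-15) by auto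
    finally show ?thesis .
  qed
  then show ?thesis using assms(2-5) by metis
qed

text \<open>The pullback is the kernel of \<open>g \<cdot> p1\<close> minus
  \<open>h \<cdot> p2\<close> on the biproduct. The last two clauses are existence and uniqueness in
  its universal property.\<close>

lemma pullback_exists:
  assumes g: "g \<in> Hom C a c" and h: "h \<in> Hom C b c"
  obtains d p q where "p \<in> Hom C d a" "q \<in> Hom C d b" "g \<cdot> p = h \<cdot> q"
    "\<And>t x y. x \<in> Hom C t a \<Longrightarrow> y \<in> Hom C t b \<Longrightarrow> g \<cdot> x = h \<cdot> y \<Longrightarrow>
       \<exists>u\<in>Hom C t d. p \<cdot> u = x \<and> q \<cdot> u = y"
    "\<And>t u v. u \<in> Hom C t d \<Longrightarrow> v \<in> Hom C t d \<Longrightarrow> p \<cdot> u = p \<cdot> v \<Longrightarrow> q \<cdot> u = q \<cdot> v \<Longrightarrow> u = v"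
proof -
  have ob: "a \<in> Obj C" "b \<in> Obj C" "c \<in> Obj C" using g h by auto
  obtain s i1 i2 p1 p2 where S: "is_biprod C a b (s, i1, i2, p1, p2)"
    using ex_biprod[OF ob(1,2)] by (metis prod_cases5)
  note B = biprodE[OF S] and R = biprod_rules[OF S]
  let ?D = "(g \<cdot> p1) \<boxplus> neg (h \<cdot> p2)"
  obtain k where k: "is_kernel C k ?D" using ex_kernel[of ?D] g h B(1-15) by auto
  have kT: "k \<in> Arr C" "Cod C k = s" and kz: "?D \<cdot> k = Zero C (Dom C k) c"
    using k B(1-15) g h unfolding is_kernel_def by auto
  show ?thesis
  proof (rule that[of "p1 \<cdot> k" "Dom C k" "p2 \<cdot> k"])
    show "p1 \<cdot> k \<in> Hom C (Dom C k) a" "p2 \<cdot> k \<in> Hom C (Dom C k) b" using B(1-15) kT by auto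
    show "g \<cdot> (p1 \<cdot> k) = h \<cdot> (p2 \<cdot> k)"
      by (rule sub_eq_zero) (use kz B(1-15) kT g h in auto)
  next
    fix t x y assume x: "x \<in> Hom C t a" "y \<in> Hom C t b" "g \<cdot> x = h \<cdot> y"
    have "?D \<cdot> ((i1 \<cdot> x) \<boxplus> (i2 \<cdot> y)) = Zero C t (Cod C ?D)"
      using x g h B(1-15) R by auto
    then obtain u where u: "u \<in> Hom C t (Dom C k)" "k \<cdot> u = (i1 \<cdot> x) \<boxplus> (i2 \<cdot> y)"
      by (rule kernel_factor[OF k, of "(i1 \<cdot> x) \<boxplus> (i2 \<cdot> y)" t, rotated]) (use x g h B(1-15) in auto)
    then show "\<exists>u\<in>Hom C t (Dom C k). (p1 \<cdot> k) \<cdot> u = x \<and> (p2 \<cdot> k) \<cdot> u = y"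
      using B(1-15) R kT x by (intro bexI[of _ u]) auto
  next
    fix t u v assume u: "u \<in> Hom C t (Dom C k)" "v \<in> Hom C t (Dom C k)"
      "(p1 \<cdot> k) \<cdot> u = (p1 \<cdot> k) \<cdot> v" "(p2 \<cdot> k) \<cdot> u = (p2 \<cdot> k) \<cdot> v"
    have "k \<cdot> u = k \<cdot> v" by (rule biprod_eqI[OF S, of _ t]) (use u kT B(1-15) in auto)
    then show "u = v" by (rule mono_cancel[OF kernel_mono[OF k], of _ t, rotated 2]) (use u in auto)
  qed
qed

lemma ses_ker_fact:
  assumes "ses C f g" "f \<in> Hom C a b" "g \<in> Hom C b c" "t \<in> Hom C d b" "g \<cdot> t = Zero C d c"
  obtains u where "u \<in> Hom C d a" "f \<cdot> u = t"
  by (rule ker_fact[OF ses_kernel[OF assms(1)] assms(2-5)])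

lemma ses_coker_fact:
  assumes "ses C f g" "f \<in> Hom C a b" "g \<in> Hom C b c" "t \<in> Hom C b d" "t \<cdot> f = Zero C a d"
  obtains u where "u \<in> Hom C c d" "u \<cdot> g = t"
  by (rule coker_fact[OF ses_cokernel[OF assms(1)] assms(3,2,4,5)])

lemma ses_zero:
  assumes "ses C f g" "f \<in> Hom C a b" "g \<in> Hom C b c"
  shows "g \<cdot> f = Zero C a c" "x \<in> Arr C \<Longrightarrow> Cod C x = a \<Longrightarrow> g \<cdot> (f \<cdot> x) = Zero C (Dom C x) c"
proof -
  show z: "g \<cdot> f = Zero C a c" using ses_arr(4)[OF assms(1)] assms by auto
  show "x \<in> Arr C \<Longrightarrow> Cod C x = a \<Longrightarrow> g \<cdot> (f \<cdot> x) = Zero C (Dom C x) c"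
    using assoc_eq[OF z, of x] assms by auto
qed

lemma ses_iso_right:
  assumes s: "ses C f g" and f: "f \<in> Hom C a b" and g: "g \<in> Hom C b c"
    and i: "i \<in> Hom C c d" "j \<in> Hom C d c" "j \<cdot> i = Id C c" "i \<cdot> j = Id C d"
  shows "ses C f (i \<cdot> g)"
proof (rule cokernel_ses[OF ses_arr(5)[OF s]])
  have "is_epi C i" using epi_left[of i j] i id_epi by auto
  then have e: "is_epi C (i \<cdot> g)" using comp_epi[OF ses_arr(6)[OF s]] g i by auto
  show "is_cokernel C (i \<cdot> g) f"
  proof (rule is_cokernelI[OF e, of b d _ a])
    show "(i \<cdot> g) \<cdot> f = Zero C a d" using ses_zero[OF s f g] f g i(1) by auto
    fix r t assume t: "t \<in> Hom C b r" "t \<cdot> f = Zero C a r"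
    obtain u where u: "u \<in> Hom C c r" "u \<cdot> g = t" by (rule ses_coker_fact[OF s f g t])
    have "(u \<cdot> j) \<cdot> (i \<cdot> g) = u \<cdot> ((j \<cdot> i) \<cdot> g)" using u(1) i(1,2) g by auto
    then have "(u \<cdot> j) \<cdot> (i \<cdot> g) = t" unfolding i(3) using u g by auto
    then show "\<exists>u\<in>Hom C d r. u \<cdot> (i \<cdot> g) = t" using u(1) i(1,2) by (intro bexI[of _ "u \<cdot> j"]) auto
  qed (use f g i in auto)
qed

lemma split_ses:
  assumes s: "ses C f g" and f: "f \<in> Hom C a b" and g: "g \<in> Hom C b c"
    and r: "r \<in> Hom C b a" "r \<cdot> f = Id C a"
  obtains t where "is_biprod C a c (b, f, t, r, g)"
proof -
  note z = ses_zero[OF s f g]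
  \<comment> \<open>The section \<open>t\<close> comes from 1 - f r, which kills \<open>f\<close>
    and hence descends along \<open>g\<close>.\<close>
  have "(Id C b \<boxplus> neg (f \<cdot> r)) \<cdot> f = Zero C a b" using f r by auto
  then obtain t where t: "t \<in> Hom C c b" "t \<cdot> g = Id C b \<boxplus> neg (f \<cdot> r)"
    by (rule ses_coker_fact[OF s f g, rotated]) (use f r g in auto)
  have gt: "g \<cdot> t = Id C c"
    by (rule epi_cancel[OF ses_arr(6)[OF s], of _ c]) (use t z f g r in auto)
  have "r \<cdot> (f \<cdot> r) = r" using assoc_eq[OF r(2), of r] f r(1) by auto
  then have rt: "r \<cdot> t = Zero C c a"
    by - (rule epi_cancel[OF ses_arr(6)[OF s], of _ a], use t z f g r in auto)
  have "(f \<cdot> r) \<boxplus> (t \<cdot> g) = Id C b" unfolding t(2) using f r(1) g by (simp add: add_ac)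
  then show ?thesis using that[of t] gt rt t z f g r unfolding is_biprod_def by auto
qed

text \<open>The class \<open>coresolved\<close>, cut into short exact sequences so that one can
  induct on the length. At length 0 it is \<open>M\<close> itself; agreement with
  \<open>coresolved\<close> there uses that \<open>M\<close> is closed under isomorphism.\<close>

primrec cores :: "'a set \<Rightarrow> nat \<Rightarrow> 'a set" where
  "cores M 0 = M"
| "cores M (Suc m) =
     {a. \<exists>f g. ses C f g \<and> Dom C f = a \<and> Cod C f \<in> M \<and> Cod C g \<in> cores M m}"

lemma cores_SucI:
  assumes "ses C f g" "f \<in> Hom C a b" "g \<in> Hom C b c" "b \<in> M" "c \<in> cores M m"
  shows "a \<in> cores M (Suc m)"
proof -
  have "Dom C f = a" "Cod C f = b" "Cod C g = c" using assms(2,3) by auto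
  then show ?thesis using assms(1,4,5) by auto
qed

lemma cores_SucE:
  assumes "a \<in> cores M (Suc m)"
  obtains f g b c where "ses C f g" "f \<in> Hom C a b" "g \<in> Hom C b c" "b \<in> M" "c \<in> cores M m"
proof -
  obtain f g where "ses C f g" "Dom C f = a" "Cod C f \<in> M" "Cod C g \<in> cores M m"
    using assms by auto
  then show ?thesis using that[of f g "Cod C f" "Cod C g"] ses_arr[of f g] by auto
qed

lemma ses_id_zero:
  assumes "a \<in> Obj C" "is_zero C z"
  shows "ses C (Id C a) (Zero C a z)"
proof -
  have z: "z \<in> Obj C" "Id C z = Zero C z z" using assms(2) by (auto simp: is_zero_iff)
  have "is_epi C (Zero C a z)"
    unfolding epi_iff_zero
  proof (intro conjI ballI impI)
    fix s assume "s \<in> Arr C" "Dom C s = Cod C (Zero C a z)"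
    then show "s = Zero C (Cod C (Zero C a z)) (Cod C s)"
      using zero_obj_arr(1)[OF assms(2), of s "Cod C s"] assms(1) z by auto
  qed (use assms(1) z in auto)
  moreover have "is_kernel C (Id C a) (Zero C a z)"
    by (rule is_kernelI[OF id_mono]) (use assms(1) z in auto)
  ultimately show ?thesis by (rule kernel_ses[rotated])
qed

text \<open>A coresolution is lengthened by a zero object of \<open>M\<close> at its far
  end.\<close>

lemma cores_Suc_mono:
  assumes "M \<subseteq> Obj C" "z \<in> M" "is_zero C z"
  shows "a \<in> cores M m \<Longrightarrow> a \<in> cores M (Suc m)"
proof (induction m arbitrary: a)
  case 0
  then have "a \<in> Obj C" "z \<in> Obj C" using assms(1,2) by auto
  then show ?case
    by - (rule cores_SucI[OF ses_id_zero[of a z], of a a z M 0], use 0 assms in auto)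
next
  case (Suc m)
  obtain f g b c where "ses C f g" "f \<in> Hom C a b" "g \<in> Hom C b c" "b \<in> M" "c \<in> cores M m"
    by (rule cores_SucE[OF Suc.prems])
  then show ?case using Suc.IH[of c] by (intro cores_SucI[of f g a b c])
qed

lemma cores_mono:
  assumes "M \<subseteq> Obj C" "z \<in> M" "is_zero C z" "k \<le> m" "a \<in> cores M k"
  shows "a \<in> cores M m"
  using assms(4,5)
proof (induction m)
  case (Suc m)
  then show ?case using cores_Suc_mono[OF assms(1-3), of a m] by (cases "k = Suc m") auto
qed auto

lemma biprod_iso:
  assumes S: "is_biprod C a b (s, i1, i2, p1, p2)" and S': "is_biprod C a' b' (s', j1, j2, q1, q2)"
    and a: "isomorphic C a a'" and b: "isomorphic C b b'"
  shows "isomorphic C s s'"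
proof -
  note R = biprodE[OF S] and R' = biprodE[OF S']
  obtain u u' where u: "u \<in> Hom C a a'" "u' \<in> Hom C a' a" "u' \<cdot> u = Id C a" "u \<cdot> u' = Id C a'"
    using a unfolding isomorphic_def by blast
  obtain v v' where v: "v \<in> Hom C b b'" "v' \<in> Hom C b' b" "v' \<cdot> v = Id C b" "v \<cdot> v' = Id C b'"
    using b unfolding isomorphic_def by blast
  have uu: "u' \<cdot> (u \<cdot> p1) = p1" "u \<cdot> (u' \<cdot> q1) = q1" "v' \<cdot> (v \<cdot> p2) = p2" "v \<cdot> (v' \<cdot> q2) = q2"
    using assoc_eq[OF u(3), of p1] assoc_eq[OF u(4), of q1] assoc_eq[OF v(3), of p2]
      assoc_eq[OF v(4), of q2] u(1,2) v(1,2) R(1-15) R'(1-15) by auto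
  let ?f = "(j1 \<cdot> (u \<cdot> p1)) \<boxplus> (j2 \<cdot> (v \<cdot> p2))" and ?g = "(i1 \<cdot> (u' \<cdot> q1)) \<boxplus> (i2 \<cdot> (v' \<cdot> q2))"
  show ?thesis
  proof (rule isomorphicI[of ?f _ _ ?g])
    show "?f \<in> Hom C s s'" "?g \<in> Hom C s' s" using u(1,2) v(1,2) R(1-15) R'(1-15) by auto
    show "?g \<cdot> ?f = Id C s"
      using u(1,2) v(1,2) R(1-15) R'(1-15) biprod_rules(1-4)[OF S'] R(20) uu by simp
    show "?f \<cdot> ?g = Id C s'"
      using u(1,2) v(1,2) R(1-15) R'(1-15) biprod_rules(1-4)[OF S] R'(20) uu by simp
  qed
qed

text \<open>The homology object is the cokernel of the arrow \<open>u\<close> from \<open>a\<close>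
  to the kernel of \<open>g\<close>. If it vanishes, \<open>u\<close> is epi, and \<open>u\<close>
  followed by the kernel is an image factorization of \<open>f\<close>.\<close>

lemma homology_zero_exact:
  assumes f: "f \<in> Hom C a b" and g: "g \<in> Hom C b c" and z: "g \<cdot> f = Zero C a c"
    and h: "is_zero C (homology C f g)"
  shows "exact_at C f g"
proof -
  define k where "k = ker C g"
  have "g \<in> Arr C" using g by simp
  from someI_ex[OF ex_kernel[OF this]] have k: "is_kernel C k g" unfolding k_def ker_def .
  have kT: "k \<in> Hom C (Dom C k) b" using k g unfolding is_kernel_def by auto
  obtain u where u: "u \<in> Hom C a (Dom C k)" "k \<cdot> u = f" by (rule ker_fact[OF k kT g f z])
  have "(THE u. u \<in> Hom C (Dom C f) (Dom C (ker C g)) \<and> ker C g \<cdot> u = f) = u"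
    unfolding k_def[symmetric]
  proof (rule the_equality)
    fix u' assume u': "u' \<in> Hom C (Dom C f) (Dom C k) \<and> k \<cdot> u' = f"
    show "u' = u" by (rule mono_cancel[OF kernel_mono[OF k], of _ a]) (use u u' f in auto)
  qed (use u f in auto)
  then have hz: "is_zero C (coker_obj C u)" using h unfolding homology_def by simp
  have "u \<in> Arr C" using u by simp
  then obtain d where d: "is_cokernel C d u" "coker_obj C u = Cod C d" by (rule coker_obj_spec)
  have dT: "d \<in> Hom C (Dom C k) (Cod C d)" using d(1) u unfolding is_cokernel_def by auto
  have dz: "d = Zero C (Dom C k) (Cod C d)" using zero_obj_arr(2)[OF _ dT] hz d(2) by simp
  have "is_epi C u"
    unfolding epi_iff_zero
  proof (intro conjI ballI impI)
    fix t assume t: "t \<in> Arr C" "Dom C t = Cod C u" "t \<cdot> u = Zero C (Dom C u) (Cod C t)"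
    obtain w where w: "w \<in> Hom C (Cod C d) (Cod C t)" "w \<cdot> d = t"
      by (rule cokernel_factor[OF d(1), of t "Cod C t"]) (use t u in auto)
    have "w \<cdot> Zero C (Dom C k) (Cod C d) = t" using w(2) dz by simp
    then show "t = Zero C (Cod C u) (Cod C t)" using w(1) u dT by auto
  qed (use u in auto)
  then have "is_image_fact C f (u, k)"
    using u kT f kernel_mono[OF k] unfolding is_image_fact_def by auto
  then show ?thesis using k f g unfolding exact_at_def by auto
qed

lemma zero_objects_isomorphic:
  assumes "is_zero C a" "is_zero C b"
  shows "isomorphic C a b"
  by (rule isomorphicI[of "Zero C a b" _ _ "Zero C b a"]) (use assms in \<open>auto simp: is_zero_iff\<close>)

text \<open>The sequence contributes the new top step: \<open>f\<close> becomes the inclusion of the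
  first proper subobject, and the old filtration moves up by one index.\<close>

lemma filtration_Suc:
  assumes s: "ses C f g" and D: "has_filtration C m (Dom C f) Q"
    and Q': "Q' 0 = Cod C g" "\<And>r. Q' (Suc r) = Q r"
  shows "has_filtration C (Suc m) (Cod C f) Q'"
proof -
  obtain D d where D: "D 0 = Dom C f" "is_zero C (D m)"
    "\<And>r. r < m \<Longrightarrow> d r \<in> Hom C (D (Suc r)) (D r) \<and> is_mono C (d r) \<and> isomorphic C (coker_obj C (d r)) (Q r)"
    using D unfolding has_filtration_def by blast
  let ?D = "\<lambda>r. case r of 0 \<Rightarrow> Cod C f | Suc k \<Rightarrow> D k" and ?d = "\<lambda>r. case r of 0 \<Rightarrow> f | Suc k \<Rightarrow> d k"
  have "?d r \<in> Hom C (?D (Suc r)) (?D r) \<and> is_mono C (?d r) \<and> isomorphic C (coker_obj C (?d r)) (Q' r)"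
    if "r < Suc m" for r
  proof (cases r)
    case 0
    then show ?thesis using D(1) ses_arr[OF s] coker_obj_ses[OF s] Q'(1) by auto
  next
    case (Suc k)
    then show ?thesis using D(3)[of k] Q'(2)[of k] that by (simp del: Hom_iff)
  qed
  then show ?thesis
    unfolding has_filtration_def using D(2) by (intro exI[of _ ?D] exI[of _ ?d]) auto
qed

end

section \<open>Testing exactness on arrows out of projective objects\<close>

locale abelian_enough = abelian_category +
  assumes enough_proj: "enough_projectives C"
    and enough_inj: "enough_injectives C"
begin

lemma projective_obj: "projective C p \<Longrightarrow> p \<in> Obj C"
  by (simp add: projective_def)

lemma projective_lift:
  assumes "projective C p" "is_epi C e" "x \<in> Hom C p (Cod C e)"
  obtains y where "y \<in> Hom C p (Dom C e)" "e \<cdot> y = x"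
  using assms unfolding projective_def by blast

lemma injective_extend:
  assumes "injective C j" "is_mono C k" "x \<in> Hom C (Dom C k) j"
  obtains y where "y \<in> Hom C (Cod C k) j" "y \<cdot> k = x"
  using assms unfolding injective_def by blast

lemma projective_cover:
  assumes "a \<in> Obj C"
  obtains e p where "is_epi C e" "projective C p" "e \<in> Hom C p a"
  using assms enough_proj epi_arr unfolding enough_projectives_def by fastforce

text \<open>It is enough to lift one projective cover of \<open>b\<close>, since an epi composite
  has an epi left factor.\<close>

lemma epi_elemI:
  assumes "g \<in> Hom C a b"
    and "\<And>p x. projective C p \<Longrightarrow> x \<in> Hom C p b \<Longrightarrow> \<exists>y\<in>Hom C p a. g \<cdot> y = x"
  shows "is_epi C g"
proof -
  obtain e p where e: "is_epi C e" "projective C p" "e \<in> Hom C p b"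
    using projective_cover[of b] assms(1) by auto
  then obtain y where "y \<in> Hom C p a" "g \<cdot> y = e" using assms(2) by blast
  then show ?thesis using e assms(1) by (intro epi_left[of g y]) auto
qed

lemma mono_elemI:
  assumes "f \<in> Hom C a b"
    and "\<And>p x. projective C p \<Longrightarrow> x \<in> Hom C p a \<Longrightarrow> f \<cdot> x = Zero C p b \<Longrightarrow> x = Zero C p a"
  shows "is_mono C f"
  unfolding mono_iff_zero
proof (intro conjI ballI impI)
  fix s assume s: "s \<in> Arr C" "Cod C s = Dom C f" "f \<cdot> s = Zero C (Dom C s) (Cod C f)"
  obtain e p where e: "is_epi C e" "projective C p" "e \<in> Hom C p (Dom C s)"
    using projective_cover[of "Dom C s"] s by auto
  have "s \<cdot> e = Zero C p a"
  proof (rule assms(2)[OF e(2)])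
    have "f \<cdot> (s \<cdot> e) = (f \<cdot> s) \<cdot> e" using e s(1,2) assms(1) by auto
    then show "f \<cdot> (s \<cdot> e) = Zero C p b" unfolding s(3) using e s(1,2) assms(1) by auto
  qed (use e s assms(1) in auto)
  then have "s \<cdot> e = Zero C (Dom C s) (Dom C f) \<cdot> e" using assms(1) e s(1) by auto
  then show "s = Zero C (Dom C s) (Dom C f)"
    by (rule epi_cancel[OF e(1), of _ "Dom C f", rotated 2]) (use e s assms in auto)
qed (use assms in auto)

lemma mono_elemD:
  assumes "is_mono C f" "f \<in> Hom C a b" "x \<in> Hom C c a" "f \<cdot> x = Zero C c b"
  shows "x = Zero C c a"
  by (rule mono_cancel[OF assms(1), of _ c]) (use assms in auto)

lemma exact_elemD:
  assumes "exact_at C f g" "projective C p" "x \<in> Hom C p (Dom C g)" "g \<cdot> x = Zero C p (Cod C g)"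
  obtains y where "y \<in> Hom C p (Dom C f)" "f \<cdot> y = x"
proof -
  obtain q i where q: "is_epi C q" "is_mono C i" "q \<in> Hom C (Dom C f) (Dom C i)"
    "i \<in> Hom C (Dom C i) (Cod C f)" "i \<cdot> q = f" "is_kernel C i g"
    by (rule exactE[OF assms(1)])
  obtain u where u: "u \<in> Hom C p (Dom C i)" "i \<cdot> u = x"
    by (rule kernel_factor[OF q(6) assms(3,4)])
  obtain y where y: "y \<in> Hom C p (Dom C f)" "q \<cdot> y = u"
    using projective_lift[OF assms(2) q(1), of u] u q by auto
  have "f \<cdot> y = x" unfolding q(5)[symmetric] using y u q(3,4) by auto
  then show ?thesis using y that by blast
qed

text \<open>An arbitrary \<open>t\<close> killed by \<open>g\<close> becomes an element after
  covering its source by a projective. That element comes from \<open>f\<close>, so the cokernel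
  \<open>k\<close> of the image kills it. As the cover is epi, \<open>k\<close> kills
  \<open>t\<close>, and \<open>t\<close> factors through the image.\<close>

lemma exact_elemI:
  assumes f: "f \<in> Hom C a b" and g: "g \<in> Hom C b c" and z: "g \<cdot> f = Zero C a c"
    and ex: "\<And>p x. projective C p \<Longrightarrow> x \<in> Hom C p b \<Longrightarrow> g \<cdot> x = Zero C p c \<Longrightarrow>
       \<exists>y\<in>Hom C p a. f \<cdot> y = x"
  shows "exact_at C f g"
proof -
  have fA: "f \<in> Arr C" using f by auto
  obtain q i where q: "is_epi C q" "is_mono C i" "q \<in> Hom C (Dom C f) (Dom C i)"
    "i \<in> Hom C (Dom C i) (Cod C f)" "i \<cdot> q = f" "is_image_fact C f (q, i)"
    by (rule image_fact_obtain[OF fA])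
  have "(g \<cdot> i) \<cdot> q = Zero C (Dom C i) c \<cdot> q" using z q f g by auto
  then have gi: "g \<cdot> i = Zero C (Dom C i) c"
    by (rule epi_cancel[OF q(1), of _ c, rotated 2]) (use q f g in auto)
  obtain k where k: "ses C i k" by (rule mono_ses[OF q(2)])
  note kT = ses_arr[OF k]
  have "is_kernel C i g"
  proof (rule is_kernelI[OF q(2) _ g gi])
    fix d t assume t: "t \<in> Hom C d b" "g \<cdot> t = Zero C d c"
    obtain e p where e: "is_epi C e" "projective C p" "e \<in> Hom C p d"
      using projective_cover[of d] t by auto
    have "g \<cdot> (t \<cdot> e) = (g \<cdot> t) \<cdot> e" using t(1) g e by auto
    then have "g \<cdot> (t \<cdot> e) = Zero C p c" unfolding t(2) using t(1) g e by auto
    then obtain y where y: "y \<in> Hom C p a" "f \<cdot> y = t \<cdot> e"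
      using ex[OF e(2), of "t \<cdot> e"] e t by auto
    have "(k \<cdot> t) \<cdot> e = k \<cdot> (f \<cdot> y)" unfolding y(2) using t(1) e kT f q by auto
    also have "\<dots> = (k \<cdot> i) \<cdot> (q \<cdot> y)" unfolding q(5)[symmetric] using y(1) f q(1-4) kT(1-3) by auto
    also have "\<dots> = Zero C d (Cod C k) \<cdot> e" unfolding kT(4) using y(1) f q(1-4) kT(1-3) t e by auto
    finally have "k \<cdot> t = Zero C d (Cod C k)"
      by (rule epi_cancel[OF e(1), of _ "Cod C k", rotated 2]) (use e t kT f q in auto)
    then show "\<exists>u\<in>Hom C d (Dom C i). i \<cdot> u = t"
      using kernel_factor[OF ses_kernel[OF k], of t d] t f q kT by (metis Hom_iff)
  qed (use q f in auto)
  then show ?thesis using q(6) f g unfolding exact_at_def by auto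
qed

lemma ses_elemI:
  assumes f: "f \<in> Hom C a b" and g: "g \<in> Hom C b c" and z: "g \<cdot> f = Zero C a c"
    and m: "\<And>p x. projective C p \<Longrightarrow> x \<in> Hom C p a \<Longrightarrow> f \<cdot> x = Zero C p b \<Longrightarrow> x = Zero C p a"
    and ex: "\<And>p x. projective C p \<Longrightarrow> x \<in> Hom C p b \<Longrightarrow> g \<cdot> x = Zero C p c \<Longrightarrow>
       \<exists>y\<in>Hom C p a. f \<cdot> y = x"
    and e: "\<And>p x. projective C p \<Longrightarrow> x \<in> Hom C p c \<Longrightarrow> \<exists>y\<in>Hom C p b. g \<cdot> y = x"
  shows "ses C f g"
  unfolding ses_def using mono_elemI[OF f m] epi_elemI[OF g e] exact_elemI[OF f g z ex] by blast

lemma exact_lift: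
  assumes "exact_at C f g" "projective C p" "f \<in> Hom C a b" "g \<in> Hom C b c" "x \<in> Hom C p b"
    "g \<cdot> x = Zero C p c"
  obtains y where "y \<in> Hom C p a" "f \<cdot> y = x"
  by (rule exact_elemD[OF assms(1,2), of x]) (use assms that in auto)

end

section \<open>Vanishing of Ext\<close>

context abelian_enough
begin

lemma injective_ses:
  assumes "y \<in> Obj C"
  obtains i q j s where "ses C i q" "i \<in> Hom C y j" "q \<in> Hom C j s" "injective C j"
proof -
  obtain i where i: "is_mono C i" "Dom C i = y" "injective C (Cod C i)"
    using enough_inj assms unfolding enough_injectives_def by blast
  obtain q where q: "ses C i q" by (rule mono_ses[OF i(1)])
  show ?thesis using that[OF q, of "Cod C i" "Cod C q"] i ses_arr[OF q] by auto
qed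

lemma projective_ses:
  assumes "x \<in> Obj C"
  obtains k e w p where "ses C k e" "k \<in> Hom C w p" "e \<in> Hom C p x" "projective C p"
proof -
  obtain e p where e: "is_epi C e" "projective C p" "e \<in> Hom C p x" by (rule projective_cover[OF assms])
  obtain k where k: "ses C k e" by (rule epi_ses[OF e(1)])
  show ?thesis using that[OF k, of "Dom C k" p] e ses_arr[OF k] by auto
qed

lemma ses_lift:
  assumes "ses C f g" "g \<in> Hom C b c" "projective C p" "x \<in> Hom C p c"
  obtains y where "y \<in> Hom C p b" "g \<cdot> y = x"
  by (rule projective_lift[OF assms(3) ses_arr(6)[OF assms(1)], of x]) (use assms that in auto)

text \<open>The vanishing of Ext^1 without any resolution: the pushout of every extension ending in
  \<open>x\<close> along an arrow into \<open>y\<close> splits.\<close>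

definition ext1_zero :: "'a \<Rightarrow> 'a \<Rightarrow> bool" where
  "ext1_zero x y \<longleftrightarrow> (\<forall>f g. ses C f g \<and> Cod C g = x \<longrightarrow>
     (\<forall>h\<in>Hom C (Dom C f) y. \<exists>h'\<in>Hom C (Cod C f) y. h' \<cdot> f = h))"

text \<open>\<open>ext_zero k x y\<close> says that \<open>Ext\<^sup>k\<^sup>+\<^sup>1(x, y)\<close> vanishes, by dimension shift along
  injective embeddings of \<open>y\<close>.\<close>

primrec ext_zero :: "nat \<Rightarrow> 'a \<Rightarrow> 'a \<Rightarrow> bool" where
  "ext_zero 0 x y = ext1_zero x y"
| "ext_zero (Suc k) x y = (\<forall>f g. ses C f g \<and> Dom C f = y \<and> injective C (Cod C f) \<longrightarrow>
     ext_zero k x (Cod C g))"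

lemma ext1_zeroD:
  assumes "ext1_zero x y" "ses C f g" "f \<in> Hom C a b" "g \<in> Hom C b x" "h \<in> Hom C a y"
  obtains h' where "h' \<in> Hom C b y" "h' \<cdot> f = h"
proof -
  have "Dom C f = a" "Cod C f = b" "Cod C g = x" using assms(3,4) by auto
  then show ?thesis using assms(1,2,5) that unfolding ext1_zero_def by blast
qed

lemma ext1_zeroI:
  assumes "\<And>f g a b h. ses C f g \<Longrightarrow> f \<in> Hom C a b \<Longrightarrow> g \<in> Hom C b x \<Longrightarrow> h \<in> Hom C a y \<Longrightarrow>
    \<exists>h'\<in>Hom C b y. h' \<cdot> f = h"
  shows "ext1_zero x y"
  unfolding ext1_zero_def
proof (intro allI impI ballI)
  fix f g h assume a: "ses C f g \<and> Cod C g = x" "h \<in> Hom C (Dom C f) y"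
  show "\<exists>h'\<in>Hom C (Cod C f) y. h' \<cdot> f = h"
    by (rule assms[of f g]) (use a ses_arr[of f g] in auto)
qed

text \<open>For injective \<open>j\<close>, Ext^1(x, y) is the cokernel of Hom(x, j) -> Hom(x, s).
  Concretely, \<open>i \<cdot> h\<close> extends to some \<open>r\<close> by injectivity,
  \<open>q \<cdot> r\<close> descends to an arrow \<open>w\<close> out of \<open>x\<close>, and
  subtracting a lift of \<open>w\<close> pushes \<open>r\<close> into \<open>y\<close>.\<close>

lemma ext1_zero_injI:
  assumes iq: "ses C i q" and i: "i \<in> Hom C y j" and q: "q \<in> Hom C j s" and j: "injective C j"
    and lift: "\<And>w. w \<in> Hom C x s \<Longrightarrow> \<exists>v\<in>Hom C x j. q \<cdot> v = w"
  shows "ext1_zero x y"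
proof (rule ext1_zeroI)
  fix f g c d h
  assume s: "ses C f g" and f: "f \<in> Hom C c d" and g: "g \<in> Hom C d x" and h: "h \<in> Hom C c y"
  note zs = ses_zero[OF s f g] and zq = ses_zero[OF iq i q]
  obtain r where r: "r \<in> Hom C d j" "r \<cdot> f = i \<cdot> h"
    using injective_extend[OF j ses_arr(5)[OF s], of "i \<cdot> h"] i f h by auto
  have "(q \<cdot> r) \<cdot> f = Zero C c s" using r zq q f h i by auto
  then obtain w where w: "w \<in> Hom C x s" "w \<cdot> g = q \<cdot> r"
    by (rule ses_coker_fact[OF s f g, rotated]) (use q r in auto)
  obtain v where v: "v \<in> Hom C x j" "q \<cdot> v = w" using lift w by blast
  have "q \<cdot> (v \<cdot> g) = w \<cdot> g" using assoc_eq[OF v(2)] v(1) q g by auto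
  then have "q \<cdot> (r \<boxplus> neg (v \<cdot> g)) = Zero C d s"
    using w v(1) q g r(1) by auto
  then obtain h' where h': "h' \<in> Hom C d y" "i \<cdot> h' = r \<boxplus> neg (v \<cdot> g)"
    by (rule ses_ker_fact[OF iq i q, rotated]) (use r v g in auto)
  have "i \<cdot> (h' \<cdot> f) = (i \<cdot> h') \<cdot> f" using h'(1) f i by auto
  also have "\<dots> = i \<cdot> h" unfolding h'(2) using r v(1) f g h i zs by auto
  finally have "h' \<cdot> f = h"
    by (rule mono_cancel[OF ses_arr(5)[OF iq], of _ c, rotated 2]) (use h' f i h in auto)
  then show "\<exists>h'\<in>Hom C d y. h' \<cdot> f = h" using h'(1) by blast
qed

text \<open>The universal property of the pullback is exported along with the sequence, because
  \<open>ses_three_by_three\<close> has to map into the pulled back object.\<close>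

lemma pullback_ses:
  assumes iq: "ses C i q" and i: "i \<in> Hom C a b" and q: "q \<in> Hom C b c" and w: "w \<in> Hom C x c"
  obtains d i' r p where "ses C i' r" "i' \<in> Hom C a d" "r \<in> Hom C d x" "p \<in> Hom C d b"
    "q \<cdot> p = w \<cdot> r" "p \<cdot> i' = i"
    "\<And>t y z. y \<in> Hom C t b \<Longrightarrow> z \<in> Hom C t x \<Longrightarrow> q \<cdot> y = w \<cdot> z \<Longrightarrow>
       \<exists>u\<in>Hom C t d. p \<cdot> u = y \<and> r \<cdot> u = z"
    "\<And>t u v. u \<in> Hom C t d \<Longrightarrow> v \<in> Hom C t d \<Longrightarrow> p \<cdot> u = p \<cdot> v \<Longrightarrow> r \<cdot> u = r \<cdot> v \<Longrightarrow> u = v"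
proof -
  note zq = ses_zero[OF iq i q]
  obtain d p r where p: "p \<in> Hom C d b" and r: "r \<in> Hom C d x" and pr: "q \<cdot> p = w \<cdot> r"
    and ex: "\<And>t y z. y \<in> Hom C t b \<Longrightarrow> z \<in> Hom C t x \<Longrightarrow> q \<cdot> y = w \<cdot> z \<Longrightarrow>
       \<exists>u\<in>Hom C t d. p \<cdot> u = y \<and> r \<cdot> u = z"
    and un: "\<And>t u v. u \<in> Hom C t d \<Longrightarrow> v \<in> Hom C t d \<Longrightarrow> p \<cdot> u = p \<cdot> v \<Longrightarrow> r \<cdot> u = r \<cdot> v \<Longrightarrow> u = v"
    by (rule pullback_exists[OF q w]) blast
  obtain i' where i': "i' \<in> Hom C a d" "p \<cdot> i' = i" "r \<cdot> i' = Zero C a x"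
    using ex[of i a "Zero C a x"] i w q zq by auto
  have "ses C i' r"
  proof (rule ses_elemI[OF i'(1) r i'(3)])
    fix t y assume t: "projective C t" and y: "y \<in> Hom C t a" "i' \<cdot> y = Zero C t d"
    have "i \<cdot> y = p \<cdot> (i' \<cdot> y)" using assoc_eq[OF i'(2)] i'(1) p y(1) by auto
    then have "i \<cdot> y = Zero C t b" unfolding y(2) using p y(1) by auto
    then show "y = Zero C t a" by (rule mono_elemD[OF ses_arr(5)[OF iq] i y(1)])
  next
    fix t y assume t: "projective C t" and y: "y \<in> Hom C t d" "r \<cdot> y = Zero C t x"
    have "q \<cdot> (p \<cdot> y) = w \<cdot> (r \<cdot> y)" using assoc_eq[OF pr] p q r w y(1) by auto
    then have "q \<cdot> (p \<cdot> y) = Zero C t c" unfolding y(2) using w y(1) by auto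
    then obtain z where z: "z \<in> Hom C t a" "i \<cdot> z = p \<cdot> y"
      by (rule ses_ker_fact[OF iq i q, rotated]) (use p y in auto)
    have "i' \<cdot> z = y"
    proof (rule un[of _ t])
      show "p \<cdot> (i' \<cdot> z) = p \<cdot> y" using z assoc_eq[OF i'(2), of z] i'(1) p by auto
      show "r \<cdot> (i' \<cdot> z) = r \<cdot> y" using z(1) assoc_eq[OF i'(3), of z] i'(1) r y by auto
    qed (use y z(1) i'(1) in auto)
    then show "\<exists>z\<in>Hom C t a. i' \<cdot> z = y" using z by blast
  next
    fix t y assume t: "projective C t" and y: "y \<in> Hom C t x"
    obtain m where m: "m \<in> Hom C t b" "q \<cdot> m = w \<cdot> y"
      by (rule ses_lift[OF iq q t, of "w \<cdot> y"]) (use w y in auto)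
    then show "\<exists>z\<in>Hom C t d. r \<cdot> z = y" using ex[of m t y] y by blast
  qed
  then show ?thesis using that i' r p pr ex un by blast
qed

text \<open>The pullback of the sequence along \<open>w\<close> is an extension of \<open>x\<close>
  by \<open>y\<close>, so it has a retraction \<open>h\<close>. Then \<open>p\<close> minus
  \<open>i \<cdot> h\<close> kills the subobject and descends to the required lift.\<close>

lemma ext1_zero_lift:
  assumes e: "ext1_zero x y" and iq: "ses C i q" and i: "i \<in> Hom C y j" and q: "q \<in> Hom C j s"
    and w: "w \<in> Hom C x s"
  obtains v where "v \<in> Hom C x j" "q \<cdot> v = w"
proof -
  obtain d i' r p where s: "ses C i' r" and i': "i' \<in> Hom C y d" and r: "r \<in> Hom C d x"
    and p: "p \<in> Hom C d j" "q \<cdot> p = w \<cdot> r" "p \<cdot> i' = i"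
    by (rule pullback_ses[OF iq i q w]) blast
  obtain h where h: "h \<in> Hom C d y" "h \<cdot> i' = Id C y"
    by (rule ext1_zeroD[OF e s i' r, of "Id C y"]) (use i in auto)
  have "(p \<boxplus> neg (i \<cdot> h)) \<cdot> i' = Zero C y j" using p i' i h by auto
  then obtain v where v: "v \<in> Hom C x j" "v \<cdot> r = p \<boxplus> neg (i \<cdot> h)"
    by (rule ses_coker_fact[OF s i' r, rotated]) (use p i h in auto)
  have "(q \<cdot> v) \<cdot> r = w \<cdot> r" using v p(1,2) i h(1) r q w ses_zero[OF iq i q] by auto
  then have "q \<cdot> v = w"
    by (rule epi_cancel[OF ses_arr(6)[OF s], of _ s, rotated 2]) (use v q w r in auto)
  then show ?thesis using v that by blast
qed

text \<open>One projective presentation of \<open>x\<close> decides the matter: Ext^1(x, y) is also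
  the cokernel of Hom(p, y) -> Hom(w, y). The proof embeds \<open>y\<close> into an injective and
  uses the criterion \<open>ext1_zero_injI\<close>.\<close>

lemma ext1_zero_projI:
  assumes ke: "ses C k e" and k: "k \<in> Hom C w p" and e: "e \<in> Hom C p x" and p: "projective C p"
    and y: "y \<in> Obj C"
    and ex: "\<And>h. h \<in> Hom C w y \<Longrightarrow> \<exists>l\<in>Hom C p y. l \<cdot> k = h"
  shows "ext1_zero x y"
proof -
  obtain i q j s where iq: "ses C i q" and i: "i \<in> Hom C y j" and q: "q \<in> Hom C j s"
    and j: "injective C j" by (rule injective_ses[OF y])
  note zq = ses_zero[OF iq i q] and zk = ses_zero[OF ke k e]
  show ?thesis
  proof (rule ext1_zero_injI[OF iq i q j])
    fix v assume v: "v \<in> Hom C x s"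
    obtain m where m: "m \<in> Hom C p j" "q \<cdot> m = v \<cdot> e"
      using projective_lift[OF p ses_arr(6)[OF iq], of "v \<cdot> e"] q v e by auto
    have "q \<cdot> (m \<cdot> k) = Zero C w s"
      using assoc_eq[OF m(2), of k] zk m(1) q k v e by auto
    then obtain h where h: "h \<in> Hom C w y" "i \<cdot> h = m \<cdot> k"
      by (rule ses_ker_fact[OF iq i q, rotated]) (use m k in auto)
    obtain l where l: "l \<in> Hom C p y" "l \<cdot> k = h" using ex[OF h(1)] by blast
    \<comment> \<open>\<open>m\<close> lifts \<open>v \<cdot> e\<close> but need not descend to
      \<open>x\<close>. The correction by \<open>i \<cdot> l\<close> makes it vanish on the syzygy,
      and it is invisible after \<open>q\<close>.\<close>
    have "(m \<boxplus> neg (i \<cdot> l)) \<cdot> k = Zero C w j" using m l h i k by auto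
    then obtain u where u: "u \<in> Hom C x j" "u \<cdot> e = m \<boxplus> neg (i \<cdot> l)"
      by (rule ses_coker_fact[OF ke k e, rotated]) (use m l i in auto)
    have "(q \<cdot> u) \<cdot> e = v \<cdot> e" using u e q m l(1) i zq v by auto
    then have "q \<cdot> u = v"
      by (rule epi_cancel[OF ses_arr(6)[OF ke], of _ s, rotated 2]) (use u q e v in auto)
    then show "\<exists>u\<in>Hom C x j. q \<cdot> u = v" using u by blast
  qed
qed

text \<open>Both sides express the vanishing of Ext^2(x, y), shifted once in the first variable and
  once in the second.\<close>

lemma ext1_zero_shift:
  assumes ke: "ses C k e" and k: "k \<in> Hom C w p" and e: "e \<in> Hom C p x" and p: "projective C p"
    and iq: "ses C i q" and i: "i \<in> Hom C y j" and q: "q \<in> Hom C j s" and j: "injective C j"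
  shows "ext1_zero w y \<longleftrightarrow> ext1_zero x s"
proof
  assume E: "ext1_zero w y"
  show "ext1_zero x s"
  proof (rule ext1_zero_projI[OF ke k e p])
    fix h assume h: "h \<in> Hom C w s"
    obtain m where m: "m \<in> Hom C w j" "q \<cdot> m = h" by (rule ext1_zero_lift[OF E iq i q h])
    obtain n where n: "n \<in> Hom C p j" "n \<cdot> k = m"
      using injective_extend[OF j ses_arr(5)[OF ke], of m] k m by auto
    show "\<exists>l\<in>Hom C p s. l \<cdot> k = h" using n m(2) q k by (intro bexI[of _ "q \<cdot> n"]) auto
  qed (use q in auto)
next
  assume E: "ext1_zero x s"
  show "ext1_zero w y"
  proof (rule ext1_zero_injI[OF iq i q j])
    fix h assume h: "h \<in> Hom C w s"
    obtain l where l: "l \<in> Hom C p s" "l \<cdot> k = h" by (rule ext1_zeroD[OF E ke k e h])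
    obtain m where m: "m \<in> Hom C p j" "q \<cdot> m = l"
      using projective_lift[OF p ses_arr(6)[OF iq], of l] q l by auto
    have "q \<cdot> (m \<cdot> k) = h" using assoc_eq[OF m(2), of k] m(1) q k l by auto
    then show "\<exists>v\<in>Hom C w j. q \<cdot> v = h" using m(1) k by (intro bexI[of _ "m \<cdot> k"]) auto
  qed
qed

lemma ext_zero_Suc_iff_all:
  "ext_zero (Suc k) x y \<longleftrightarrow> (\<forall>i q j s. ses C i q \<longrightarrow> i \<in> Hom C y j \<longrightarrow> q \<in> Hom C j s \<longrightarrow> injective C j \<longrightarrow>
     ext_zero k x s)"
  (is "_ \<longleftrightarrow> ?R")
proof
  assume "ext_zero (Suc k) x y"
  then show ?R by auto
next
  assume R: ?R
  have "ext_zero k x (Cod C g)" if "ses C f g" "Dom C f = y" "injective C (Cod C f)" for f g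
    by (rule R[rule_format, OF that(1), of "Cod C f"]) (use that ses_arr[OF that(1)] in auto)
  then show "ext_zero (Suc k) x y" unfolding ext_zero.simps by blast
qed

text \<open>The recursion of \<open>ext_zero\<close> shifts in the second variable only. Degree two,
  where both shifts agree by \<open>ext1_zero_shift\<close>, starts the induction; the later cases
  unfold the recursion on either side.\<close>

lemma ext_zero_shift:
  assumes ke: "ses C k e" and k: "k \<in> Hom C w p" and e: "e \<in> Hom C p x" and p: "projective C p"
  shows "y \<in> Obj C \<Longrightarrow> ext_zero n w y \<longleftrightarrow> ext_zero (Suc n) x y"
proof (induction n arbitrary: y)
  case 0
  obtain i q j s where iq: "ses C i q" and i: "i \<in> Hom C y j" and q: "q \<in> Hom C j s"
    and j: "injective C j" by (rule injective_ses[OF 0])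
  show ?case unfolding ext_zero_Suc_iff_all ext_zero.simps(1)
    using ext1_zero_shift[OF ke k e p] iq i q j by metis
next
  case (Suc n)
  show ?case
    unfolding ext_zero_Suc_iff_all[of "Suc n"] ext_zero_Suc_iff_all[of n w]
    using Suc.IH by (metis Hom_iff)
qed

text \<open>The recursion quantifies over all injective embeddings of \<open>y\<close>. A single one
  suffices, as one sees by moving the induction to syzygies of \<open>x\<close>, which leaves the
  embedding fixed.\<close>

lemma ext_zero_inj_shift:
  assumes x: "x \<in> Obj C"
    and iq: "ses C i q" and i: "i \<in> Hom C y j" and q: "q \<in> Hom C j s" and j: "injective C j"
  shows "ext_zero (Suc n) x y \<longleftrightarrow> ext_zero n x s"
  using x
proof (induction n arbitrary: x)
  case 0
  obtain k e w p where ke: "ses C k e" and k: "k \<in> Hom C w p" and e: "e \<in> Hom C p x"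
    and p: "projective C p" by (rule projective_ses[OF 0])
  show ?case using ext1_zero_shift[OF ke k e p iq i q j] ext_zero_shift[OF ke k e p, of y 0] i by auto
next
  case (Suc n)
  obtain k e w p where ke: "ses C k e" and k: "k \<in> Hom C w p" and e: "e \<in> Hom C p x"
    and p: "projective C p" by (rule projective_ses[OF Suc.prems])
  have ob: "y \<in> Obj C" "s \<in> Obj C" "w \<in> Obj C" using i q k by auto
  show ?case
    using Suc.IH[OF ob(3)] ext_zero_shift[OF ke k e p ob(1), of "Suc n"]
      ext_zero_shift[OF ke k e p ob(2), of n] by blast
qed

text \<open>The piece Ext^(k+1)(b, y) -> Ext^(k+1)(a, y) -> Ext^(k+2)(c, y) of a long exact
  sequence. Shifting along an injective embedding of \<open>y\<close> reduces it to \<open>k\<close>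
  = 0.\<close>

lemma ext_zero_kernel:
  assumes s: "ses C f g" and f: "f \<in> Hom C a b" and g: "g \<in> Hom C b c"
  shows "y \<in> Obj C \<Longrightarrow> ext_zero k b y \<Longrightarrow> ext_zero (Suc k) c y \<Longrightarrow> ext_zero k a y"
proof (induction k arbitrary: y)
  case 0
  obtain i q j t where iq: "ses C i q" and i: "i \<in> Hom C y j" and q: "q \<in> Hom C j t"
    and j: "injective C j" by (rule injective_ses[OF 0(1)])
  have b: "ext1_zero b y" using 0 by simp
  have c: "ext1_zero c t" using 0(3) ext_zero_inj_shift[OF _ iq i q j, of c 0] g by simp
  have "ext1_zero a y"
  proof (rule ext1_zero_injI[OF iq i q j])
    fix w assume w: "w \<in> Hom C a t"
    obtain l where l: "l \<in> Hom C b t" "l \<cdot> f = w" by (rule ext1_zeroD[OF c s f g w])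
    obtain v where v: "v \<in> Hom C b j" "q \<cdot> v = l" by (rule ext1_zero_lift[OF b iq i q l(1)])
    have "q \<cdot> (v \<cdot> f) = w" using assoc_eq[OF v(2), of f] v(1) q f l by auto
    then show "\<exists>v\<in>Hom C a j. q \<cdot> v = w" using v(1) f by (intro bexI[of _ "v \<cdot> f"]) auto
  qed
  then show ?case by simp
next
  case (Suc k)
  obtain i q j t where iq: "ses C i q" and i: "i \<in> Hom C y j" and q: "q \<in> Hom C j t"
    and j: "injective C j" by (rule injective_ses[OF Suc.prems(1)])
  have ob: "a \<in> Obj C" "b \<in> Obj C" "c \<in> Obj C" "t \<in> Obj C" using f g q by auto
  show ?case
    using Suc.IH[OF ob(4)] Suc.prems(2,3) ext_zero_inj_shift[OF ob(1) iq i q j]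
      ext_zero_inj_shift[OF ob(2) iq i q j] ext_zero_inj_shift[OF ob(3) iq i q j] by blast
qed

text \<open>The piece of the long exact sequence in the second variable. Shifting along syzygies of
  \<open>x\<close> reduces it to degree one. There an arrow on the syzygy is first extended modulo
  \<open>a\<close>, and the error, which lands in \<open>a\<close>, is extended separately.\<close>

lemma ext_zero_extension:
  assumes s: "ses C u v" and u: "u \<in> Hom C a b" and v: "v \<in> Hom C b c"
  shows "x \<in> Obj C \<Longrightarrow> ext_zero k x a \<Longrightarrow> ext_zero k x c \<Longrightarrow> ext_zero k x b"
proof (induction k arbitrary: x)
  case 0
  obtain k e w p where ke: "ses C k e" and k: "k \<in> Hom C w p" and e: "e \<in> Hom C p x"
    and p: "projective C p" by (rule projective_ses[OF 0(1)])
  have E: "ext1_zero x a" "ext1_zero x c" using 0 by simp_all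
  have "ext1_zero x b"
  proof (rule ext1_zero_projI[OF ke k e p])
    fix h assume h: "h \<in> Hom C w b"
    obtain l where l: "l \<in> Hom C p c" "l \<cdot> k = v \<cdot> h"
      by (rule ext1_zeroD[OF E(2) ke k e, of "v \<cdot> h"]) (use h v in auto)
    obtain m where m: "m \<in> Hom C p b" "v \<cdot> m = l"
      using projective_lift[OF p ses_arr(6)[OF s], of l] v l by auto
    have "v \<cdot> (m \<cdot> k) = v \<cdot> h" using assoc_eq[OF m(2), of k] m(1) v k l by auto
    then have "v \<cdot> (h \<boxplus> neg (m \<cdot> k)) = Zero C w c" using h v m(1) k by auto
    then obtain h1 where h1: "h1 \<in> Hom C w a" "u \<cdot> h1 = h \<boxplus> neg (m \<cdot> k)"
      by (rule ses_ker_fact[OF s u v, rotated]) (use h m k in auto)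
    obtain l1 where l1: "l1 \<in> Hom C p a" "l1 \<cdot> k = h1" by (rule ext1_zeroD[OF E(1) ke k e h1(1)])
    have "h = (u \<cdot> h1) \<boxplus> (m \<cdot> k)" by (rule sub_eq) (use h1 h m(1) k u in auto)
    then show "\<exists>l\<in>Hom C p b. l \<cdot> k = h"
      using l1 m(1) u k by (intro bexI[of _ "(u \<cdot> l1) \<boxplus> m"]) auto
  qed (use u in auto)
  then show ?case by simp
next
  case (Suc k)
  obtain i e w p where ke: "ses C i e" and i: "i \<in> Hom C w p" and e: "e \<in> Hom C p x"
    and p: "projective C p" by (rule projective_ses[OF Suc.prems(1)])
  have ob: "a \<in> Obj C" "b \<in> Obj C" "c \<in> Obj C" "w \<in> Obj C" using u v i by auto
  show ?case
    using Suc.IH[OF ob(4)] Suc.prems(2,3) ext_zero_shift[OF ke i e p ob(1)]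
      ext_zero_shift[OF ke i e p ob(2)] ext_zero_shift[OF ke i e p ob(3)] by blast
qed

lemma ext_zero_iso:
  assumes "isomorphic C x x'"
  shows "ext_zero k x y \<Longrightarrow> ext_zero k x' y"
proof (induction k arbitrary: y)
  case 0
  obtain i j where i: "i \<in> Hom C x' x" "j \<in> Hom C x x'" "j \<cdot> i = Id C x'" "i \<cdot> j = Id C x"
    using assms unfolding isomorphic_def by blast
  have "ext1_zero x' y"
  proof (rule ext1_zeroI)
    fix f g a b h
    assume s: "ses C f g" and f: "f \<in> Hom C a b" and g: "g \<in> Hom C b x'" and h: "h \<in> Hom C a y"
    have "ses C f (i \<cdot> g)" by (rule ses_iso_right[OF s f g i])
    then obtain h' where "h' \<in> Hom C b y" "h' \<cdot> f = h"
      by (rule ext1_zeroD[of x y f "i \<cdot> g" a b h, rotated]) (use 0 f g i h in auto)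
    then show "\<exists>h'\<in>Hom C b y. h' \<cdot> f = h" by blast
  qed
  then show ?case by simp
qed auto

lemma ext1_zero_split:
  assumes "ext1_zero x y" "ses C f g" "f \<in> Hom C y b" "g \<in> Hom C b x"
  obtains t r where "is_biprod C y x (b, f, t, r, g)"
proof -
  obtain r where r: "r \<in> Hom C b y" "r \<cdot> f = Id C y"
    by (rule ext1_zeroD[OF assms, of "Id C y"]) (use assms(3) in auto)
  show ?thesis using split_ses[OF assms(2-4) r] that by metis
qed

section \<open>Gluing short exact sequences\<close>

text \<open>Embed \<open>d1\<close> into an injective \<open>J\<close> with cokernel
  \<open>S\<close>. Extensions by \<open>d1\<close> are then pullbacks of \<open>J\<close> ->
  \<open>S\<close>, so the middle object is found by producing an arrow into \<open>S\<close>
  instead of by manipulating extensions.\<close>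

lemma ses_three_by_three:
  assumes s1: "ses C i c" and i: "i \<in> Hom C x0 a0" and c: "c \<in> Hom C a0 k0"
    and s2: "ses C u v" and u: "u \<in> Hom C k0 e0" and v: "v \<in> Hom C e0 t0"
    and s3: "ses C f g" and f: "f \<in> Hom C x0 d1" and g: "g \<in> Hom C d1 q1"
    and E: "ext_zero 1 t0 d1"
  obtains a b m w s t d0 q0 where
    "ses C a b" "a \<in> Hom C a0 d0" "b \<in> Hom C d0 q0"
    "ses C m w" "m \<in> Hom C d1 d0" "w \<in> Hom C d0 e0"
    "ses C s t" "s \<in> Hom C q1 q0" "t \<in> Hom C q0 t0"
proof -
  note z1 = ses_zero[OF s1 i c] and z2 = ses_zero[OF s2 u v] and z3 = ses_zero[OF s3 f g]
  have ob: "d1 \<in> Obj C" "t0 \<in> Obj C" using f v by auto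
  obtain j q J S where jq: "ses C j q" and j: "j \<in> Hom C d1 J" and q: "q \<in> Hom C J S"
    and J: "injective C J" by (rule injective_ses[OF ob(1)])
  note zq = ses_zero[OF jq j q]
  have E': "ext1_zero t0 S"
    using E ext_zero_inj_shift[OF ob(2) jq j q J, of 0] by simp
  \<comment> \<open>\<open>\<beta>\<close> classifies the pushout of the first sequence along
    \<open>f\<close>, an extension of \<open>k0\<close> by \<open>d1\<close>.\<close>
  obtain \<alpha> where \<alpha>: "\<alpha> \<in> Hom C a0 J" "\<alpha> \<cdot> i = j \<cdot> f"
    using injective_extend[OF J ses_arr(5)[OF s1], of "j \<cdot> f"] i j f by auto
  have "(q \<cdot> \<alpha>) \<cdot> i = Zero C x0 S" using \<alpha> q i j f zq by auto
  then obtain \<beta> where \<beta>: "\<beta> \<in> Hom C k0 S" "\<beta> \<cdot> c = q \<cdot> \<alpha>"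
    by (rule ses_coker_fact[OF s1 i c, rotated]) (use q \<alpha> in auto)
  \<comment> \<open>The only obstructed step: extending \<open>\<beta>\<close> from
    \<open>k0\<close> to \<open>e0\<close> needs Ext^1(t0, S) = Ext^2(t0, d1) to vanish.\<close>
  obtain \<gamma> where \<gamma>: "\<gamma> \<in> Hom C e0 S" "\<gamma> \<cdot> u = \<beta>" by (rule ext1_zeroD[OF E' s2 u v \<beta>(1)])
  obtain d0 m w \<pi> where mw: "ses C m w" and m: "m \<in> Hom C d1 d0" and w: "w \<in> Hom C d0 e0"
    and \<pi>: "\<pi> \<in> Hom C d0 J" "q \<cdot> \<pi> = \<gamma> \<cdot> w" "\<pi> \<cdot> m = j"
    and ex: "\<And>t y z. y \<in> Hom C t J \<Longrightarrow> z \<in> Hom C t e0 \<Longrightarrow> q \<cdot> y = \<gamma> \<cdot> z \<Longrightarrow>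
       \<exists>u\<in>Hom C t d0. \<pi> \<cdot> u = y \<and> w \<cdot> u = z"
    and un: "\<And>t u v. u \<in> Hom C t d0 \<Longrightarrow> v \<in> Hom C t d0 \<Longrightarrow> \<pi> \<cdot> u = \<pi> \<cdot> v \<Longrightarrow> w \<cdot> u = w \<cdot> v \<Longrightarrow> u = v"
    by (rule pullback_ses[OF jq j q \<gamma>(1)]) blast
  note zm = ses_zero[OF mw m w]
  \<comment> \<open>The pair of \<open>\<alpha>\<close> and \<open>u \<cdot> c\<close> is compatible
    over \<open>S\<close>, so it defines the arrow \<open>a\<close> from \<open>a0\<close> into the
    pullback \<open>d0\<close>. It restricts to \<open>m \<cdot> f\<close> on
    \<open>x0\<close>.\<close>
  have "q \<cdot> \<alpha> = \<gamma> \<cdot> (u \<cdot> c)" using assoc_eq[OF \<gamma>(2), of c] \<gamma>(1) u c \<beta>(2) by auto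
  then obtain a where a: "a \<in> Hom C a0 d0" "\<pi> \<cdot> a = \<alpha>" "w \<cdot> a = u \<cdot> c"
    using ex[of \<alpha> a0 "u \<cdot> c"] \<alpha> u c by auto
  have wa: "w \<cdot> (a \<cdot> x) = u \<cdot> (c \<cdot> x)" if "x \<in> Arr C" "Cod C x = a0" for x
    using assoc_eq[OF a(3), of x] a(1) w u c that by auto
  have ai: "a \<cdot> i = m \<cdot> f"
  proof (rule un[of _ x0])
    show "\<pi> \<cdot> (a \<cdot> i) = \<pi> \<cdot> (m \<cdot> f)"
      using assoc_eq[OF a(2), of i] assoc_eq[OF \<pi>(3), of f] a(1) \<pi>(1) i \<alpha> m f by auto
    show "w \<cdot> (a \<cdot> i) = w \<cdot> (m \<cdot> f)" using wa[of i] z1 zm i u f by auto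
  qed (use a i m f in auto)
  have ai': "a \<cdot> (i \<cdot> x) = m \<cdot> (f \<cdot> x)" if "x \<in> Arr C" "Cod C x = x0" for x
    using assoc_eq[OF ai, of x] a(1) i m f that by auto
  have a_ker: "\<exists>x'\<in>Hom C p x0. x = i \<cdot> x'" if x: "x \<in> Hom C p a0" "w \<cdot> (a \<cdot> x) = Zero C p e0" for x p
  proof -
    have "u \<cdot> (c \<cdot> x) = Zero C p e0" using x wa[of x] by auto
    then have "c \<cdot> x = Zero C p k0"
      by (rule mono_elemD[OF ses_arr(5)[OF s2] u, rotated]) (use c x in auto)
    then show ?thesis using ses_ker_fact[OF s1 i c x(1)] by metis
  qed
  have amono: "is_mono C a"
  proof (rule mono_elemI[OF a(1)])
    fix p x assume p: "projective C p" and x: "x \<in> Hom C p a0" "a \<cdot> x = Zero C p d0"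
    have "w \<cdot> (a \<cdot> x) = Zero C p e0" unfolding x(2) using w x(1) by auto
    then obtain x' where x': "x' \<in> Hom C p x0" "x = i \<cdot> x'" using a_ker[OF x(1)] by blast
    have "m \<cdot> (f \<cdot> x') = Zero C p d0" using x(2) x' ai'[of x'] by auto
    then have "f \<cdot> x' = Zero C p d1"
      by (rule mono_elemD[OF ses_arr(5)[OF mw] m, rotated]) (use f x' in auto)
    then have "x' = Zero C p x0" by (rule mono_elemD[OF ses_arr(5)[OF s3] f x'(1)])
    then show "x = Zero C p a0" using x' i by auto
  qed
  \<comment> \<open>\<open>q0\<close> is defined as the cokernel of \<open>a\<close>; the third
    sequence is induced on cokernels and verified by a diagram chase.\<close>
  obtain b where ab: "ses C a b" by (rule mono_ses[OF amono])
  define q0 where "q0 = Cod C b"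
  have b: "b \<in> Hom C d0 q0" using ses_arr[OF ab] a(1) unfolding q0_def by auto
  note zb = ses_zero[OF ab a(1) b]
  have "(v \<cdot> w) \<cdot> a = Zero C a0 t0" using v w a z2 c by auto
  then obtain t where t: "t \<in> Hom C q0 t0" "t \<cdot> b = v \<cdot> w"
    by (rule ses_coker_fact[OF ab a(1) b, rotated]) (use v w in auto)
  have "(b \<cdot> m) \<cdot> f = Zero C x0 q0" using ai[symmetric] b m f zb i by auto
  then obtain s where s: "s \<in> Hom C q1 q0" "s \<cdot> g = b \<cdot> m"
    by (rule ses_coker_fact[OF s3 f g, rotated]) (use b m in auto)
  have tb: "t \<cdot> (b \<cdot> x) = v \<cdot> (w \<cdot> x)" if "x \<in> Arr C" "Cod C x = d0" for x
    using assoc_eq[OF t(2), of x] t(1) b v w that by auto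
  have sg: "s \<cdot> (g \<cdot> x) = b \<cdot> (m \<cdot> x)" if "x \<in> Arr C" "Cod C x = d1" for x
    using assoc_eq[OF s(2), of x] s(1) b g m that by auto
  have "(t \<cdot> s) \<cdot> g = Zero C q1 t0 \<cdot> g" using t(1) s g tb[of m] zm v b m by auto
  then have ts: "t \<cdot> s = Zero C q1 t0"
    by (rule epi_cancel[OF ses_arr(6)[OF s3], of _ t0, rotated 2]) (use t s g in auto)
  have st: "ses C s t"
  proof (rule ses_elemI[OF s(1) t(1) ts])
    fix p z assume p: "projective C p" and z: "z \<in> Hom C p q1" "s \<cdot> z = Zero C p q0"
    obtain y where y: "y \<in> Hom C p d1" "g \<cdot> y = z" by (rule ses_lift[OF s3 g p z(1)])
    have "b \<cdot> (m \<cdot> y) = Zero C p q0" using sg[of y] y z by auto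
    then obtain x where x: "x \<in> Hom C p a0" "a \<cdot> x = m \<cdot> y"
      by (rule ses_ker_fact[OF ab a(1) b, rotated]) (use m y in auto)
    have "w \<cdot> (a \<cdot> x) = Zero C p e0" unfolding x(2) using zm y by auto
    then obtain x' where x': "x' \<in> Hom C p x0" "x = i \<cdot> x'" using a_ker[OF x(1)] by blast
    have "m \<cdot> y = a \<cdot> (i \<cdot> x')" using x(2) unfolding x'(2) by simp
    then have "m \<cdot> y = m \<cdot> (f \<cdot> x')" using ai'[of x'] x'(1) by auto
    then have "y = f \<cdot> x'"
      by (rule mono_cancel[OF ses_arr(5)[OF mw], of _ p, rotated 2]) (use m f y x' in auto)
    then show "z = Zero C p q1" using y z3 x' by auto
  next
    fix p z assume p: "projective C p" and z: "z \<in> Hom C p q0" "t \<cdot> z = Zero C p t0"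
    obtain d where d: "d \<in> Hom C p d0" "b \<cdot> d = z" by (rule ses_lift[OF ab b p z(1)])
    have "v \<cdot> (w \<cdot> d) = Zero C p t0" using tb[of d] d z by auto
    then obtain k where k: "k \<in> Hom C p k0" "u \<cdot> k = w \<cdot> d"
      by (rule ses_ker_fact[OF s2 u v, rotated]) (use w d in auto)
    obtain x where x: "x \<in> Hom C p a0" "c \<cdot> x = k" by (rule ses_lift[OF s1 c p k(1)])
    have "w \<cdot> (d \<boxplus> neg (a \<cdot> x)) = Zero C p e0" using w d(1) a(1) x k wa[of x] u by auto
    then obtain y where y: "y \<in> Hom C p d1" "m \<cdot> y = d \<boxplus> neg (a \<cdot> x)"
      by (rule ses_ker_fact[OF mw m w, rotated]) (use a x d in auto)
    have "b \<cdot> (m \<cdot> y) = z" unfolding y(2) using b d a(1) x(1) zb z(1) by auto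
    then have "s \<cdot> (g \<cdot> y) = z" using sg[of y] y by auto
    then show "\<exists>y\<in>Hom C p q1. s \<cdot> y = z" using g y(1) by (intro bexI[of _ "g \<cdot> y"]) auto
  next
    fix p z assume p: "projective C p" and z: "z \<in> Hom C p t0"
    obtain e where e: "e \<in> Hom C p e0" "v \<cdot> e = z" by (rule ses_lift[OF s2 v p z])
    obtain d where d: "d \<in> Hom C p d0" "w \<cdot> d = e" by (rule ses_lift[OF mw w p e(1)])
    have "t \<cdot> (b \<cdot> d) = z" using tb[of d] d e by auto
    then show "\<exists>y\<in>Hom C p q0. t \<cdot> y = z" using b d(1) by (intro bexI[of _ "b \<cdot> d"]) auto
  qed
  show ?thesis by (rule that[OF ab a(1) b mw m w st s(1) t(1)])
qed

text \<open>The splicing rule: an epi in front does not change the image, and a mono behind does not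
  change the kernel.\<close>

lemma exact_epi_mono:
  assumes s: "ses C k g" and k: "k \<in> Hom C a b" and g: "g \<in> Hom C b c"
    and e: "is_epi C e" "e \<in> Hom C a' a" and m: "is_mono C m" "m \<in> Hom C c c'"
  shows "exact_at C (k \<cdot> e) (m \<cdot> g)"
proof (rule exact_elemI[of _ a' b _ c'])
  note z = ses_zero[OF s k g]
  show "(m \<cdot> g) \<cdot> (k \<cdot> e) = Zero C a' c'" using k g e m z by auto
  fix p x assume p: "projective C p" and x: "x \<in> Hom C p b" "(m \<cdot> g) \<cdot> x = Zero C p c'"
  have "m \<cdot> (g \<cdot> x) = Zero C p c'" using x m g by auto
  then have "g \<cdot> x = Zero C p c"
    by (rule mono_elemD[OF m, rotated]) (use g x in auto)
  then obtain y where y: "y \<in> Hom C p a" "k \<cdot> y = x" using ses_ker_fact[OF s k g x(1)] by metis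
  obtain z where z: "z \<in> Hom C p a'" "e \<cdot> z = y" using projective_lift[OF p e(1), of y] e y by auto
  then show "\<exists>y\<in>Hom C p a'. (k \<cdot> e) \<cdot> y = x" using y k e(2) by (intro bexI[of _ z]) auto
qed (use k g e m in auto)

section \<open>Projective resolutions, syzygies and the comparison with the Ext groups\<close>

lemma proj_res_exists:
  assumes "x \<in> Obj C"
  shows "\<exists>R. is_proj_res C x R"
proof -
  have "\<forall>w\<in>Obj C. \<exists>k e. ses C k e \<and> Cod C e = w \<and> projective C (Cod C k)"
  proof
    fix w assume "w \<in> Obj C"
    then obtain k e w' p where "ses C k e" "k \<in> Hom C w' p" "e \<in> Hom C p w" "projective C p"
      by (rule projective_ses)
    then show "\<exists>k e. ses C k e \<and> Cod C e = w \<and> projective C (Cod C k)"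
      by (intro exI[of _ k] exI[of _ e]) auto
  qed
  then obtain K E where KE: "\<forall>w\<in>Obj C. ses C (K w) (E w) \<and> Cod C (E w) = w \<and> projective C (Cod C (K w))"
    by metis
  \<comment> \<open>\<open>W i\<close> is the i-th syzygy, got by iterating the chosen kernel. The
    projective over \<open>W i\<close> is the common term \<open>Cod C (K (W i))\<close> of the
    presentation.\<close>
  define W where "W i = ((\<lambda>w. Dom C (K w)) ^^ i) x" for i
  have W0: "W 0 = x" and WS: "W (Suc i) = Dom C (K (W i))" for i by (simp_all add: W_def)
  have Wo: "W i \<in> Obj C" for i
  proof (induction i)
    case (Suc i)
    then show ?case using KE ses_arr(1) unfolding WS by auto
  qed (use assms W0 in simp)
  have s: "ses C (K (W i)) (E (W i))" and p: "projective C (Cod C (K (W i)))" for i using KE Wo by auto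
  have K: "K (W i) \<in> Hom C (W (Suc i)) (Cod C (K (W i)))" for i
    using ses_arr[OF s[of i]] Wo[of "Suc i"] by (auto simp: WS)
  have E: "E (W i) \<in> Hom C (Cod C (K (W i))) (W i)" for i
    using ses_arr[OF s[of i]] KE Wo[of i] by auto
  have "is_proj_res C x (\<lambda>i. Cod C (K (W i)), \<lambda>i. K (W i) \<cdot> E (W (Suc i)), E x)"
    unfolding is_proj_res_def
  proof (clarsimp, intro conjI allI)
    fix i
    show "projective C (Cod C (K (W i)))" by (rule p)
    show "K (W i) \<cdot> E (W (Suc i)) \<in> Arr C" "Dom C (K (W i) \<cdot> E (W (Suc i))) = Cod C (K (W (Suc i)))"
      "Cod C (K (W i) \<cdot> E (W (Suc i))) = Cod C (K (W i))" "Cod C (K (W (Suc i))) \<in> Obj C"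
      "Cod C (K (W i)) \<in> Obj C"
      using K[of i] E[of "Suc i"] by auto
    show "exact_at C (K (W (Suc i)) \<cdot> E (W (Suc (Suc i)))) (K (W i) \<cdot> E (W (Suc i)))"
      by (rule exact_epi_mono[OF s K E ses_arr(6)[OF s] E ses_arr(5)[OF s] K])
  next
    show "E x \<in> Arr C" "Dom C (E x) = Cod C (K (W 0))" "Cod C (E x) = x" "Cod C (K (W 0)) \<in> Obj C" "x \<in> Obj C"
      using E[of 0] by (auto simp: W0)
    show "is_epi C (E x)" using ses_arr(6)[OF s[of 0]] by (simp add: W0)
    have "exact_at C (K (W 0) \<cdot> E (W (Suc 0))) (Id C (W 0) \<cdot> E (W 0))"
      by (rule exact_epi_mono[OF s K E ses_arr(6)[OF s] E id_mono[OF Wo] id_hom[OF Wo]])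
    then show "exact_at C (K (W 0) \<cdot> E (W (Suc 0))) (E x)"
      using E[of 0] by (simp add: W0)
  qed
  then show ?thesis by blast
qed

text \<open>A resolution is cut into presentations of its successive syzygies, the form in which
  dimension shift consumes it.\<close>

lemma syzygies:
  assumes "is_proj_res C x (P, d, e)"
  obtains W K E where "\<And>i. ses C (K i) (E i)" "\<And>i. K i \<in> Hom C (W (Suc i)) (P i)"
    "\<And>i. E i \<in> Hom C (P i) (W i)" "W 0 = x" "E 0 = e" "\<And>i. d i = K i \<cdot> E (Suc i)"
    "\<And>i. projective C (P i)"
proof -
  have R: "\<And>i. projective C (P i)" "\<And>i. d i \<in> Hom C (P (Suc i)) (P i)" "e \<in> Hom C (P 0) x"
    "is_epi C e" "exact_at C (d 0) e" "\<And>i. exact_at C (d (Suc i)) (d i)"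
    using assms unfolding is_proj_res_def by auto
  \<comment> \<open>The augmentation is put at index 0, so that every differential
    \<open>d i\<close> is followed by \<open>D i\<close> and all exactness statements become
    uniform.\<close>
  define D where "D i = (case i of 0 \<Rightarrow> e | Suc j \<Rightarrow> d j)" for i
  have ex: "exact_at C (d i) (D i)" for i using R(5,6) by (cases i) (auto simp: D_def)
  have "\<forall>i. \<exists>q k. is_epi C q \<and> is_mono C k \<and> q \<in> Hom C (Dom C (d i)) (Dom C k) \<and>
    k \<in> Hom C (Dom C k) (Cod C (d i)) \<and> k \<cdot> q = d i \<and> is_kernel C k (D i)"
    using exactE[OF ex] by metis
  then obtain q k where qk: "is_epi C (q i)" "is_mono C (k i)" "q i \<in> Hom C (Dom C (d i)) (Dom C (k i))"
    "k i \<in> Hom C (Dom C (k i)) (Cod C (d i))" "k i \<cdot> q i = d i" "is_kernel C (k i) (D i)" for i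
    by metis
  define E where "E i = (case i of 0 \<Rightarrow> e | Suc j \<Rightarrow> q j)" for i
  define W where "W i = Cod C (E i)" for i
  have K: "k i \<in> Hom C (W (Suc i)) (P i)" for i
    using qk(3,4)[of i] R(2)[of i] by (auto simp: W_def E_def)
  have E: "E i \<in> Hom C (P i) (W i)" for i
    using qk(3)[of "i - 1"] R(2)[of "i - 1"] R(3) by (cases i) (auto simp: W_def E_def)
  have s: "ses C (k i) (E i)" for i
  proof (cases i)
    case 0
    then show ?thesis using qk(6)[of 0] R(4) by (auto simp: D_def E_def intro: kernel_ses)
  next
    case (Suc j)
    have dj: "d j = k j \<cdot> q j" using qk(5) by simp
    have q: "q j \<in> Hom C (P i) (W i)" using E[of i] Suc by (simp add: E_def)
    have kj: "k j \<in> Hom C (W i) (P j)" using K[of j] Suc by simp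
    have ker: "is_kernel C (k i) (d j)" using qk(6)[of i] Suc by (simp add: D_def)
    then have z: "d j \<cdot> k i = Zero C (W (Suc i)) (P j)"
      using K[of i] R(2)[of j] unfolding is_kernel_def by auto
    have zq: "q j \<cdot> k i = Zero C (W (Suc i)) (W i)"
    proof (rule mono_elemD[OF qk(2) kj])
      show "k j \<cdot> (q j \<cdot> k i) = Zero C (W (Suc i)) (P j)"
        using z q kj K[of i] unfolding dj by auto
    qed (use q K[of i] in auto)
    \<comment> \<open>Since \<open>k j\<close> is mono, \<open>q j\<close> has the same kernel as
      the differential \<open>d j\<close>.\<close>
    have "is_kernel C (k i) (q j)"
    proof (rule is_kernelI[OF qk(2) K q zq])
      fix c t assume t: "t \<in> Hom C c (P i)" "q j \<cdot> t = Zero C c (W i)"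
      have "d j \<cdot> t = k j \<cdot> (q j \<cdot> t)" unfolding dj using q kj t(1) by auto
      then have "d j \<cdot> t = Zero C c (P j)" unfolding t(2) using kj t(1) by auto
      then show "\<exists>u\<in>Hom C c (W (Suc i)). k i \<cdot> u = t"
        using ker_fact[OF ker K _ t(1), of "P j"] R(2)[of j] Suc by (metis)
    qed
    then show ?thesis using qk(1)[of j] Suc by (auto simp: E_def intro: kernel_ses)
  qed
  show ?thesis
    by (rule that[OF s K E]) (use R qk(5) E[of 0] in \<open>auto simp: W_def E_def\<close>)
qed

lemma res_syzygies:
  assumes "x \<in> Obj C"
  obtains W K E where "\<And>i. ses C (K i) (E i)" "\<And>i. K i \<in> Hom C (W (Suc i)) (res_obj C x i)"
    "\<And>i. E i \<in> Hom C (res_obj C x i) (W i)" "W 0 = x" "\<And>i. res_diff C x i = K i \<cdot> E (Suc i)"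
    "\<And>i. projective C (res_obj C x i)"
proof -
  have "is_proj_res C x (proj_res C x)"
    unfolding proj_res_def by (rule someI_ex[OF proj_res_exists[OF assms]])
  then have "is_proj_res C x (res_obj C x, res_diff C x, snd (snd (proj_res C x)))"
    by (simp add: res_obj_def res_diff_def)
  from syzygies[OF this] that show ?thesis by metis
qed

text \<open>If the quotient has \<open>H\<close> as its only element, then \<open>z\<close> = 0 +
  \<open>z\<close> lies in the coset of \<open>z\<close>, which is \<open>H\<close>. Conversely, if
  \<open>H\<close> is everything, all cosets coincide.\<close>

lemma trivial_quotient:
  assumes "a \<in> Obj C" "b \<in> Obj C"
    and Z: "Z \<subseteq> Hom C a b" "Zero C a b \<in> Z" "\<And>f g. f \<in> Z \<Longrightarrow> g \<in> Z \<Longrightarrow> f \<boxplus> g \<in> Z"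
      "\<And>f. f \<in> Z \<Longrightarrow> neg f \<in> Z"
    and H: "H \<subseteq> Z" "Zero C a b \<in> H"
  shows "trivial_group ((hom_group C a b)\<lparr>carrier := Z\<rparr> Mod H) \<longleftrightarrow> Z \<subseteq> H"
proof -
  interpret G: comm_group "hom_group C a b" by (rule hom_comm_group[OF assms(1,2)])
  let ?G = "(hom_group C a b)\<lparr>carrier := Z\<rparr>"
  have "subgroup Z (hom_group C a b)"
  proof (rule G.subgroupI)
    fix f assume f: "f \<in> Z"
    then have "inv\<^bsub>hom_group C a b\<^esub> f = neg f" using Z(1) unfolding neg_def by auto
    then show "inv\<^bsub>hom_group C a b\<^esub> f \<in> Z" using Z(4)[OF f] by simp
  qed (use Z in \<open>auto simp: hom_group_simps\<close>)
  then have "group ?G" by (rule G.subgroup_imp_group)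
  then interpret Z: group ?G .
  have "f \<boxplus> g = g \<boxplus> f" if "f \<in> Z" "g \<in> Z" for f g
  proof -
    have "f \<in> Hom C a b" "g \<in> Hom C a b" using that Z(1) by blast+
    then show ?thesis using add_comm[of f g] by simp
  qed
  then interpret Z: comm_group ?G
    by (intro Z.group_comm_groupI) (auto simp: hom_group_simps)
  have cs: "carrier ?G = Z" "one ?G = Zero C a b" "mult ?G = Add C" by (simp_all add: hom_group_simps)
  show ?thesis
  proof
    assume "trivial_group (?G Mod H)"
    then have tr: "carrier (?G Mod H) = {H}" unfolding trivial_group_def FactGroup_def by simp
    show "Z \<subseteq> H"
    proof
      fix z assume z: "z \<in> Z"
      have "H #>\<^bsub>?G\<^esub> z \<in> carrier (?G Mod H)" using z by (auto simp: FactGroup_def RCOSETS_def cs(1))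
      then have "H #>\<^bsub>?G\<^esub> z = H" using tr by simp
      moreover have "Zero C a b \<boxplus> z \<in> H #>\<^bsub>?G\<^esub> z" using H(2) by (auto simp: r_coset_def cs(3))
      moreover have "Zero C a b \<boxplus> z = z" using z Z(1) by auto
      ultimately show "z \<in> H" by simp
    qed
  next
    assume "Z \<subseteq> H"
    then have HZ: "H = carrier ?G" using H by auto
    have n: "normal (carrier ?G) ?G" by (rule Z.subgroup_imp_normal[OF Z.subgroup_self])
    have "H #>\<^bsub>?G\<^esub> z = H" if "z \<in> carrier ?G" for z
      unfolding HZ by (rule Z.coset_join2[OF that Z.subgroup_self that])
    then have "carrier (?G Mod H) = {H}"
      using Z.one_closed unfolding FactGroup_def RCOSETS_def by auto
    then show "trivial_group (?G Mod H)"
      using normal.factorgroup_is_group[OF n] unfolding trivial_group_def HZ by (auto simp: FactGroup_def)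
  qed
qed

text \<open>Cocycles in degree n + 1 are arrows out of the syzygy \<open>W (Suc n)\<close>, and
  coboundaries are those that extend over the n-th projective. Their equality is Ext^1 vanishing for
  \<open>W n\<close>, which shifts back to \<open>x\<close> in n steps.\<close>

lemma Ext_trivial_iff:
  assumes x: "x \<in> Obj C" and y: "y \<in> Obj C"
  shows "trivial_group (Ext C (Suc n) x y) \<longleftrightarrow> ext_zero n x y"
proof -
  obtain W K E where s: "\<And>i. ses C (K i) (E i)" and K: "\<And>i. K i \<in> Hom C (W (Suc i)) (res_obj C x i)"
    and E: "\<And>i. E i \<in> Hom C (res_obj C x i) (W i)" and W0: "W 0 = x"
    and d: "\<And>i. res_diff C x i = K i \<cdot> E (Suc i)" and P: "\<And>i. projective C (res_obj C x i)"
    by (rule res_syzygies[OF x]) blast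
  note z = ses_zero[OF s K E]
  let ?P = "res_obj C x"
  let ?Z = "ext_cocycles C (Suc n) x y" and ?H = "ext_coboundaries C (Suc n) x y"
  have dT: "res_diff C x i \<in> Hom C (?P (Suc i)) (?P i)" for i using K[of i] E[of "Suc i"] d[of i] by auto
  have ob: "?P i \<in> Obj C" for i using K[of i] by auto
  have dd: "res_diff C x i \<cdot> res_diff C x (Suc i) = Zero C (?P (Suc (Suc i))) (?P i)" for i
    unfolding d using K[of i] E[of "Suc i"] K[of "Suc i"] E[of "Suc (Suc i)"] z(2)[of "E (Suc (Suc i))" "Suc i"] by auto
  have "trivial_group (Ext C (Suc n) x y) \<longleftrightarrow> ?Z \<subseteq> ?H"
    unfolding Ext_def
  proof (rule trivial_quotient[OF ob y])
    show "Zero C (?P (Suc n)) y \<in> ?H"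
      using dT[of n] y ob by (auto intro!: image_eqI[of _ _ "Zero C (?P n) y"])
    show "?H \<subseteq> ?Z"
    proof
      fix \<phi> assume "\<phi> \<in> ?H"
      then obtain \<psi> where \<psi>: "\<psi> \<in> Hom C (?P n) y" "\<phi> = \<psi> \<cdot> res_diff C x n" by auto
      then show "\<phi> \<in> ?Z" using dT[of n] dT[of "Suc n"] dd[of n] unfolding ext_cocycles_def by auto
    qed
  qed (use dT[of "Suc n"] ob y in \<open>auto simp: ext_cocycles_def\<close>)
  also have "\<dots> \<longleftrightarrow> (\<forall>h\<in>Hom C (W (Suc n)) y. \<exists>l\<in>Hom C (?P n) y. l \<cdot> K n = h)"
  proof (intro iffI ballI subsetI)
    fix h assume H: "?Z \<subseteq> ?H" and h: "h \<in> Hom C (W (Suc n)) y"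
    have "h \<cdot> E (Suc n) \<in> ?Z"
      using h E[of "Suc n"] K[of "Suc n"] E[of "Suc (Suc n)"] z(2)[of "E (Suc (Suc n))" "Suc n"]
      unfolding ext_cocycles_def by (auto simp: d)
    then have "h \<cdot> E (Suc n) \<in> ?H" using H by blast
    then obtain \<psi> where \<psi>: "\<psi> \<in> Hom C (?P n) y" "h \<cdot> E (Suc n) = \<psi> \<cdot> res_diff C x n" by auto
    then have "(\<psi> \<cdot> K n) \<cdot> E (Suc n) = h \<cdot> E (Suc n)" using K[of n] E[of "Suc n"] by (auto simp: d)
    then have "\<psi> \<cdot> K n = h"
      by (rule epi_cancel[OF ses_arr(6)[OF s], of _ "Suc n" y, rotated 2]) (use \<psi> K[of n] E[of "Suc n"] h in auto)
    then show "\<exists>l\<in>Hom C (?P n) y. l \<cdot> K n = h" using \<psi>(1) by blast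
  next
    \<comment> \<open>A cocycle vanishes on the next syzygy, as one sees by cancelling the epi onto
      it, and therefore factors through \<open>E (Suc n)\<close>.\<close>
    fix \<phi> assume R: "\<forall>h\<in>Hom C (W (Suc n)) y. \<exists>l\<in>Hom C (?P n) y. l \<cdot> K n = h" and "\<phi> \<in> ?Z"
    then have \<phi>: "\<phi> \<in> Hom C (?P (Suc n)) y" "\<phi> \<cdot> res_diff C x (Suc n) = Zero C (?P (Suc (Suc n))) y"
      unfolding ext_cocycles_def by auto
    have "(\<phi> \<cdot> K (Suc n)) \<cdot> E (Suc (Suc n)) = Zero C (W (Suc (Suc n))) y \<cdot> E (Suc (Suc n))"
      using \<phi> K[of "Suc n"] E[of "Suc (Suc n)"] by (auto simp: d)
    then have "\<phi> \<cdot> K (Suc n) = Zero C (W (Suc (Suc n))) y"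
      by (rule epi_cancel[OF ses_arr(6)[OF s], of _ "Suc (Suc n)" y, rotated 2])
        (use \<phi> K[of "Suc n"] E[of "Suc (Suc n)"] in auto)
    then obtain h where h: "h \<in> Hom C (W (Suc n)) y" "h \<cdot> E (Suc n) = \<phi>"
      using ses_coker_fact[OF s K E \<phi>(1)] by metis
    then obtain l where l: "l \<in> Hom C (?P n) y" "l \<cdot> K n = h" using R by blast
    have "l \<cdot> res_diff C x n = \<phi>"
      using assoc_eq[OF l(2), of "E (Suc n)"] l(1) K[of n] E[of "Suc n"] h by (auto simp: d)
    then show "\<phi> \<in> ?H" using l(1) by auto
  qed
  also have "\<dots> \<longleftrightarrow> ext1_zero (W n) y"
  proof
    assume "\<forall>h\<in>Hom C (W (Suc n)) y. \<exists>l\<in>Hom C (?P n) y. l \<cdot> K n = h"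
    then show "ext1_zero (W n) y" by (intro ext1_zero_projI[OF s K E P y]) blast
  next
    assume "ext1_zero (W n) y"
    then show "\<forall>h\<in>Hom C (W (Suc n)) y. \<exists>l\<in>Hom C (?P n) y. l \<cdot> K n = h"
      using ext1_zeroD[OF _ s K E] by metis
  qed
  also have "\<dots> \<longleftrightarrow> ext_zero n x y"
  proof -
    have "ext_zero j (W i) y \<longleftrightarrow> ext_zero (j + i) x y" for i j
    proof (induction i arbitrary: j)
      case (Suc i)
      then show ?case using ext_zero_shift[OF s K E P y, of j i] by simp
    qed (simp add: W0)
    from this[of 0 n] show ?thesis by simp
  qed
  finally show ?thesis .
qed

lemma Ext_vanishes_iff:
  assumes "X \<subseteq> Obj C" "Y \<subseteq> Obj C"
  shows "Ext_vanishes C (Suc k) X Y \<longleftrightarrow> (\<forall>x\<in>X. \<forall>y\<in>Y. ext_zero k x y)"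
  using Ext_trivial_iff assms unfolding Ext_vanishes_def by blast

end

section \<open>Right cotorsion pairs\<close>

lemma additive_subcatD:
  assumes "additive_subcat C M"
  shows "M \<subseteq> Obj C" "\<exists>z\<in>M. is_zero C z" "a \<in> M \<Longrightarrow> isomorphic C a b \<Longrightarrow> b \<in> M"
    "a \<in> M \<Longrightarrow> b \<in> M \<Longrightarrow> is_biprod C a b (s, i1, i2, p1, p2) \<Longrightarrow> s \<in> M"
  using assms unfolding additive_subcat_def by blast+

lemma right_cotorsion_pairD:
  assumes "right_cotorsion_pair C n X Y"
  shows "additive_subcat C X" "additive_subcat C Y" "summand_closed C Y"
    "i \<in> {1..n} \<Longrightarrow> Ext_vanishes C i X Y"
    "a \<in> Obj C \<Longrightarrow>
       \<exists>f g. ses C f g \<and> Dom C f = a \<and> Cod C f \<in> Y \<and> Cod C g \<in> coresolved C X (n - 1)"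
  using assms unfolding right_cotorsion_pair_def by blast+

context abelian_enough
begin

lemma exact_from_zero_mono:
  assumes "is_zero C (Dom C d)" "exact_at C d f"
  shows "is_mono C f"
proof -
  note T = exact_arr[OF assms(2)]
  show ?thesis
  proof (rule mono_elemI[of _ "Cod C d" "Cod C f"])
    fix p x assume p: "projective C p" and x: "x \<in> Hom C p (Cod C d)" "f \<cdot> x = Zero C p (Cod C f)"
    obtain y where y: "y \<in> Hom C p (Dom C d)" "d \<cdot> y = x"
      by (rule exact_elemD[OF assms(2) p, of x]) (use x T in auto)
    have "y = Zero C p (Dom C d)" by (rule zero_obj_arr(2)[OF assms(1) y(1)])
    then show "x = Zero C p (Cod C d)" using y T by auto
  qed (use T in auto)
qed

lemma exact_to_zero_epi:
  assumes "is_zero C (Cod C d)" "exact_at C f d"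
  shows "is_epi C f"
proof -
  note T = exact_arr[OF assms(2)]
  show ?thesis
  proof (rule epi_elemI[of _ "Dom C f" "Cod C f"])
    fix p x assume p: "projective C p" and x: "x \<in> Hom C p (Cod C f)"
    have "d \<cdot> x = Zero C p (Cod C d)" by (rule zero_obj_arr(2)[OF assms(1)]) (use x T in auto)
    then show "\<exists>y\<in>Hom C p (Dom C f). f \<cdot> y = x"
      using exact_elemD[OF assms(2) p, of x] x T by metis
  qed (use T in auto)
qed

lemma mono_exact_from_zero:
  assumes "is_mono C f" "f \<in> Hom C a b" "z \<in> Obj C"
  shows "exact_at C (Zero C z a) f"
proof (rule exact_elemI[OF _ assms(2)])
  fix p x assume x: "x \<in> Hom C p a" "f \<cdot> x = Zero C p b"
  then have "x = Zero C p a" by (intro mono_elemD[OF assms(1,2)])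
  then show "\<exists>y\<in>Hom C p z. Zero C z a \<cdot> y = x"
    using x(1) assms by (intro bexI[of _ "Zero C p z"]) auto
qed (use assms in auto)

text \<open>The first term is peeled off: the cokernel \<open>b\<close> of \<open>a\<close> -> M^0
  embeds into M^1, and the remaining terms coresolve \<open>b\<close>.\<close>

lemma coresolved_subset:
  assumes M: "additive_subcat C M"
  shows "a \<in> coresolved C M m \<Longrightarrow> a \<in> cores M m"
proof (induction m arbitrary: a)
  case 0
  then obtain X d where ex: "exact_seq C 3 X d" and X: "is_zero C (X 0)" "X 1 = a" "X 2 \<in> M"
    "is_zero C (X 3)" unfolding coresolved_def by (auto simp: numeral_eq_Suc)
  have d: "d i \<in> Hom C (X i) (X (Suc i))" if "i < 3" for i
    using ex that unfolding exact_seq_def by blast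
  have e: "exact_at C (d i) (d (Suc i))" if "Suc i < 3" for i
    using ex that unfolding exact_seq_def by blast
  \<comment> \<open>With 0 on both sides of \<open>a\<close> -> M^0, the arrow \<open>d 1\<close> is
    invertible, and closure under isomorphism puts \<open>a\<close> into \<open>M\<close>.\<close>
  have "is_mono C (d 1)" using exact_from_zero_mono[of "d 0" "d 1"] e[of 0] X(1) d[of 0] by auto
  moreover have "is_epi C (d 1)"
    using exact_to_zero_epi[of "d 2" "d 1"] e[of 1] X(4) d[of 2] by (auto simp: numeral_eq_Suc)
  ultimately obtain g where "g \<in> Hom C (Cod C (d 1)) (Dom C (d 1))" "g \<cdot> d 1 = Id C (Dom C (d 1))"
    "d 1 \<cdot> g = Id C (Cod C (d 1))" by (rule mono_epi_iso)
  then have "isomorphic C (X 2) a"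
    using d[of 1] X(2) by (intro isomorphicI[of g _ _ "d 1"]) (auto simp: numeral_2_eq_2)
  then show ?case using additive_subcatD(3)[OF M X(3)] by simp
next
  case (Suc m)
  then obtain X d where ex: "exact_seq C (Suc m + 3) X d" and X: "is_zero C (X 0)" "X 1 = a"
    "\<And>j. j \<le> Suc m \<Longrightarrow> X (j + 2) \<in> M" "is_zero C (X (Suc m + 3))" unfolding coresolved_def by auto
  have Xo: "X i \<in> Obj C" if "i \<le> Suc m + 3" for i
    using ex that unfolding exact_seq_def by blast
  have d: "d i \<in> Hom C (X i) (X (Suc i))" if "i < Suc m + 3" for i
    using ex that unfolding exact_seq_def by blast
  have e: "exact_at C (d i) (d (Suc i))" if "Suc i < Suc m + 3" for i
    using ex that unfolding exact_seq_def by blast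
  have mono: "is_mono C (d 1)" using exact_from_zero_mono[of "d 0" "d 1"] e[of 0] X(1) d[of 0] by auto
  obtain g where s: "ses C (d 1) g" by (rule mono_ses[OF mono])
  define b where "b = Cod C g"
  have d1: "d 1 \<in> Hom C a (X 2)" using d[of 1] X(2) by (auto simp: numeral_2_eq_2)
  have d2: "d 2 \<in> Hom C (X 2) (X 3)" using d[of 2] by (auto simp: numeral_2_eq_2 numeral_3_eq_3)
  have d3: "d 3 \<in> Hom C (X 3) (X 4)" using d[of 3] by (auto simp: eval_nat_numeral)
  have e12: "exact_at C (d 1) (d 2)" using e[of 1] by (auto simp: numeral_2_eq_2)
  have e23: "exact_at C (d 2) (d 3)" using e[of 2] by (auto simp: numeral_3_eq_3)
  have g: "g \<in> Hom C (X 2) b" using ses_arr[OF s] d1 by (auto simp: b_def)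
  have "d 2 \<cdot> d 1 = Zero C a (X 3)" using exact_arr(4)[OF e12] d1 d2 by auto
  then obtain u where u: "u \<in> Hom C b (X 3)" "u \<cdot> g = d 2" by (rule ses_coker_fact[OF s d1 g d2])
  have um: "is_mono C u"
  proof (rule mono_elemI[OF u(1)])
    fix p z assume p: "projective C p" and z: "z \<in> Hom C p b" "u \<cdot> z = Zero C p (X 3)"
    obtain x where x: "x \<in> Hom C p (X 2)" "g \<cdot> x = z" by (rule ses_lift[OF s g p z(1)])
    have "d 2 \<cdot> x = Zero C p (X 3)" using assoc_eq[OF u(2), of x] u(1) g x z by auto
    then obtain y where y: "y \<in> Hom C p a" "d 1 \<cdot> y = x"
      using exact_elemD[OF e12 p, of x] x d1 d2 by (metis Hom_iff)
    show "z = Zero C p b" using ses_zero(2)[OF s d1 g, of y] x y by auto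
  qed
  have eu: "exact_at C u (d 3)"
  proof (rule exact_elemI[OF u(1) d3])
    have "(d 3 \<cdot> u) \<cdot> g = d 3 \<cdot> (u \<cdot> g)" using d3 u(1) g by auto
    also have "\<dots> = Zero C b (X 4) \<cdot> g" unfolding u(2) using exact_arr(4)[OF e23] d2 d3 g by auto
    finally show "d 3 \<cdot> u = Zero C b (X 4)"
      by (rule epi_cancel[OF ses_arr(6)[OF s], of _ "X 4", rotated 2]) (use d3 u g in auto)
    fix p x assume p: "projective C p" and x: "x \<in> Hom C p (X 3)" "d 3 \<cdot> x = Zero C p (X 4)"
    obtain y where y: "y \<in> Hom C p (X 2)" "d 2 \<cdot> y = x"
      using exact_elemD[OF e23 p, of x] x d2 d3 by (metis Hom_iff)
    have "u \<cdot> (g \<cdot> y) = x" using assoc_eq[OF u(2), of y] y u(1) g by auto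
    then show "\<exists>y\<in>Hom C p b. u \<cdot> y = x" using g y(1) by (intro bexI[of _ "g \<cdot> y"]) auto
  qed
  \<comment> \<open>M^0 at position 2 disappears: \<open>b\<close> takes position 1, and everything
    from position 3 on moves down by one.\<close>
  let ?X = "\<lambda>i. if i = 0 then X 0 else if i = 1 then b else X (Suc i)"
  let ?d = "\<lambda>i. if i = 0 then Zero C (X 0) b else if i = 1 then u else d (Suc i)"
  have "exact_seq C (m + 3) ?X ?d"
    unfolding exact_seq_def
  proof (intro conjI allI impI)
    fix i assume i: "i \<le> m + 3"
    show "?X i \<in> Obj C" using Xo[of 0] Xo[of "Suc i"] g i by auto
  next
    fix i assume i: "i < m + 3"
    show "?d i \<in> Hom C (?X i) (?X (Suc i))"
      using Xo[of 0] u(1) d[of "Suc i"] i by (auto simp: numeral_3_eq_3)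
  next
    fix i assume i: "Suc i < m + 3"
    consider "i = 0" | "i = 1" | "i \<ge> 2" by linarith
    then show "exact_at C (?d i) (?d (Suc i))"
    proof cases
      case 1
      then show ?thesis using mono_exact_from_zero[OF um u(1) Xo[of 0]] by simp
    next
      case 2
      then show ?thesis using eu by (simp add: numeral_3_eq_3)
    next
      case 3
      then show ?thesis using e[of "Suc i"] i by simp
    qed
  qed
  then have "b \<in> coresolved C M m"
    unfolding coresolved_def using g X(1,4) X(3)[of "Suc _"]
    by (auto intro!: exI[of _ ?X] exI[of _ ?d] simp: numeral_2_eq_2)
  then have "b \<in> cores M m" by (rule Suc.IH)
  then show ?case using cores_SucI[OF s d1 g, of M m] X(3)[of 0] by (simp add: numeral_2_eq_2)
qed

lemma cores_subset:
  assumes M: "additive_subcat C M"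
  shows "a \<in> cores M m \<Longrightarrow> a \<in> coresolved C M m"
proof (induction m arbitrary: a)
  case 0
  obtain z where z: "is_zero C z" "z \<in> M" using additive_subcatD(2)[OF M] by blast
  have a: "a \<in> M" "a \<in> Obj C" and zo: "z \<in> Obj C" using 0 z additive_subcatD(1)[OF M] by auto
  let ?X = "\<lambda>i::nat. if i = 1 \<or> i = 2 then a else z"
  let ?d = "\<lambda>i::nat. if i = 0 then Zero C z a else if i = 1 then Id C a else Zero C a z"
  have "exact_seq C 3 ?X ?d"
    unfolding exact_seq_def
  proof (intro conjI allI impI)
    fix i :: nat assume i: "Suc i < 3"
    have "exact_at C (Id C a) (Zero C a z)" by (rule ses_arr(7)[OF ses_id_zero[OF a(2) z(1)]])
    moreover have "exact_at C (Zero C z a) (Id C a)"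
      by (rule mono_exact_from_zero[OF id_mono]) (use a zo in auto)
    ultimately show "exact_at C (?d i) (?d (Suc i))" using i by (cases "i = 0") auto
  qed (use a zo in \<open>auto simp: less_Suc_eq numeral_3_eq_3\<close>)
  then show ?case
    unfolding coresolved_def using a z by (auto intro!: exI[of _ ?X] exI[of _ ?d] simp: numeral_3_eq_3)
next
  case (Suc m)
  obtain f g b c where s: "ses C f g" and f: "f \<in> Hom C a b" and g: "g \<in> Hom C b c"
    and b: "b \<in> M" and "c \<in> cores M m" by (rule cores_SucE[OF Suc.prems])
  then have "c \<in> coresolved C M m" by (intro Suc.IH)
  then obtain X d where ex: "exact_seq C (m + 3) X d" and X: "is_zero C (X 0)" "X 1 = c"
    "\<And>j. j \<le> m \<Longrightarrow> X (j + 2) \<in> M" "is_zero C (X (m + 3))" unfolding coresolved_def by auto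
  have Xo: "X i \<in> Obj C" if "i \<le> m + 3" for i
    using ex that unfolding exact_seq_def by blast
  have d: "d i \<in> Hom C (X i) (X (Suc i))" if "i < m + 3" for i
    using ex that unfolding exact_seq_def by blast
  have e: "exact_at C (d i) (d (Suc i))" if "Suc i < m + 3" for i
    using ex that unfolding exact_seq_def by blast
  have mono: "is_mono C (d 1)" using exact_from_zero_mono[of "d 0" "d 1"] e[of 0] X(1) d[of 0] by auto
  have d1: "d 1 \<in> Hom C c (X 2)" using d[of 1] X(2) by (auto simp: numeral_2_eq_2)
  have d2: "d 2 \<in> Hom C (X 2) (X 3)" using d[of 2] by (auto simp: numeral_2_eq_2 numeral_3_eq_3)
  have e12: "exact_at C (d 1) (d 2)" using e[of 1] by (auto simp: numeral_2_eq_2)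
  have eu: "exact_at C (d 1 \<cdot> g) (d 2)"
  proof (rule exact_elemI[of _ b "X 2" _ "X 3"])
    have "d 2 \<cdot> (d 1 \<cdot> g) = (d 2 \<cdot> d 1) \<cdot> g" using d1 d2 g by auto
    also have "\<dots> = Zero C b (X 3)" using exact_arr(4)[OF e12] d1 d2 g by auto
    finally show "d 2 \<cdot> (d 1 \<cdot> g) = Zero C b (X 3)" .
    fix p x assume p: "projective C p" and x: "x \<in> Hom C p (X 2)" "d 2 \<cdot> x = Zero C p (X 3)"
    obtain y where y: "y \<in> Hom C p c" "d 1 \<cdot> y = x"
      using exact_elemD[OF e12 p, of x] x d1 d2 by (metis Hom_iff)
    obtain w where w: "w \<in> Hom C p b" "g \<cdot> w = y" by (rule ses_lift[OF s g p y(1)])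
    show "\<exists>y\<in>Hom C p b. (d 1 \<cdot> g) \<cdot> y = x" using y w d1 g by (intro bexI[of _ w]) auto
  qed (use d1 d2 g in auto)
  have fe: "exact_at C f (d 1 \<cdot> g)"
    using exact_epi_mono[OF s f g id_epi id_hom mono d1] f by auto
  have f0: "exact_at C (Zero C (X 0) a) f"
    by (rule mono_exact_from_zero[OF ses_arr(5)[OF s] f Xo[of 0]]) simp
  \<comment> \<open>The reverse shift: \<open>a\<close> and \<open>b\<close> take positions 1 and 2,
    whatever followed \<open>c\<close> moves up by one, and the arrow out of \<open>b\<close> runs
    through \<open>c\<close>.\<close>
  let ?X = "\<lambda>i. if i = 0 then X 0 else if i = 1 then a else if i = 2 then b else X (i - 1)"
  let ?d = "\<lambda>i. if i = 0 then Zero C (X 0) a else if i = 1 then f else if i = 2 then d 1 \<cdot> g else d (i - 1)"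
  have "exact_seq C (Suc m + 3) ?X ?d"
    unfolding exact_seq_def
  proof (intro conjI allI impI)
    fix i assume i: "i \<le> Suc m + 3"
    show "?X i \<in> Obj C" using Xo[of 0] Xo[of "i - 1"] f i by auto
  next
    fix i assume i: "i < Suc m + 3"
    consider "i = 0" | "i = 1" | "i = 2" | j where "i = Suc j" "j \<ge> 2" by (cases i) force+
    then show "?d i \<in> Hom C (?X i) (?X (Suc i))"
    proof cases
      case 4
      then show ?thesis using d[of j] i by auto
    qed (use Xo[of 0] f g d1 in \<open>auto simp: numeral_2_eq_2\<close>)
  next
    fix i assume i: "Suc i < Suc m + 3"
    consider "i = 0" | "i = 1" | "i = 2" | j where "i = Suc j" "j \<ge> 2" by (cases i) force+
    then show "exact_at C (?d i) (?d (Suc i))"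
    proof cases
      case 4
      then show ?thesis using e[of j] i by auto
    qed (use f0 fe eu in \<open>auto simp: numeral_2_eq_2\<close>)
  qed
  moreover have "?X (j + 2) \<in> M" if "j \<le> Suc m" for j
    using X(3)[of "j - 1"] b that by (cases j) auto
  moreover have "is_zero C (?X (Suc m + 3))" using X(4) by (simp add: add.commute)
  moreover have "a \<in> Obj C" "is_zero C (?X 0)" "?X 1 = a" using f X(1) by simp_all
  ultimately show ?case
    unfolding coresolved_def mem_Collect_eq by (intro conjI exI[of _ ?X] exI[of _ ?d]) blast+
qed

lemma coresolved_eq_cores: "additive_subcat C M \<Longrightarrow> coresolved C M m = cores M m"
  using coresolved_subset cores_subset by blast

section \<open>Dimension shift along coresolutions, and orthogonal classes\<close>

text \<open>Each step of the coresolution trades \<open>a\<close> for its cokernel one degree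
  higher, so a coresolution of length \<open>m\<close> involves the degrees from \<open>k\<close> to
  \<open>k + m\<close>.\<close>

lemma ext_zero_cores:
  assumes "y \<in> Obj C" "M \<subseteq> Obj C"
  shows "a \<in> cores M m \<Longrightarrow> (\<And>j x. k \<le> j \<Longrightarrow> j \<le> k + m \<Longrightarrow> x \<in> M \<Longrightarrow> ext_zero j x y) \<Longrightarrow> ext_zero k a y"
proof (induction m arbitrary: a k)
  case (Suc m)
  obtain f g b c where s: "ses C f g" and f: "f \<in> Hom C a b" and g: "g \<in> Hom C b c"
    and b: "b \<in> M" and c: "c \<in> cores M m" by (rule cores_SucE[OF Suc.prems(1)])
  have "ext_zero (Suc k) c y" by (rule Suc.IH[OF c]) (rule Suc.prems(2), auto)
  then show ?case using ext_zero_kernel[OF s f g assms(1)] Suc.prems(2)[OF _ _ b, of k] by auto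
qed auto

lemma ext1_zero_summand:
  assumes "ext1_zero x y" "ses C f g" "f \<in> Hom C y b" "g \<in> Hom C b x" "summand_closed C M" "b \<in> M"
  shows "y \<in> M"
  using ext1_zero_split[OF assms(1-4)] assms(5,6) unfolding summand_closed_def by metis

text \<open>The index of \<open>ext_zero\<close> is one less than the Ext degree, so degrees 1 to
  \<open>n\<close> become \<open>k < n\<close>.\<close>

lemma perp_iff:
  assumes "X \<subseteq> Obj C"
  shows "a \<in> perp C X n \<longleftrightarrow> a \<in> Obj C \<and> (\<forall>x\<in>X. \<forall>k<n. ext_zero k x a)"
proof -
  have "(\<forall>i\<in>{1..n}. Ext_vanishes C i X {a}) \<longleftrightarrow> (\<forall>k<n. Ext_vanishes C (Suc k) X {a})"
    by (metis (no_types, opaque_lifting) One_nat_def Suc_le_D Suc_le_eq Suc_le_mono atLeastAtMost_iff le0)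
  then show ?thesis
    using Ext_vanishes_iff[of X "{a}"] assms unfolding perp_def by auto
qed

lemma right_cotorsion_perp:
  assumes ct: "right_cotorsion_pair C n X Y" and n: "n \<ge> 1"
  shows "Y = perp C X n"
proof -
  note D = right_cotorsion_pairD[OF ct]
  have X: "additive_subcat C X" "X \<subseteq> Obj C" and Y: "Y \<subseteq> Obj C" and sc: "summand_closed C Y"
    using D(1-3) additive_subcatD(1) by blast+
  have ex: "\<exists>f g. ses C f g \<and> Dom C f = a \<and> Cod C f \<in> Y \<and> Cod C g \<in> cores X (n - 1)" if "a \<in> Obj C" for a
    using D(5)[OF that] coresolved_eq_cores[OF X(1)] by simp
  have "Ext_vanishes C (Suc k) X Y" if "k < n" for k
    using D(4) that by auto
  then have van: "ext_zero k x y" if "k < n" "x \<in> X" "y \<in> Y" for k x y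
    using Ext_vanishes_iff[OF X(2) Y] that by blast
  show ?thesis
  proof (intro equalityI subsetI)
    fix y assume "y \<in> Y"
    then show "y \<in> perp C X n" using van Y perp_iff[OF X(2)] by auto
  next
    fix y assume y: "y \<in> perp C X n"
    then have yo: "y \<in> Obj C" and E: "\<And>x k. x \<in> X \<Longrightarrow> k < n \<Longrightarrow> ext_zero k x y"
      using perp_iff[OF X(2)] by auto
    obtain f g where s: "ses C f g" and fg: "Dom C f = y" "Cod C f \<in> Y" "Cod C g \<in> cores X (n - 1)"
      using ex[OF yo] by blast
    \<comment> \<open>For a coresolution of length n - 1, Ext^1 is controlled by Ext^1, ..., Ext^n
      on \<open>X\<close>, exactly the degrees that \<open>perp\<close> makes vanish. Hence the
      sequence splits and \<open>y\<close> is a summand of an object of \<open>Y\<close>.\<close>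
    have "ext_zero 0 (Cod C g) y"
      by (rule ext_zero_cores[OF yo X(2) fg(3)]) (use E n in auto)
    then show "y \<in> Y"
      using ext1_zero_summand[of "Cod C g" y f g "Cod C f" Y] s fg sc ses_arr[OF s] by auto
  qed
qed

text \<open>As an orthogonal class, \<open>Y\<close> is closed under extensions. This is what places
  the middle term of the gluing over \<open>Y\<close>.\<close>

lemma right_cotorsion_extension:
  assumes ct: "right_cotorsion_pair C n X Y" and n: "n \<ge> 1"
    and s: "ses C f g" "f \<in> Hom C a b" "g \<in> Hom C b c" and ac: "a \<in> Y" "c \<in> Y"
  shows "b \<in> Y"
proof -
  have X: "X \<subseteq> Obj C" using right_cotorsion_pairD(1)[OF ct] additive_subcatD(1) by blast
  have "b \<in> perp C X n"
    using ac ext_zero_extension[OF s] X s(2) unfolding right_cotorsion_perp[OF ct n] perp_iff[OF X]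
    by auto
  then show ?thesis using right_cotorsion_perp[OF ct n] by simp
qed

end

section \<open>The category of the extension\<close>

locale eta_extension = abelian_enough B for B :: "('o, 'm) cat" (structure) +
  fixes F :: "('o, 'm, 'o, 'm) funct" and \<eta> :: "'o \<Rightarrow> 'm"
  assumes datum: "eta_datum B F \<eta>"
begin

abbreviation A where "A \<equiv> eta_ext B F \<eta>"

section \<open>Calculus of the functor and of the natural transformation\<close>

lemma F_functor: "is_functor B B F" and F_right_exact: "right_exact B B F"
  and eta_trans: "nat_trans B B (funct_comp F F) F \<eta>"
  and F_add_hom: "f \<in> Hom B a b \<Longrightarrow> g \<in> Hom B a b \<Longrightarrow> FM F (f \<boxplus> g) = FM F f \<boxplus> FM F g"
  using datum unfolding eta_datum_def additive_functor_def by blast+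

lemma F_obj [simp]: "a \<in> Obj B \<Longrightarrow> FO F a \<in> Obj B"
  and F_id [simp]: "a \<in> Obj B \<Longrightarrow> FM F (Id B a) = Id B (FO F a)"
  using F_functor unfolding is_functor_def by blast+

lemma F_arr [simp]:
  assumes "f \<in> Arr B"
  shows "FM F f \<in> Arr B" "Dom B (FM F f) = FO F (Dom B f)" "Cod B (FM F f) = FO F (Cod B f)"
proof -
  have "FM F f \<in> Hom B (FO F (Dom B f)) (FO F (Cod B f))"
    using F_functor assms unfolding is_functor_def by (metis Hom_iff obj_simps)
  then show "FM F f \<in> Arr B" "Dom B (FM F f) = FO F (Dom B f)" "Cod B (FM F f) = FO F (Cod B f)"
    by auto
qed

lemma F_comp [simp]:
  assumes "f \<in> Arr B" "g \<in> Arr B" "Dom B g = Cod B f"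
  shows "FM F (g \<cdot> f) = FM F g \<cdot> FM F f"
  using F_functor assms unfolding is_functor_def by (metis Hom_iff obj_simps)

lemma F_add [simp]:
  assumes "f \<in> Arr B" "g \<in> Arr B" "Dom B g = Dom B f" "Cod B g = Cod B f"
  shows "FM F (f \<boxplus> g) = FM F f \<boxplus> FM F g"
  by (rule F_add_hom[of _ "Dom B f" "Cod B f"]) (use assms in auto)

lemma F_zero [simp]:
  assumes "a \<in> Obj B" "b \<in> Obj B"
  shows "FM F (Zero B a b) = Zero B (FO F a) (FO F b)"
proof -
  let ?z = "FM F (Zero B a b)"
  have "FM F (Zero B a b \<boxplus> Zero B a b) = ?z \<boxplus> ?z" by (rule F_add) (use assms in auto)
  then have "?z \<boxplus> ?z = ?z \<boxplus> Zero B (FO F a) (FO F b)" using assms by simp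
  then show ?thesis using assms by (subst (asm) add_left_cancel) auto
qed

lemma F_neg [simp]:
  assumes "f \<in> Arr B"
  shows "FM F (neg f) = neg (FM F f)"
proof -
  have "FM F (f \<boxplus> neg f) = FM F f \<boxplus> FM F (neg f)" by (rule F_add) (use assms in auto)
  then show ?thesis using assms by - (rule neg_unique, auto)
qed

lemma eta_arr [simp]:
  assumes "a \<in> Obj B"
  shows "\<eta> a \<in> Arr B" "Dom B (\<eta> a) = FO F (FO F a)" "Cod B (\<eta> a) = FO F a"
proof -
  have "\<eta> a \<in> Hom B (FO F (FO F a)) (FO F a)"
    using eta_trans assms unfolding nat_trans_def funct_comp_def by auto
  then show "\<eta> a \<in> Arr B" "Dom B (\<eta> a) = FO F (FO F a)" "Cod B (\<eta> a) = FO F a" by auto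
qed

lemma eta_nat:
  assumes "f \<in> Hom B a b"
  shows "FM F f \<cdot> \<eta> a = \<eta> b \<cdot> FM F (FM F f)"
  using eta_trans assms unfolding nat_trans_def funct_comp_def by (metis comp_apply funct.simps(2))

lemma eta_assoc: "b \<in> Obj B \<Longrightarrow> \<eta> b \<cdot> FM F (\<eta> b) = \<eta> b \<cdot> \<eta> (FO F b)"
  using datum unfolding eta_datum_def by blast

lemma F_ses:
  assumes "ses B f g"
  shows "exact_at B (FM F f) (FM F g)" "is_epi B (FM F g)"
  using F_right_exact assms unfolding right_exact_def by auto

lemma F_epi: "is_epi B q \<Longrightarrow> is_epi B (FM F q)"
  using epi_ses[of q] F_ses(2) by metis

text \<open>Right exactness is given for short exact sequences only. Factor \<open>f\<close> as a
  mono after an epi \<open>q\<close>; then \<open>FM F q\<close> is epi, so \<open>FM F f\<close>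
  has the same cokernel as the image of the mono part.\<close>

lemma F_cokernel:
  assumes "is_cokernel B c f"
  shows "is_cokernel B (FM F c) (FM F f)"
proof -
  have T: "c \<in> Arr B" "f \<in> Arr B" "Dom B c = Cod B f" and z: "c \<cdot> f = Zero B (Dom B f) (Cod B c)"
    using assms unfolding is_cokernel_def by auto
  obtain q i where q: "is_epi B q" "is_mono B i" "q \<in> Hom B (Dom B f) (Dom B i)"
    "i \<in> Hom B (Dom B i) (Cod B f)" "i \<cdot> q = f"
    by (rule image_fact_obtain[OF T(2)]) blast
  have epi: "is_epi B c" by (rule cokernel_epi[OF assms])
  have ci: "c \<cdot> i = Zero B (Dom B i) (Cod B c)"
    by (rule epi_cancel[OF q(1), of _ "Cod B c"]) (use T z q in auto)
  have "is_cokernel B c i"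
  proof (rule is_cokernelI[OF epi _ q(4) ci])
    fix d t assume t: "t \<in> Hom B (Cod B f) d" "t \<cdot> i = Zero B (Dom B i) d"
    have "t \<cdot> f = (t \<cdot> i) \<cdot> q" unfolding q(5)[symmetric] using t(1) q(3,4) by auto
    then have "t \<cdot> f = Zero B (Dom B f) d" unfolding t(2) using q(3) t(1) by auto
    then show "\<exists>u\<in>Hom B (Cod B c) d. u \<cdot> c = t"
      using cokernel_factor[OF assms t(1)] by metis
  qed (use T in auto)
  then have s: "ses B i c" by (rule cokernel_ses[OF q(2)])
  have Fc: "is_cokernel B (FM F c) (FM F i)" by (rule exact_cokernel[OF F_ses[OF s]])
  have Ff: "FM F f = FM F i \<cdot> FM F q" unfolding q(5)[symmetric] using q(3,4) by simp
  show ?thesis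
  proof (rule is_cokernelI[OF F_epi[OF epi]])
    show "FM F c \<in> Hom B (FO F (Cod B f)) (FO F (Cod B c))"
      "FM F f \<in> Hom B (FO F (Dom B f)) (FO F (Cod B f))" using T by auto
    show "FM F c \<cdot> FM F f = Zero B (FO F (Dom B f)) (FO F (Cod B c))"
      using F_comp[of f c] T z by simp
    fix d t assume t: "t \<in> Hom B (FO F (Cod B f)) d" "t \<cdot> FM F f = Zero B (FO F (Dom B f)) d"
    have "(t \<cdot> FM F i) \<cdot> FM F q = Zero B (FO F (Dom B i)) d \<cdot> FM F q"
      using t q(3,4) unfolding Ff by auto
    then have "t \<cdot> FM F i = Zero B (FO F (Dom B i)) d"
      by (rule epi_cancel[OF F_epi[OF q(1)], of _ d, rotated 2]) (use t q(3,4) in auto)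
    then show "\<exists>u\<in>Hom B (FO F (Cod B c)) d. u \<cdot> FM F c = t"
      using coker_fact[OF Fc _ _ t(1), of "FO F (Cod B c)" "FO F (Dom B i)"] q(4) T by (metis F_arr Hom_iff obj_simps)
  qed
qed

lemma F_biprod:
  assumes "is_biprod B a b (s, i1, i2, p1, p2)"
  shows "is_biprod B (FO F a) (FO F b) (FO F s, FM F i1, FM F i2, FM F p1, FM F p2)"
proof -
  note S = biprodE[OF assms]
  have "FM F (p1 \<cdot> i1) = FM F (Id B a)" "FM F (p2 \<cdot> i2) = FM F (Id B b)"
    "FM F (p1 \<cdot> i2) = FM F (Zero B b a)" "FM F (p2 \<cdot> i1) = FM F (Zero B a b)"
    "FM F ((i1 \<cdot> p1) \<boxplus> (i2 \<cdot> p2)) = FM F (Id B s)"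
    unfolding S(16-20) by simp_all
  then show ?thesis using S(1-15) unfolding is_biprod_def by simp
qed

lemma ObjA_iff:
  "a \<in> Obj A \<longleftrightarrow> fst a \<in> Obj B \<and> snd a \<in> Hom B (FO F (fst a)) (fst a) \<and>
     snd a \<cdot> FM F (snd a) = snd a \<cdot> \<eta> (fst a)"
  by (cases a) (auto simp: eta_ext_def eta_obj_def)

lemma ObjA_D:
  assumes "a \<in> Obj A"
  shows "fst a \<in> Obj B" "snd a \<in> Arr B" "Dom B (snd a) = FO F (fst a)" "Cod B (snd a) = fst a"
    "snd a \<cdot> FM F (snd a) = snd a \<cdot> \<eta> (fst a)"
  using assms unfolding ObjA_iff by auto

lemma eta_ext_simps [simp]:
  "Dom A (a, \<alpha>, b) = a" "Cod A (a, \<alpha>, b) = b" "Id A a = (a, Id B (fst a), a)"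
  "Comp A (b, \<beta>, c) (a, \<alpha>, b') = (a, \<beta> \<cdot> \<alpha>, c)" "Add A (a, \<alpha>, b) (a', \<alpha>', b') = (a, \<alpha> \<boxplus> \<alpha>', b)"
  "Zero A a b = (a, Zero B (fst a) (fst b), b)"
  by (simp_all add: eta_ext_def)

lemma ArrA_iff:
  "(a, \<alpha>, b) \<in> Arr A \<longleftrightarrow> a \<in> Obj A \<and> b \<in> Obj A \<and> \<alpha> \<in> Hom B (fst a) (fst b) \<and>
     \<alpha> \<cdot> snd a = snd b \<cdot> FM F \<alpha>"
  by (cases a; cases b) (auto simp: eta_ext_def)

lemma HomA_iff:
  "(a', \<alpha>, b') \<in> Hom A a b \<longleftrightarrow> a' = a \<and> b' = b \<and> a \<in> Obj A \<and> b \<in> Obj A \<and>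
     \<alpha> \<in> Hom B (fst a) (fst b) \<and> \<alpha> \<cdot> snd a = snd b \<cdot> FM F \<alpha>"
  unfolding Hom_def[of A] using ArrA_iff by auto

lemma HomA_E:
  assumes "g \<in> Hom A a b"
  obtains \<alpha> where "g = (a, \<alpha>, b)" "(a, \<alpha>, b) \<in> Hom A a b" "a \<in> Obj A" "b \<in> Obj A"
    "\<alpha> \<in> Hom B (fst a) (fst b)" "\<alpha> \<cdot> snd a = snd b \<cdot> FM F \<alpha>"
proof -
  obtain a' \<alpha> b' where g: "g = (a', \<alpha>, b')" by (metis prod_cases3)
  show ?thesis using that[of \<alpha>] assms unfolding g HomA_iff by auto
qed

lemma HomA_under:
  assumes "g \<in> Hom A a b"
  obtains \<alpha> where "g = (a, \<alpha>, b)" "\<alpha> \<in> Hom B (fst a) (fst b)"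
  using HomA_E[OF assms] by metis

lemma ArrA_E:
  assumes "g \<in> Arr A"
  obtains a \<alpha> b where "g = (a, \<alpha>, b)" "(a, \<alpha>, b) \<in> Hom A a b" "a \<in> Obj A" "b \<in> Obj A"
    "\<alpha> \<in> Hom B (fst a) (fst b)" "\<alpha> \<cdot> snd a = snd b \<cdot> FM F \<alpha>"
proof -
  have "g \<in> Hom A (Dom A g) (Cod A g)" using assms by (simp add: Hom_def)
  then show ?thesis using HomA_E that by metis
qed

section \<open>The abelian structure of the extension\<close>

lemma category_A: "category A"
proof
  fix f assume "f \<in> Arr A"
  then show "Dom A f \<in> Obj A" "Cod A f \<in> Obj A" by (auto elim!: ArrA_E)
next
  fix a assume "a \<in> Obj A"
  then show "Id A a \<in> Hom A a a" using ObjA_D[of a] by (simp add: HomA_iff)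
next
  fix f g a b c assume "f \<in> Hom A a b" "g \<in> Hom A b c"
  then obtain \<alpha> \<beta> where f: "f = (a, \<alpha>, b)" "(a, \<alpha>, b) \<in> Hom A a b" and g: "g = (b, \<beta>, c)" "(b, \<beta>, c) \<in> Hom A b c"
    by (metis HomA_E)
  note H = f(2)[unfolded HomA_iff] g(2)[unfolded HomA_iff]
  note O = ObjA_D[of a] ObjA_D[of b] ObjA_D[of c]
  have "\<beta> \<cdot> (snd b \<cdot> FM F \<alpha>) = (snd c \<cdot> FM F \<beta>) \<cdot> FM F \<alpha>"
    by (rule assoc_eq) (use H O in simp_all)
  then have "(\<beta> \<cdot> \<alpha>) \<cdot> snd a = snd c \<cdot> FM F (\<beta> \<cdot> \<alpha>)" using H O by simp
  then show "Comp A g f \<in> Hom A a c" using H unfolding f(1) g(1) eta_ext_simps HomA_iff by auto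
next
  fix f g h a b c d assume "f \<in> Hom A a b" "g \<in> Hom A b c" "h \<in> Hom A c d"
  then show "Comp A (Comp A h g) f = Comp A h (Comp A g f)" by (elim HomA_under) simp
next
  fix f a b assume "f \<in> Hom A a b"
  then show "Comp A f (Id A a) = f" "Comp A (Id A b) f = f" by (elim HomA_under, simp)+
qed

lemma preadditive_A: "preadditive_category A"
proof -
  interpret A: category A by (rule category_A)
  note A.Hom_iff [simp del]
  show ?thesis
  proof (intro preadditive_category.intro preadditive_category_axioms.intro category_A)
    fix a b assume ab: "a \<in> Obj A" "b \<in> Obj A"
    note O = ObjA_D[OF ab(1)] ObjA_D[OF ab(2)]
    have cs: "carrier (hom_group A a b) = Hom A a b" "mult (hom_group A a b) = Add A"
      "one (hom_group A a b) = Zero A a b" by (simp_all add: hom_group_def)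
    show "comm_group (hom_group A a b)"
    proof (rule comm_groupI, unfold cs)
      show "Zero A a b \<in> Hom A a b" using O ab by (simp add: HomA_iff)
    next
      fix x y assume "x \<in> Hom A a b" "y \<in> Hom A a b"
      then obtain \<alpha> \<beta> where x: "x = (a, \<alpha>, b)" "\<alpha> \<in> Hom B (fst a) (fst b)" "\<alpha> \<cdot> snd a = snd b \<cdot> FM F \<alpha>"
        and y: "y = (a, \<beta>, b)" "\<beta> \<in> Hom B (fst a) (fst b)" "\<beta> \<cdot> snd a = snd b \<cdot> FM F \<beta>"
        by (metis HomA_E)
      show "Add A x y \<in> Hom A a b" using x y ab O by (simp add: HomA_iff)
      show "Add A x y = Add A y x" using x y add_comm[of \<alpha> \<beta>] by simp
    next
      fix x y z assume "x \<in> Hom A a b" "y \<in> Hom A a b" "z \<in> Hom A a b"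
      then show "Add A (Add A x y) z = Add A x (Add A y z)" by (elim HomA_under) (simp add: add_assoc)
    next
      fix x assume "x \<in> Hom A a b"
      then obtain \<alpha> where x: "x = (a, \<alpha>, b)" "\<alpha> \<in> Hom B (fst a) (fst b)" "\<alpha> \<cdot> snd a = snd b \<cdot> FM F \<alpha>"
        by (rule HomA_E)
      show "Add A (Zero A a b) x = x" using x by simp
      show "\<exists>y\<in>Hom A a b. Add A y x = Zero A a b"
        using x ab O by (intro bexI[of _ "(a, neg \<alpha>, b)"]) (auto simp: HomA_iff)
    qed
  next
    fix f f' g a b c assume "f \<in> Hom A a b" "f' \<in> Hom A a b" "g \<in> Hom A b c"
    then show "Comp A g (Add A f f') = Add A (Comp A g f) (Comp A g f')" by (elim HomA_under) simp
  next
    fix f g g' a b c assume "f \<in> Hom A a b" "g \<in> Hom A b c" "g' \<in> Hom A b c"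
    then show "Comp A (Add A g g') f = Add A (Comp A g f) (Comp A g' f)" by (elim HomA_under) simp
  qed
qed

lemma mono_reflect:
  assumes "is_mono B \<alpha>" "(a, \<alpha>, b) \<in> Hom A a b"
  shows "is_mono A (a, \<alpha>, b)"
  unfolding is_mono_def
proof (intro conjI allI ballI impI)
  show "(a, \<alpha>, b) \<in> Arr A" using assms(2) by (simp add: Hom_def)
  fix c s t assume "s \<in> Hom A c (Dom A (a, \<alpha>, b))" "t \<in> Hom A c (Dom A (a, \<alpha>, b))"
    and st: "Comp A (a, \<alpha>, b) s = Comp A (a, \<alpha>, b) t"
  then obtain \<sigma> \<tau> where s: "s = (c, \<sigma>, a)" "\<sigma> \<in> Hom B (fst c) (fst a)"
    and t: "t = (c, \<tau>, a)" "\<tau> \<in> Hom B (fst c) (fst a)"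
    unfolding eta_ext_simps by (metis HomA_E)
  have "\<sigma> = \<tau>"
    by (rule mono_cancel[OF assms(1), of _ "fst c"]) (use assms(2) s t st in \<open>auto simp: HomA_iff\<close>)
  then show "s = t" using s t by simp
qed

lemma epi_reflect:
  assumes "is_epi B \<alpha>" "(a, \<alpha>, b) \<in> Hom A a b"
  shows "is_epi A (a, \<alpha>, b)"
  unfolding is_epi_def
proof (intro conjI allI ballI impI)
  show "(a, \<alpha>, b) \<in> Arr A" using assms(2) by (simp add: Hom_def)
  fix c s t assume "s \<in> Hom A (Cod A (a, \<alpha>, b)) c" "t \<in> Hom A (Cod A (a, \<alpha>, b)) c"
    and st: "Comp A s (a, \<alpha>, b) = Comp A t (a, \<alpha>, b)"
  then obtain \<sigma> \<tau> where s: "s = (b, \<sigma>, c)" "\<sigma> \<in> Hom B (fst b) (fst c)"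
    and t: "t = (b, \<tau>, c)" "\<tau> \<in> Hom B (fst b) (fst c)"
    unfolding eta_ext_simps by (metis HomA_E)
  have "\<sigma> = \<tau>"
    by (rule epi_cancel[OF assms(1), of _ "fst c"]) (use assms(2) s t st in \<open>auto simp: HomA_iff\<close>)
  then show "s = t" using s t by simp
qed

text \<open>The factorization found in \<open>B\<close> is automatically a morphism of pairs,
  because compatibility with the structure maps may be checked after composing with the mono
  \<open>k\<close>.\<close>

lemma kernel_reflect:
  assumes k: "is_kernel B k \<alpha>" and kA: "(d, k, a) \<in> Hom A d a" and g: "(a, \<alpha>, b) \<in> Hom A a b"
  shows "is_kernel A (d, k, a) (a, \<alpha>, b)"
proof -
  interpret A: preadditive_category A by (rule preadditive_A)
  note A.Hom_iff [simp del]
  note H = kA[unfolded HomA_iff] g[unfolded HomA_iff]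
  have z: "\<alpha> \<cdot> k = Zero B (fst d) (fst b)" using k H unfolding is_kernel_def by auto
  show ?thesis
  proof (rule A.is_kernelI[OF mono_reflect[OF kernel_mono[OF k] kA] kA g])
    show "Comp A (a, \<alpha>, b) (d, k, a) = Zero A d b" using z by simp
    fix c t assume "t \<in> Hom A c a" and tz: "Comp A (a, \<alpha>, b) t = Zero A c b"
    then obtain \<tau> where t: "t = (c, \<tau>, a)" "c \<in> Obj A" "\<tau> \<in> Hom B (fst c) (fst a)"
      "\<tau> \<cdot> snd c = snd a \<cdot> FM F \<tau>" by (metis HomA_E)
    obtain u where u: "u \<in> Hom B (fst c) (fst d)" "k \<cdot> u = \<tau>"
      by (rule ker_fact[OF k, of "fst d" "fst a" "fst b" \<tau> "fst c"]) (use H t tz in auto)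
    note O = ObjA_D[OF t(2)] ObjA_D[of d] ObjA_D[of a]
    have Fu: "FM F k \<cdot> FM F u = FM F \<tau>" using F_comp[of u k] u H by simp
    have "u \<cdot> snd c = snd d \<cdot> FM F u"
    proof (rule mono_cancel[OF kernel_mono[OF k], of _ "FO F (fst c)"])
      have "k \<cdot> (u \<cdot> snd c) = \<tau> \<cdot> snd c" using assoc_eq[OF u(2), of "snd c"] u(1) H O by auto
      also have "\<dots> = snd a \<cdot> (FM F k \<cdot> FM F u)" unfolding t(4) Fu ..
      also have "\<dots> = (snd a \<cdot> FM F k) \<cdot> FM F u" using u(1) H O by simp
      also have "\<dots> = k \<cdot> (snd d \<cdot> FM F u)"
        by (rule assoc_eq[symmetric]) (use u(1) H O in simp_all)
      finally show "k \<cdot> (u \<cdot> snd c) = k \<cdot> (snd d \<cdot> FM F u)" .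
    qed (use u(1) H O in auto)
    then have "(c, u, d) \<in> Hom A c d" using H t u by (simp add: HomA_iff)
    then show "\<exists>u\<in>Hom A c d. Comp A (d, k, a) u = t" using u t by (intro bexI[of _ "(c, u, d)"]) auto
  qed
qed

text \<open>Dual to the case of kernels, except that compatibility is checked before
  \<open>FM F k\<close>, which is epi by right exactness of \<open>F\<close>.\<close>

lemma cokernel_reflect:
  assumes k: "is_cokernel B k \<alpha>" and kA: "(b, k, d) \<in> Hom A b d" and g: "(a, \<alpha>, b) \<in> Hom A a b"
  shows "is_cokernel A (b, k, d) (a, \<alpha>, b)"
proof -
  interpret A: preadditive_category A by (rule preadditive_A)
  note A.Hom_iff [simp del]
  note H = kA[unfolded HomA_iff] g[unfolded HomA_iff]
  have z: "k \<cdot> \<alpha> = Zero B (fst a) (fst d)" using k H unfolding is_cokernel_def by auto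
  show ?thesis
  proof (rule A.is_cokernelI[OF epi_reflect[OF cokernel_epi[OF k] kA] kA g])
    show "Comp A (b, k, d) (a, \<alpha>, b) = Zero A a d" using z by simp
    fix c t assume "t \<in> Hom A b c" and tz: "Comp A t (a, \<alpha>, b) = Zero A a c"
    then obtain \<tau> where t: "t = (b, \<tau>, c)" "c \<in> Obj A" "\<tau> \<in> Hom B (fst b) (fst c)"
      "\<tau> \<cdot> snd b = snd c \<cdot> FM F \<tau>" by (metis HomA_E)
    obtain u where u: "u \<in> Hom B (fst d) (fst c)" "u \<cdot> k = \<tau>"
      by (rule coker_fact[OF k, of "fst b" "fst d" "fst a" \<tau> "fst c"]) (use H t tz in auto)
    note O = ObjA_D[OF t(2)] ObjA_D[of d] ObjA_D[of b]
    have Fu: "FM F u \<cdot> FM F k = FM F \<tau>" using F_comp[of k u] u H by simp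
    have "u \<cdot> snd d = snd c \<cdot> FM F u"
    proof (rule epi_cancel[OF F_epi[OF cokernel_epi[OF k]], of _ "fst c"])
      have "(u \<cdot> snd d) \<cdot> FM F k = u \<cdot> (k \<cdot> snd b)" using u(1) H O by simp
      also have "\<dots> = \<tau> \<cdot> snd b" using assoc_eq[OF u(2), of "snd b"] u(1) H O by auto
      also have "\<dots> = (snd c \<cdot> FM F u) \<cdot> FM F k" unfolding t(4) Fu[symmetric] using u(1) H O by simp
      finally show "(u \<cdot> snd d) \<cdot> FM F k = (snd c \<cdot> FM F u) \<cdot> FM F k" .
    qed (use u(1) H O in auto)
    then have "(d, u, c) \<in> Hom A d c" using H t u by (simp add: HomA_iff)
    then show "\<exists>u\<in>Hom A d c. Comp A u (b, k, d) = t" using u t by (intro bexI[of _ "(d, u, c)"]) auto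
  qed
qed

text \<open>The structure map of \<open>a\<close> restricts to the kernel since
  \<open>\<alpha>\<close> is compatible. The pair axiom for the restriction is checked after the
  mono \<open>k\<close>.\<close>

lemma kernel_lift:
  assumes k: "is_kernel B k \<alpha>" and g: "(a, \<alpha>, b) \<in> Hom A a b"
  obtains d where "(d, k, a) \<in> Hom A d a" "is_kernel A (d, k, a) (a, \<alpha>, b)"
proof -
  note H = g[unfolded HomA_iff]
  have O: "a \<in> Obj A" "b \<in> Obj A" using H by auto
  note O = ObjA_D[OF O(1)] ObjA_D[OF O(2)]
  define w where "w = Dom B k"
  have kT: "k \<in> Hom B w (fst a)" and z: "\<alpha> \<cdot> k = Zero B w (fst b)"
    using k H unfolding is_kernel_def w_def by auto
  have "FM F \<alpha> \<cdot> FM F k = Zero B (FO F w) (FO F (fst b))" using F_comp[of k \<alpha>] z H kT by simp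
  then have "\<alpha> \<cdot> (snd a \<cdot> FM F k) = Zero B (FO F w) (fst b)"
    using assoc_eq[OF H[THEN conjunct2, THEN conjunct2, THEN conjunct2, THEN conjunct2, THEN conjunct2], of "FM F k"]
      H O kT by simp
  then obtain h where h: "h \<in> Hom B (FO F w) w" "k \<cdot> h = snd a \<cdot> FM F k"
    by (rule ker_fact[OF k kT, of "fst b" _ "FO F w", rotated 2]) (use H O kT in auto)
  have Fh: "FM F k \<cdot> FM F h = FM F (snd a) \<cdot> FM F (FM F k)"
    using F_comp[of h k] F_comp[of "FM F k" "snd a"] h kT O by simp
  have "h \<cdot> FM F h = h \<cdot> \<eta> w"
  proof (rule mono_cancel[OF kernel_mono[OF k], of _ "FO F (FO F w)"])
    have "k \<cdot> (h \<cdot> FM F h) = snd a \<cdot> (FM F k \<cdot> FM F h)" using assoc_eq[OF h(2), of "FM F h"] h(1) kT O by simp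
    also have "\<dots> = (snd a \<cdot> FM F (snd a)) \<cdot> FM F (FM F k)" unfolding Fh using h(1) kT O(1-4) by simp
    also have "\<dots> = snd a \<cdot> (\<eta> (fst a) \<cdot> FM F (FM F k))" unfolding O(5) using h(1) kT O(1-4) by simp
    also have "\<dots> = (snd a \<cdot> FM F k) \<cdot> \<eta> w" unfolding eta_nat[OF kT, symmetric] using kT O(1-4) by simp
    also have "\<dots> = k \<cdot> (h \<cdot> \<eta> w)" unfolding h(2)[symmetric] using kT h(1) by simp
    finally show "k \<cdot> (h \<cdot> FM F h) = k \<cdot> (h \<cdot> \<eta> w)" .
  qed (use kT h(1) in auto)
  then have "(w, h) \<in> Obj A" using h(1) by (auto simp: ObjA_iff)
  then have kA: "((w, h), k, a) \<in> Hom A (w, h) a" using kT h H by (auto simp: HomA_iff)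
  then show ?thesis using that kernel_reflect[OF k kA g] by blast
qed

text \<open>To descend the structure map of \<open>b\<close>, one needs \<open>FM F k\<close> to be
  a cokernel of \<open>FM F \<alpha>\<close>. The pair axiom is checked before the twofold image of
  \<open>k\<close>, again epi.\<close>

lemma cokernel_lift:
  assumes k: "is_cokernel B k \<alpha>" and g: "(a, \<alpha>, b) \<in> Hom A a b"
  obtains d where "(b, k, d) \<in> Hom A b d" "is_cokernel A (b, k, d) (a, \<alpha>, b)"
proof -
  note H = g[unfolded HomA_iff]
  have O: "a \<in> Obj A" "b \<in> Obj A" and Hc: "\<alpha> \<cdot> snd a = snd b \<cdot> FM F \<alpha>" using H by auto
  note O = ObjA_D[OF O(1)] ObjA_D[OF O(2)]
  define w where "w = Cod B k"
  have kT: "k \<in> Hom B (fst b) w" and z: "k \<cdot> \<alpha> = Zero B (fst a) w"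
    using k H unfolding is_cokernel_def w_def by auto
  have "(k \<cdot> snd b) \<cdot> FM F \<alpha> = (k \<cdot> \<alpha>) \<cdot> snd a" using H O kT by simp
  then have "(k \<cdot> snd b) \<cdot> FM F \<alpha> = Zero B (FO F (fst a)) w" unfolding z using O kT by simp
  then obtain h where h: "h \<in> Hom B (FO F w) w" "h \<cdot> FM F k = k \<cdot> snd b"
    by (rule coker_fact[OF F_cokernel[OF k], of "FO F (fst b)" "FO F w" "FO F (fst a)" _ w, rotated 3])
      (use H O kT in auto)
  have Fh: "FM F h \<cdot> FM F (FM F k) = FM F k \<cdot> FM F (snd b)"
    using F_comp[of "FM F k" h] F_comp[of "snd b" k] h kT O by simp
  have "h \<cdot> FM F h = h \<cdot> \<eta> w"
  proof (rule epi_cancel[OF F_epi[OF F_epi[OF cokernel_epi[OF k]]], of _ w])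
    have "(h \<cdot> FM F h) \<cdot> FM F (FM F k) = (h \<cdot> FM F k) \<cdot> FM F (snd b)" using Fh h(1) kT O(6-9) by simp
    also have "\<dots> = k \<cdot> (snd b \<cdot> FM F (snd b))" unfolding h(2) using kT O(6-9) by simp
    also have "\<dots> = (k \<cdot> snd b) \<cdot> \<eta> (fst b)" unfolding O(10) using kT O(6-9) by simp
    also have "\<dots> = h \<cdot> (FM F k \<cdot> \<eta> (fst b))" unfolding h(2)[symmetric] using h(1) kT O(6-9) by simp
    also have "\<dots> = (h \<cdot> \<eta> w) \<cdot> FM F (FM F k)" unfolding eta_nat[OF kT] using h(1) kT by simp
    finally show "(h \<cdot> FM F h) \<cdot> FM F (FM F k) = (h \<cdot> \<eta> w) \<cdot> FM F (FM F k)" .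
  qed (use kT h(1) in auto)
  then have "(w, h) \<in> Obj A" using h(1) by (auto simp: ObjA_iff)
  then have kA: "(b, k, (w, h)) \<in> Hom A b (w, h)" using kT h H by (auto simp: HomA_iff)
  then show ?thesis using that cokernel_reflect[OF k kA g] by blast
qed

text \<open>The kernel in \<open>B\<close> of the underlying arrow lifts to an arrow of the
  extension, where a mono forces it to be zero.\<close>

lemma mono_A_iff:
  assumes g: "(a, \<alpha>, b) \<in> Hom A a b"
  shows "is_mono A (a, \<alpha>, b) \<longleftrightarrow> is_mono B \<alpha>"
proof
  interpret A: preadditive_category A by (rule preadditive_A)
  note A.Hom_iff [simp del]
  assume m: "is_mono A (a, \<alpha>, b)"
  note H = g[unfolded HomA_iff]
  obtain k where k: "is_kernel B k \<alpha>" using ex_kernel H by auto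
  obtain d where d: "(d, k, a) \<in> Hom A d a" by (rule kernel_lift[OF k g])
  note D = d[unfolded HomA_iff]
  have z: "\<alpha> \<cdot> k = Zero B (fst d) (fst b)" using k D H unfolding is_kernel_def by auto
  have "(d, k, a) = Zero A d a"
  proof (rule A.mono_cancel[OF m, of _ d])
    show "Zero A d a \<in> Hom A d (Dom A (a, \<alpha>, b))"
      using D A.zero_arr[of d a] unfolding A.Hom_iff by simp
  qed (use d z H D in auto)
  then have kz: "k = Zero B (fst d) (fst a)" by simp
  show "is_mono B \<alpha>"
    unfolding mono_iff_zero
  proof (intro conjI ballI impI)
    fix s assume s: "s \<in> Arr B" "Cod B s = Dom B \<alpha>" "\<alpha> \<cdot> s = Zero B (Dom B s) (Cod B \<alpha>)"
    obtain u where u: "u \<in> Hom B (Dom B s) (Dom B k)" "k \<cdot> u = s"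
      by (rule kernel_factor[OF k, of s "Dom B s"]) (use s H in auto)
    have "Zero B (fst d) (fst a) \<cdot> u = s" using u(2) kz by simp
    then show "s = Zero B (Dom B s) (Dom B \<alpha>)" using u(1) D H by auto
  qed (use H in auto)
qed (use mono_reflect[OF _ g] in auto)

lemma epi_A_iff:
  assumes g: "(a, \<alpha>, b) \<in> Hom A a b"
  shows "is_epi A (a, \<alpha>, b) \<longleftrightarrow> is_epi B \<alpha>"
proof
  interpret A: preadditive_category A by (rule preadditive_A)
  note A.Hom_iff [simp del]
  assume m: "is_epi A (a, \<alpha>, b)"
  note H = g[unfolded HomA_iff]
  obtain k where k: "is_cokernel B k \<alpha>" using ex_cokernel H by auto
  obtain d where d: "(b, k, d) \<in> Hom A b d" by (rule cokernel_lift[OF k g])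
  note D = d[unfolded HomA_iff]
  have z: "k \<cdot> \<alpha> = Zero B (fst a) (fst d)" using k D H unfolding is_cokernel_def by auto
  have "(b, k, d) = Zero A b d"
  proof (rule A.epi_cancel[OF m, of _ d])
    show "Zero A b d \<in> Hom A (Cod A (a, \<alpha>, b)) d"
      using D A.zero_arr[of b d] unfolding A.Hom_iff by simp
  qed (use d z H D in auto)
  then have kz: "k = Zero B (fst b) (fst d)" by simp
  show "is_epi B \<alpha>"
    unfolding epi_iff_zero
  proof (intro conjI ballI impI)
    fix s assume s: "s \<in> Arr B" "Dom B s = Cod B \<alpha>" "s \<cdot> \<alpha> = Zero B (Dom B \<alpha>) (Cod B s)"
    obtain u where u: "u \<in> Hom B (Cod B k) (Cod B s)" "u \<cdot> k = s"
      by (rule cokernel_factor[OF k, of s "Cod B s"]) (use s H in auto)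
    have "u \<cdot> Zero B (fst b) (fst d) = s" using u(2) kz by simp
    then show "s = Zero B (Cod B \<alpha>) (Cod B s)" using u(1) D H by auto
  qed (use H in auto)
qed (use epi_reflect[OF _ g] in auto)

lemma zero_A_iff: "is_zero A a \<longleftrightarrow> a \<in> Obj A \<and> is_zero B (fst a)"
proof -
  interpret A: preadditive_category A by (rule preadditive_A)
  note A.Hom_iff [simp del]
  show ?thesis unfolding A.is_zero_iff is_zero_iff by (auto simp: ObjA_iff)
qed

lemma biprod_A_D:
  assumes "is_biprod A a b (s, (x1, i1, y1), (x2, i2, y2), (x3, p1, y3), (x4, p2, y4))"
  shows "is_biprod B (fst a) (fst b) (fst s, i1, i2, p1, p2)"
    "x1 = a" "y1 = s" "x2 = b" "y2 = s" "x3 = s" "y3 = a" "x4 = s" "y4 = b"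
  using assms unfolding is_biprod_def by (auto simp: HomA_iff ObjA_iff)

lemma biprod_lift:
  assumes S: "is_biprod B (fst a) (fst b) (s, i1, i2, p1, p2)" and ab: "a \<in> Obj A" "b \<in> Obj A"
  obtains t where "is_biprod A a b (t, (a, i1, t), (b, i2, t), (t, p1, a), (t, p2, b))" "fst t = s"
proof -
  note R = biprodE[OF S] and FR = biprodE[OF F_biprod[OF S]]
  note O = ObjA_D[OF ab(1)] ObjA_D[OF ab(2)]
  \<comment> \<open>The diagonal structure map is the only one that makes both injections morphisms
    of pairs. The pair axiom is then checked on the two summands of the twofold image under
    \<open>F\<close>.\<close>
  define h where "h = (i1 \<cdot> (snd a \<cdot> FM F p1)) \<boxplus> (i2 \<cdot> (snd b \<cdot> FM F p2))"
  have hT: "h \<in> Hom B (FO F s) s" using R(1-15) FR(1-15) O unfolding h_def by auto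
  have h1: "h \<cdot> FM F i1 = i1 \<cdot> snd a" and h2: "h \<cdot> FM F i2 = i2 \<cdot> snd b"
    and p1: "p1 \<cdot> h = snd a \<cdot> FM F p1" and p2: "p2 \<cdot> h = snd b \<cdot> FM F p2"
    unfolding h_def using R(1-15) FR O biprod_rules[OF S] by auto
  note FFR = biprodE[OF F_biprod[OF F_biprod[OF S]]]
  have *: "(h \<cdot> FM F h) \<cdot> FM F (FM F i) = (h \<cdot> \<eta> s) \<cdot> FM F (FM F i)"
    if i: "i \<in> Hom B (fst c) s" "h \<cdot> FM F i = i \<cdot> snd c" and c: "c \<in> Obj A" for i c
  proof -
    note O = ObjA_D[OF c]
    have "FM F h \<cdot> FM F (FM F i) = FM F i \<cdot> FM F (snd c)"
      using F_comp[of "FM F i" h] F_comp[of "snd c" i] i hT O by simp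
    then have "(h \<cdot> FM F h) \<cdot> FM F (FM F i) = (h \<cdot> FM F i) \<cdot> FM F (snd c)" using i(1) hT O by simp
    also have "\<dots> = i \<cdot> (snd c \<cdot> FM F (snd c))" unfolding i(2) using i(1) O(1-4) by simp
    also have "\<dots> = (i \<cdot> snd c) \<cdot> \<eta> (fst c)" unfolding O(5) using i(1) O(1-4) by simp
    also have "\<dots> = h \<cdot> (FM F i \<cdot> \<eta> (fst c))" unfolding i(2)[symmetric] using i(1) hT O(1-4) by simp
    also have "\<dots> = (h \<cdot> \<eta> s) \<cdot> FM F (FM F i)" unfolding eta_nat[OF i(1)] using i(1) hT by simp
    finally show ?thesis .
  qed
  have "h \<cdot> FM F h = h \<cdot> \<eta> s"
    by (rule biprod_coeqI[OF F_biprod[OF F_biprod[OF S]], of _ s])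
      (use hT R(3) *[of i1 a] *[of i2 b] h1 h2 R(1-15) ab in auto)
  then have t: "(s, h) \<in> Obj A" using hT by (auto simp: ObjA_iff)
  have "is_biprod A a b ((s, h), (a, i1, (s, h)), (b, i2, (s, h)), ((s, h), p1, a), ((s, h), p2, b))"
    unfolding is_biprod_def using t ab R h1 h2 p1 p2 by (auto simp: HomA_iff)
  then show ?thesis using that by auto
qed

lemma abelian_A: "abelian_category A"
proof -
  interpret A: preadditive_category A by (rule preadditive_A)
  note A.Hom_iff [simp del]
  show ?thesis
  proof
    obtain z where z: "is_zero B z" using ex_zero by blast
    then have "(z, Zero B (FO F z) z) \<in> Obj A" by (auto simp: ObjA_iff is_zero_iff)
    then show "\<exists>z. is_zero A z" using z by (intro exI[of _ "(z, Zero B (FO F z) z)"]) (simp add: zero_A_iff)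
  next
    fix a b assume ab: "a \<in> Obj A" "b \<in> Obj A"
    obtain S where "is_biprod B (fst a) (fst b) S" using ex_biprod ObjA_D(1) ab by blast
    then show "\<exists>S. is_biprod A a b S" using biprod_lift[OF _ ab] by (metis prod_cases5)
  next
    fix f assume "f \<in> Arr A"
    then obtain a \<alpha> b where f: "f = (a, \<alpha>, b)" "(a, \<alpha>, b) \<in> Hom A a b" "\<alpha> \<in> Hom B (fst a) (fst b)"
      by (metis ArrA_E)
    show "\<exists>k. is_kernel A k f" using ex_kernel[of \<alpha>] kernel_lift[OF _ f(2)] f(1,3) by (metis Hom_iff)
    show "\<exists>k. is_cokernel A k f" using ex_cokernel[of \<alpha>] cokernel_lift[OF _ f(2)] f(1,3) by (metis Hom_iff)
  next
    fix f assume m: "is_mono A f"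
    then obtain a \<alpha> b where f: "f = (a, \<alpha>, b)" "(a, \<alpha>, b) \<in> Hom A a b" "\<alpha> \<in> Hom B (fst a) (fst b)"
      by (metis ArrA_E A.mono_arr)
    have \<alpha>: "is_mono B \<alpha>" using m mono_A_iff[OF f(2)] f(1) by simp
    obtain c where c: "is_cokernel B c \<alpha>" using ex_cokernel f(3) by auto
    obtain d where d: "(b, c, d) \<in> Hom A b d" by (rule cokernel_lift[OF c f(2)])
    have "is_kernel A (a, \<alpha>, b) (b, c, d)"
      by (rule kernel_reflect[OF mono_kernel_of_cokernel[OF \<alpha> c] f(2) d])
    then show "\<exists>g. is_kernel A f g" using f(1) by blast
  next
    fix f assume m: "is_epi A f"
    then obtain a \<alpha> b where f: "f = (a, \<alpha>, b)" "(a, \<alpha>, b) \<in> Hom A a b" "\<alpha> \<in> Hom B (fst a) (fst b)"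
      by (metis ArrA_E A.epi_arr)
    have \<alpha>: "is_epi B \<alpha>" using m epi_A_iff[OF f(2)] f(1) by simp
    obtain c where c: "is_kernel B c \<alpha>" using ex_kernel f(3) by auto
    obtain d where d: "(d, c, a) \<in> Hom A d a" by (rule kernel_lift[OF c f(2)])
    have "is_cokernel A (a, \<alpha>, b) (d, c, a)"
      by (rule cokernel_reflect[OF epi_cokernel_of_kernel[OF \<alpha> c] f(2) d])
    then show "\<exists>g. is_cokernel A f g" using f(1) by blast
  qed
qed

lemma ses_A_iff:
  assumes f: "(a, \<alpha>, b) \<in> Hom A a b" and g: "(b, \<beta>, c) \<in> Hom A b c"
  shows "ses A (a, \<alpha>, b) (b, \<beta>, c) \<longleftrightarrow> ses B \<alpha> \<beta>"
proof
  interpret A: abelian_category A by (rule abelian_A)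
  note A.Hom_iff [simp del]
  note H = f[unfolded HomA_iff] g[unfolded HomA_iff]
  {
    assume s: "ses B \<alpha> \<beta>"
    show "ses A (a, \<alpha>, b) (b, \<beta>, c)"
      by (rule A.kernel_ses[OF kernel_reflect[OF ses_kernel[OF s] f g]])
        (use epi_A_iff[OF g] ses_arr[OF s] in simp)
  }
  assume s: "ses A (a, \<alpha>, b) (b, \<beta>, c)"
  have m: "is_mono B \<alpha>" and e: "is_epi B \<beta>"
    using s mono_A_iff[OF f] epi_A_iff[OF g] unfolding ses_def by auto
  have z: "\<beta> \<cdot> \<alpha> = Zero B (fst a) (fst c)" using A.ses_zero(1)[OF s f g] by simp
  obtain k where k: "is_kernel B k \<beta>" using ex_kernel H by auto
  obtain d where d: "(d, k, b) \<in> Hom A d b" "is_kernel A (d, k, b) (b, \<beta>, c)"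
    by (rule kernel_lift[OF k g])
  have "Comp A (b, \<beta>, c) (d, k, b) = Zero A d c" using d(2) unfolding is_kernel_def by simp
  then obtain u where u: "u \<in> Hom A d a" "Comp A (a, \<alpha>, b) u = (d, k, b)"
    by (rule A.ses_ker_fact[OF s f g d(1)])
  obtain v where v': "u = (d, v, a)" "v \<in> Hom B (fst d) (fst a)" by (rule HomA_E[OF u(1)]) blast
  have v: "v \<in> Hom B (fst d) (fst a)" "\<alpha> \<cdot> v = k" using v' u(2) by simp_all
  have "is_kernel B \<alpha> \<beta>"
  proof (rule is_kernelI[OF m _ _ z])
    fix r t assume t: "t \<in> Hom B r (fst b)" "\<beta> \<cdot> t = Zero B r (fst c)"
    obtain w where w: "w \<in> Hom B r (fst d)" "k \<cdot> w = t"
      by (rule ker_fact[OF k, of "fst d" "fst b" "fst c" t r]) (use d[unfolded HomA_iff] H t in auto)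
    show "\<exists>u\<in>Hom B r (fst a). \<alpha> \<cdot> u = t"
      using v w H assoc_eq[OF v(2), of w] by (intro bexI[of _ "v \<cdot> w"]) auto
  qed (use H in auto)
  then show "ses B \<alpha> \<beta>" using kernel_ses e by blast
qed

end

section \<open>The left adjoint of the forgetful functor\<close>

context eta_extension
begin

abbreviation T where "T \<equiv> T_obj B F \<eta>"

definition Ti1 where "Ti1 x = fst (snd (biprod B x (FO F x)))"
definition Ti2 where "Ti2 x = fst (snd (snd (biprod B x (FO F x))))"
definition Tp1 where "Tp1 x = fst (snd (snd (snd (biprod B x (FO F x)))))"
definition Tp2 where "Tp2 x = snd (snd (snd (snd (biprod B x (FO F x)))))"

lemma biprod_spec:
  assumes "a \<in> Obj B" "b \<in> Obj B"
  shows "is_biprod B a b (biprod B a b)"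
  unfolding biprod_def by (rule someI_ex[OF ex_biprod[OF assms]])

lemma T_unfold:
  "T x = (fst (T x), (Ti2 x \<cdot> FM F (Tp1 x)) \<boxplus> (Ti2 x \<cdot> \<eta> x \<cdot> FM F (Tp2 x)))"
  unfolding T_obj_def Ti1_def Ti2_def Tp1_def Tp2_def by (simp split: prod.split)

lemma T_biprod:
  assumes "x \<in> Obj B"
  shows "is_biprod B x (FO F x) (fst (T x), Ti1 x, Ti2 x, Tp1 x, Tp2 x)"
  using biprod_spec[OF assms F_obj[OF assms]]
  unfolding T_obj_def Ti1_def Ti2_def Tp1_def Tp2_def by (auto split: prod.split)

lemma lift_obj:
  assumes S: "is_biprod B y (FO F x) (s, i1, i2, p1, p2)" and p: "p \<in> Hom B y x"
    and t: "t = (i2 \<cdot> FM F p \<cdot> FM F p1) \<boxplus> (i2 \<cdot> \<eta> x \<cdot> FM F p2)"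
  shows "(s, t) \<in> Obj A" "t \<in> Hom B (FO F s) s" "t \<cdot> FM F i1 = i2 \<cdot> FM F p" "t \<cdot> FM F i2 = i2 \<cdot> \<eta> x"
proof -
  note R = biprodE[OF S] and FS = F_biprod[OF S]
  note FR = biprodE[OF FS]
  have x: "x \<in> Obj B" using p by simp
  show tT: "t \<in> Hom B (FO F s) s" unfolding t using R(1-15) p x by auto
  show t1: "t \<cdot> FM F i1 = i2 \<cdot> FM F p" and t2: "t \<cdot> FM F i2 = i2 \<cdot> \<eta> x"
    unfolding t using R(1-15) FR(16-20) p x by simp_all
  have Ft: "FM F t \<cdot> FM F (FM F i1) = FM F i2 \<cdot> FM F (FM F p)"
    "FM F t \<cdot> FM F (FM F i2) = FM F i2 \<cdot> FM F (\<eta> x)"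
    using arg_cong[OF t1, of "FM F"] arg_cong[OF t2, of "FM F"] tT R(1-15) p x by simp_all
  have "t \<cdot> FM F t = t \<cdot> \<eta> s"
  proof (rule biprod_coeqI[OF F_biprod[OF FS], of _ s])
    have "(t \<cdot> FM F t) \<cdot> FM F (FM F i1) = (t \<cdot> FM F i2) \<cdot> FM F (FM F p)"
      using Ft tT R(1-15) p x by simp
    also have "\<dots> = i2 \<cdot> (\<eta> x \<cdot> FM F (FM F p))" unfolding t2 using R(1-15) p x by simp
    also have "\<dots> = (i2 \<cdot> FM F p) \<cdot> \<eta> y" unfolding eta_nat[OF p, symmetric] using R(1-15) p x by simp
    also have "\<dots> = t \<cdot> (FM F i1 \<cdot> \<eta> y)" unfolding t1[symmetric] using tT R(1-15) by simp
    also have "\<dots> = (t \<cdot> \<eta> s) \<cdot> FM F (FM F i1)"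
      using eta_nat[of i1 y s] tT R(1-15) by simp
    finally show "(t \<cdot> FM F t) \<cdot> FM F (FM F i1) = (t \<cdot> \<eta> s) \<cdot> FM F (FM F i1)" .
    have "(t \<cdot> FM F t) \<cdot> FM F (FM F i2) = (t \<cdot> FM F i2) \<cdot> FM F (\<eta> x)"
      using Ft tT R(1-15) p x by simp
    also have "\<dots> = i2 \<cdot> (\<eta> x \<cdot> FM F (\<eta> x))" unfolding t2 using R(1-15) p x by simp
    also have "\<dots> = (i2 \<cdot> \<eta> x) \<cdot> \<eta> (FO F x)" unfolding eta_assoc[OF x] using R(1-15) p x by simp
    also have "\<dots> = t \<cdot> (FM F i2 \<cdot> \<eta> (FO F x))" unfolding t2[symmetric] using tT R(1-15) x by simp
    also have "\<dots> = (t \<cdot> \<eta> s) \<cdot> FM F (FM F i2)"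
      using eta_nat[of i2 "FO F x" s] tT R(1-15) by simp
    finally show "(t \<cdot> FM F t) \<cdot> FM F (FM F i2) = (t \<cdot> \<eta> s) \<cdot> FM F (FM F i2)" .
  qed (use tT R(1-15) in auto)
  then show "(s, t) \<in> Obj A" using tT by (auto simp: ObjA_iff)
qed

lemma T_obj_props:
  assumes x: "x \<in> Obj B"
  shows "T x \<in> Obj A" "snd (T x) \<in> Hom B (FO F (fst (T x))) (fst (T x))"
    "snd (T x) \<cdot> FM F (Ti1 x) = Ti2 x" "snd (T x) \<cdot> FM F (Ti2 x) = Ti2 x \<cdot> \<eta> x"
proof -
  note R = biprodE[OF T_biprod[OF x]]
  have s: "snd (T x) = (Ti2 x \<cdot> FM F (Id B x) \<cdot> FM F (Tp1 x)) \<boxplus> (Ti2 x \<cdot> \<eta> x \<cdot> FM F (Tp2 x))"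
    using arg_cong[OF T_unfold[of x], of snd] R(1-15) x by simp
  note L = lift_obj[OF T_biprod[OF x] id_hom[OF x] s]
  show "T x \<in> Obj A" "snd (T x) \<in> Hom B (FO F (fst (T x))) (fst (T x))"
    "snd (T x) \<cdot> FM F (Ti1 x) = Ti2 x" "snd (T x) \<cdot> FM F (Ti2 x) = Ti2 x \<cdot> \<eta> x"
    using L R(1-15) x by auto
qed

lemma T_arrow_second:
  assumes x: "x \<in> Obj B" and \<alpha>: "(T x, \<alpha>, a) \<in> Hom A (T x) a"
  shows "\<alpha> \<cdot> Ti2 x = snd a \<cdot> FM F (\<alpha> \<cdot> Ti1 x)"
proof -
  note R = biprodE[OF T_biprod[OF x]] and P = T_obj_props[OF x]
  have H: "\<alpha> \<in> Hom B (fst (T x)) (fst a)" "\<alpha> \<cdot> snd (T x) = snd a \<cdot> FM F \<alpha>" and a: "a \<in> Obj A"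
    using \<alpha> by (auto simp: HomA_iff)
  note O = ObjA_D[OF a]
  have "\<alpha> \<cdot> Ti2 x = (\<alpha> \<cdot> snd (T x)) \<cdot> FM F (Ti1 x)" unfolding P(3)[symmetric] using H(1) P(2) R(1-15) by simp
  also have "\<dots> = snd a \<cdot> FM F (\<alpha> \<cdot> Ti1 x)" unfolding H(2) using H(1) O(1-4) R(1-15) by simp
  finally show ?thesis .
qed

lemma T_ext:
  assumes x: "x \<in> Obj B" and \<alpha>: "(T x, \<alpha>, a) \<in> Hom A (T x) a" and \<beta>: "(T x, \<beta>, a) \<in> Hom A (T x) a"
    and eq: "\<alpha> \<cdot> Ti1 x = \<beta> \<cdot> Ti1 x"
  shows "\<alpha> = \<beta>"
  by (rule biprod_coeqI[OF T_biprod[OF x], of _ "fst a", OF _ _ eq])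
    (use \<alpha> \<beta> T_arrow_second[OF x \<alpha>] T_arrow_second[OF x \<beta>] eq in \<open>auto simp: HomA_iff\<close>)

lemma T_univ:
  assumes x: "x \<in> Obj B" and a: "a \<in> Obj A" and h: "h \<in> Hom B x (fst a)"
  obtains \<alpha> where "(T x, \<alpha>, a) \<in> Hom A (T x) a" "\<alpha> \<cdot> Ti1 x = h"
proof -
  note S = T_biprod[OF x] and P = T_obj_props[OF x] and O = ObjA_D[OF a]
  note R = biprodE[OF S]
  define \<alpha> where "\<alpha> = (h \<cdot> Tp1 x) \<boxplus> (snd a \<cdot> FM F h \<cdot> Tp2 x)"
  have \<alpha>T: "\<alpha> \<in> Hom B (fst (T x)) (fst a)" unfolding \<alpha>_def using R(1-15) O(1-4) h by auto
  have \<alpha>1: "\<alpha> \<cdot> Ti1 x = h" and \<alpha>2: "\<alpha> \<cdot> Ti2 x = snd a \<cdot> FM F h"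
    unfolding \<alpha>_def using R O(1-4) h by auto
  have F\<alpha>: "FM F \<alpha> \<cdot> FM F (Ti1 x) = FM F h" "FM F \<alpha> \<cdot> FM F (Ti2 x) = FM F (snd a) \<cdot> FM F (FM F h)"
    using arg_cong[OF \<alpha>1, of "FM F"] arg_cong[OF \<alpha>2, of "FM F"] \<alpha>T R(1-15) O(1-4) h by simp_all
  have "\<alpha> \<cdot> snd (T x) = snd a \<cdot> FM F \<alpha>"
  proof (rule biprod_coeqI[OF F_biprod[OF S], of _ "fst a"])
    show "(\<alpha> \<cdot> snd (T x)) \<cdot> FM F (Ti1 x) = (snd a \<cdot> FM F \<alpha>) \<cdot> FM F (Ti1 x)"
      using \<alpha>T R(1-15) O(1-4) P h F\<alpha> \<alpha>2 by simp
    have "(\<alpha> \<cdot> snd (T x)) \<cdot> FM F (Ti2 x) = (\<alpha> \<cdot> Ti2 x) \<cdot> \<eta> x" using \<alpha>T R(1-15) P x by simp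
    also have "\<dots> = snd a \<cdot> (FM F h \<cdot> \<eta> x)" unfolding \<alpha>2 using O(1-4) h x by simp
    also have "\<dots> = (snd a \<cdot> \<eta> (fst a)) \<cdot> FM F (FM F h)" unfolding eta_nat[OF h] using O(1-4) h by simp
    also have "\<dots> = snd a \<cdot> (FM F (snd a) \<cdot> FM F (FM F h))" unfolding O(5)[symmetric] using O(1-4) h by simp
    also have "\<dots> = (snd a \<cdot> FM F \<alpha>) \<cdot> FM F (Ti2 x)" unfolding F\<alpha>(2)[symmetric] using \<alpha>T R(1-15) O(1-4) by simp
    finally show "(\<alpha> \<cdot> snd (T x)) \<cdot> FM F (Ti2 x) = (snd a \<cdot> FM F \<alpha>) \<cdot> FM F (Ti2 x)" .
  qed (use \<alpha>T P O(1-4) in auto)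
  then have "(T x, \<alpha>, a) \<in> Hom A (T x) a" using \<alpha>T P(1) a by (auto simp: HomA_iff)
  then show ?thesis using that \<alpha>1 by blast
qed

definition Tu where
  "Tu \<phi> = (Ti1 (Cod B \<phi>) \<cdot> \<phi> \<cdot> Tp1 (Dom B \<phi>)) \<boxplus> (Ti2 (Cod B \<phi>) \<cdot> FM F \<phi> \<cdot> Tp2 (Dom B \<phi>))"

definition Tmor where
  "Tmor \<phi> = (T (Dom B \<phi>), Tu \<phi>, T (Cod B \<phi>))"

lemma Tu_props:
  assumes \<phi>: "\<phi> \<in> Hom B x y"
  shows "Tu \<phi> \<in> Hom B (fst (T x)) (fst (T y))" "Tu \<phi> \<cdot> Ti1 x = Ti1 y \<cdot> \<phi>" "Tu \<phi> \<cdot> Ti2 x = Ti2 y \<cdot> FM F \<phi>"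
    "Tp1 y \<cdot> Tu \<phi> = \<phi> \<cdot> Tp1 x" "Tp2 y \<cdot> Tu \<phi> = FM F \<phi> \<cdot> Tp2 x"
proof -
  have x: "x \<in> Obj B" and y: "y \<in> Obj B" using \<phi> by auto
  note R = biprodE[OF T_biprod[OF x]] and R' = biprodE[OF T_biprod[OF y]] and RR = biprod_rules[OF T_biprod[OF y]]
  show "Tu \<phi> \<in> Hom B (fst (T x)) (fst (T y))" "Tu \<phi> \<cdot> Ti1 x = Ti1 y \<cdot> \<phi>" "Tu \<phi> \<cdot> Ti2 x = Ti2 y \<cdot> FM F \<phi>"
    "Tp1 y \<cdot> Tu \<phi> = \<phi> \<cdot> Tp1 x" "Tp2 y \<cdot> Tu \<phi> = FM F \<phi> \<cdot> Tp2 x"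
    unfolding Tu_def using \<phi> R R'(1-15) RR(1-4) by simp_all
qed

lemma Tmor_hom:
  assumes \<phi>: "\<phi> \<in> Hom B x y"
  shows "Tmor \<phi> = (T x, Tu \<phi>, T y)" "(T x, Tu \<phi>, T y) \<in> Hom A (T x) (T y)"
proof -
  have x: "x \<in> Obj B" and y: "y \<in> Obj B" using \<phi> by auto
  note R = biprodE[OF T_biprod[OF x]] and R' = biprodE[OF T_biprod[OF y]]
  note P = T_obj_props[OF x] and P' = T_obj_props[OF y] and U = Tu_props[OF \<phi>]
  show "Tmor \<phi> = (T x, Tu \<phi>, T y)" using \<phi> by (simp add: Tmor_def)
  have FU: "FM F (Tu \<phi>) \<cdot> FM F (Ti1 x) = FM F (Ti1 y) \<cdot> FM F \<phi>"
    "FM F (Tu \<phi>) \<cdot> FM F (Ti2 x) = FM F (Ti2 y) \<cdot> FM F (FM F \<phi>)"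
    using arg_cong[OF U(2), of "FM F"] arg_cong[OF U(3), of "FM F"] U(1) R(1-15) R'(1-15) \<phi> by simp_all
  have "Tu \<phi> \<cdot> snd (T x) = snd (T y) \<cdot> FM F (Tu \<phi>)"
  proof (rule biprod_coeqI[OF F_biprod[OF T_biprod[OF x]], of _ "fst (T y)"])
    have "(Tu \<phi> \<cdot> snd (T x)) \<cdot> FM F (Ti1 x) = (snd (T y) \<cdot> FM F (Ti1 y)) \<cdot> FM F \<phi>"
      unfolding P'(3) using U P(2,3) R(1-15) by simp
    then show "(Tu \<phi> \<cdot> snd (T x)) \<cdot> FM F (Ti1 x) = (snd (T y) \<cdot> FM F (Tu \<phi>)) \<cdot> FM F (Ti1 x)"
      using FU(1) P'(2) U(1) R(1-15) R'(1-15) \<phi> by simp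
    have "(Tu \<phi> \<cdot> snd (T x)) \<cdot> FM F (Ti2 x) = (Tu \<phi> \<cdot> Ti2 x) \<cdot> \<eta> x"
      using U(1) P(2,4) R(1-15) x by simp
    also have "\<dots> = Ti2 y \<cdot> (FM F \<phi> \<cdot> \<eta> x)" unfolding U(3) using R'(1-15) \<phi> x by simp
    also have "\<dots> = (snd (T y) \<cdot> FM F (Ti2 y)) \<cdot> FM F (FM F \<phi>)"
      unfolding eta_nat[OF \<phi>] P'(4) using R'(1-15) \<phi> y by simp
    also have "\<dots> = (snd (T y) \<cdot> FM F (Tu \<phi>)) \<cdot> FM F (Ti2 x)"
      using FU(2) P'(2) U(1) R(1-15) R'(1-15) \<phi> by simp
    finally show "(Tu \<phi> \<cdot> snd (T x)) \<cdot> FM F (Ti2 x) = (snd (T y) \<cdot> FM F (Tu \<phi>)) \<cdot> FM F (Ti2 x)" .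
  qed (use U(1) P(2) P'(2) in auto)
  then show "(T x, Tu \<phi>, T y) \<in> Hom A (T x) (T y)" using P(1) P'(1) U(1) by (auto simp: HomA_iff)
qed

lemma Tu_functor:
  assumes \<phi>: "\<phi> \<in> Hom B x y"
  shows "\<psi> \<in> Hom B y z \<Longrightarrow> Tu (\<psi> \<cdot> \<phi>) = Tu \<psi> \<cdot> Tu \<phi>"
    and "\<phi>' \<in> Hom B x y \<Longrightarrow> Tu (\<phi> \<boxplus> \<phi>') = Tu \<phi> \<boxplus> Tu \<phi>'"
    and "Tu (Id B x) = Id B (fst (T x))"
    and "z \<in> Obj B \<Longrightarrow> Tu (Zero B x z) = Zero B (fst (T x)) (fst (T z))"
proof -
  have x: "x \<in> Obj B" using \<phi> by auto
  note S = T_biprod[OF x] and U = Tu_props[OF \<phi>]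
  note R = biprodE[OF S]
  show "Tu (\<psi> \<cdot> \<phi>) = Tu \<psi> \<cdot> Tu \<phi>" if \<psi>: "\<psi> \<in> Hom B y z"
  proof (rule biprod_coeqI[OF S, of _ "fst (T z)"])
    have y: "y \<in> Obj B" and c: "\<psi> \<cdot> \<phi> \<in> Hom B x z" and z: "z \<in> Obj B" using \<phi> \<psi> by auto
    note V = Tu_props[OF \<psi>] and W = Tu_props[OF c]
    note R' = biprodE[OF T_biprod[OF y]] and R'' = biprodE[OF T_biprod[OF z]]
    show "Tu (\<psi> \<cdot> \<phi>) \<in> Hom B (fst (T x)) (fst (T z))" by (rule W)
    show "Tu \<psi> \<cdot> Tu \<phi> \<in> Hom B (fst (T x)) (fst (T z))" using U(1) V(1) by auto
    show "Tu (\<psi> \<cdot> \<phi>) \<cdot> Ti1 x = (Tu \<psi> \<cdot> Tu \<phi>) \<cdot> Ti1 x"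
      using U(1,2) V(1) W(2) R(1-15) R'(1-15) R''(1-15) \<phi> \<psi> assoc_eq[OF V(2), of \<phi>] by simp
    show "Tu (\<psi> \<cdot> \<phi>) \<cdot> Ti2 x = (Tu \<psi> \<cdot> Tu \<phi>) \<cdot> Ti2 x"
      using U(1,3) V(1) W(3) R(1-15) R'(1-15) R''(1-15) \<phi> \<psi> assoc_eq[OF V(3), of "FM F \<phi>"] by simp
  qed
  show "Tu (\<phi> \<boxplus> \<phi>') = Tu \<phi> \<boxplus> Tu \<phi>'" if \<phi>': "\<phi>' \<in> Hom B x y"
  proof (rule biprod_coeqI[OF S, of _ "fst (T y)"])
    have y: "y \<in> Obj B" and c: "\<phi> \<boxplus> \<phi>' \<in> Hom B x y" using \<phi> \<phi>' by auto
    note V = Tu_props[OF \<phi>'] and W = Tu_props[OF c] and R' = biprodE[OF T_biprod[OF y]]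
    show "Tu (\<phi> \<boxplus> \<phi>') \<in> Hom B (fst (T x)) (fst (T y))" by (rule W)
    show "Tu \<phi> \<boxplus> Tu \<phi>' \<in> Hom B (fst (T x)) (fst (T y))" using U(1) V(1) by auto
    show "Tu (\<phi> \<boxplus> \<phi>') \<cdot> Ti1 x = (Tu \<phi> \<boxplus> Tu \<phi>') \<cdot> Ti1 x"
      "Tu (\<phi> \<boxplus> \<phi>') \<cdot> Ti2 x = (Tu \<phi> \<boxplus> Tu \<phi>') \<cdot> Ti2 x"
      using U(1-3) V(1-3) W(2,3) R(1-15) R'(1-15) \<phi> \<phi>' by simp_all
  qed
  show "Tu (Id B x) = Id B (fst (T x))"
    by (rule biprod_coeqI[OF S, of _ "fst (T x)"]) (use Tu_props[OF id_hom[OF x]] R(1-15) in auto)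
  show "Tu (Zero B x z) = Zero B (fst (T x)) (fst (T z))" if z: "z \<in> Obj B"
  proof -
    have c: "Zero B x z \<in> Hom B x z" using x z by auto
    note R' = biprodE[OF T_biprod[OF z]]
    show ?thesis
      by (rule biprod_coeqI[OF S, of _ "fst (T z)"]) (use Tu_props[OF c] R(1-15) R'(1-15) x z in auto)
  qed
qed

lemma T_preserves_biprod:
  assumes S: "is_biprod B x y (s, i1, i2, p1, p2)"
  shows "is_biprod A (T x) (T y) (T s, Tmor i1, Tmor i2, Tmor p1, Tmor p2)"
proof -
  note R = biprodE[OF S]
  have H: "i1 \<in> Hom B x s" "i2 \<in> Hom B y s" "p1 \<in> Hom B s x" "p2 \<in> Hom B s y" using R(1-15) by auto
  note M = Tmor_hom[OF H(1)] Tmor_hom[OF H(2)] Tmor_hom[OF H(3)] Tmor_hom[OF H(4)]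
  note P = T_obj_props(1)[OF R(1)] T_obj_props(1)[OF R(2)] T_obj_props(1)[OF R(3)]
  have e: "Tu p1 \<cdot> Tu i1 = Id B (fst (T x))" "Tu p2 \<cdot> Tu i2 = Id B (fst (T y))"
    "Tu p1 \<cdot> Tu i2 = Zero B (fst (T y)) (fst (T x))" "Tu p2 \<cdot> Tu i1 = Zero B (fst (T x)) (fst (T y))"
    using Tu_functor(1)[OF H(1) H(3)] Tu_functor(1)[OF H(2) H(4)] Tu_functor(1)[OF H(2) H(3)]
      Tu_functor(1)[OF H(1) H(4)] Tu_functor(3)[OF H(1)] Tu_functor(3)[OF H(2)]
      Tu_functor(4)[OF H(2) R(1)] Tu_functor(4)[OF H(1) R(2)] R(16-19) by simp_all
  have c: "i1 \<cdot> p1 \<in> Hom B s s" "i2 \<cdot> p2 \<in> Hom B s s" using H by auto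
  have "(Tu i1 \<cdot> Tu p1) \<boxplus> (Tu i2 \<cdot> Tu p2) = Id B (fst (T s))"
    using Tu_functor(2)[OF c] Tu_functor(1)[OF H(3) H(1)] Tu_functor(1)[OF H(4) H(2)]
      Tu_functor(3)[OF H(3)] R(20) by simp
  then show ?thesis unfolding is_biprod_def M(1,3,5,7) using M P e by simp
qed

lemma T_ses:
  assumes s: "ses B k e" and k: "k \<in> Hom B w p" and e: "e \<in> Hom B p x" and Fk: "is_mono B (FM F k)"
  shows "ses A (Tmor k) (Tmor e)"
proof -
  have w: "w \<in> Obj B" and p: "p \<in> Obj B" and x: "x \<in> Obj B" using k e by auto
  note Sw = T_biprod[OF w] and Sp = T_biprod[OF p] and Sx = T_biprod[OF x]
  note Rw = biprodE[OF Sw] and Rp = biprodE[OF Sp] and Rx = biprodE[OF Sx]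
  note K = Tu_props[OF k] and E = Tu_props[OF e] and z = ses_zero[OF s k e]
  note Fs = F_ses[OF s]
  have FkT: "FM F k \<in> Hom B (FO F w) (FO F p)" and FeT: "FM F e \<in> Hom B (FO F p) (FO F x)" using k e by auto
  have K1: "Tp1 p \<cdot> (Tu k \<cdot> y) = k \<cdot> (Tp1 w \<cdot> y)" "Tp2 p \<cdot> (Tu k \<cdot> y) = FM F k \<cdot> (Tp2 w \<cdot> y)"
    if "y \<in> Arr B" "Cod B y = fst (T w)" for y
    using assoc_eq[OF K(4), of y] assoc_eq[OF K(5), of y] that K(1) Rw(1-15) Rp(1-15) k FkT by auto
  have E1: "Tp1 x \<cdot> (Tu e \<cdot> y) = e \<cdot> (Tp1 p \<cdot> y)" "Tp2 x \<cdot> (Tu e \<cdot> y) = FM F e \<cdot> (Tp2 p \<cdot> y)"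
    if "y \<in> Arr B" "Cod B y = fst (T p)" for y
    using assoc_eq[OF E(4), of y] assoc_eq[OF E(5), of y] that E(1) Rp(1-15) Rx(1-15) e FeT by auto
  have "ses B (Tu k) (Tu e)"
  proof (rule ses_elemI[OF K(1) E(1)])
    show "Tu e \<cdot> Tu k = Zero B (fst (T w)) (fst (T x))"
      using Tu_functor(1)[OF k e] Tu_functor(4)[OF k x] z(1) by simp
  next
    fix q y assume q: "projective B q" and y: "y \<in> Hom B q (fst (T w))" "Tu k \<cdot> y = Zero B q (fst (T p))"
    have "k \<cdot> (Tp1 w \<cdot> y) = Zero B q p" "FM F k \<cdot> (Tp2 w \<cdot> y) = Zero B q (FO F p)"
      using K1[of y] y Rp(1-15) by auto
    then have "Tp1 w \<cdot> y = Zero B q w" "Tp2 w \<cdot> y = Zero B q (FO F w)"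
      using mono_elemD[OF ses_arr(5)[OF s] k, of "Tp1 w \<cdot> y" q]
        mono_elemD[OF Fk FkT, of "Tp2 w \<cdot> y" q] y(1) Rw(1-15) by auto
    then show "y = Zero B q (fst (T w))"
      using biprod_eqI[OF Sw y(1), of "Zero B q (fst (T w))"] y(1) Rw(1-15) by auto
  next
    fix q y assume q: "projective B q" and y: "y \<in> Hom B q (fst (T p))" "Tu e \<cdot> y = Zero B q (fst (T x))"
    have "e \<cdot> (Tp1 p \<cdot> y) = Zero B q x" "FM F e \<cdot> (Tp2 p \<cdot> y) = Zero B q (FO F x)"
      using E1[of y] y Rx(1-15) by auto
    note ez = this
    obtain a where a: "a \<in> Hom B q w" "k \<cdot> a = Tp1 p \<cdot> y"
      by (rule ses_ker_fact[OF s k e _ ez(1)]) (use y(1) Rp(1-15) in auto)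
    obtain b where b: "b \<in> Hom B q (FO F w)" "FM F k \<cdot> b = Tp2 p \<cdot> y"
      by (rule exact_lift[OF Fs(1) q FkT FeT _ ez(2)]) (use y(1) Rp(1-15) in auto)
    let ?u = "(Ti1 w \<cdot> a) \<boxplus> (Ti2 w \<cdot> b)"
    have u: "?u \<in> Hom B q (fst (T w))" using a(1) b(1) Rw(1-15) by auto
    have pu: "Tp1 w \<cdot> ?u = a" "Tp2 w \<cdot> ?u = b" using a(1) b(1) Rw(1-15) biprod_rules(1-4)[OF Sw] by auto
    have "Tu k \<cdot> ?u = y"
    proof (rule biprod_eqI[OF Sp, of _ q])
      show "Tu k \<cdot> ?u \<in> Hom B q (fst (T p))" using u K(1) by (simp del: comp_add_arr add: Rw(1-15))
      show "Tp1 p \<cdot> (Tu k \<cdot> ?u) = Tp1 p \<cdot> y" using K1(1)[of ?u] u pu a(2) by (simp del: comp_add_arr)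
      show "Tp2 p \<cdot> (Tu k \<cdot> ?u) = Tp2 p \<cdot> y" using K1(2)[of ?u] u pu b(2) by (simp del: comp_add_arr)
    qed (use y in auto)
    then show "\<exists>u\<in>Hom B q (fst (T w)). Tu k \<cdot> u = y" using u by blast
  next
    fix q y assume q: "projective B q" and y: "y \<in> Hom B q (fst (T x))"
    have y1: "Tp1 x \<cdot> y \<in> Hom B q x" and y2: "Tp2 x \<cdot> y \<in> Hom B q (Cod B (FM F e))"
      using y Rx(1-15) FeT by auto
    obtain a where a: "a \<in> Hom B q p" "e \<cdot> a = Tp1 x \<cdot> y" by (rule ses_lift[OF s e q y1])
    obtain b where b: "b \<in> Hom B q (FO F p)" "FM F e \<cdot> b = Tp2 x \<cdot> y"
      by (rule projective_lift[OF q Fs(2) y2]) (use FeT in auto)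
    let ?u = "(Ti1 p \<cdot> a) \<boxplus> (Ti2 p \<cdot> b)"
    have u: "?u \<in> Hom B q (fst (T p))" using a(1) b(1) Rp(1-15) by auto
    have pu: "Tp1 p \<cdot> ?u = a" "Tp2 p \<cdot> ?u = b" using a(1) b(1) Rp(1-15) biprod_rules(1-4)[OF Sp] by auto
    have "Tu e \<cdot> ?u = y"
    proof (rule biprod_eqI[OF Sx, of _ q])
      show "Tu e \<cdot> ?u \<in> Hom B q (fst (T x))" using u E(1) by (simp del: comp_add_arr add: Rp(1-15))
      show "Tp1 x \<cdot> (Tu e \<cdot> ?u) = Tp1 x \<cdot> y" using E1(1)[of ?u] u pu a(2) by (simp del: comp_add_arr)
      show "Tp2 x \<cdot> (Tu e \<cdot> ?u) = Tp2 x \<cdot> y" using E1(2)[of ?u] u pu b(2) by (simp del: comp_add_arr)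
    qed (use y in auto)
    then show "\<exists>u\<in>Hom B q (fst (T p)). Tu e \<cdot> u = y" using u by blast
  qed
  then show ?thesis
    using ses_A_iff[OF Tmor_hom(2)[OF k] Tmor_hom(2)[OF e]] Tmor_hom(1)[OF k] Tmor_hom(1)[OF e] by simp
qed

lemma derived_zero_exact:
  assumes x: "x \<in> Obj B" and z: "is_zero B (left_derived B B F (Suc i) x)"
  shows "exact_at B (FM F (res_diff B x (Suc i))) (FM F (res_diff B x i))"
proof -
  obtain W K E where s: "\<And>i. ses B (K i) (E i)" and K: "\<And>i. K i \<in> Hom B (W (Suc i)) (res_obj B x i)"
    and E: "\<And>i. E i \<in> Hom B (res_obj B x i) (W i)" and d: "\<And>i. res_diff B x i = K i \<cdot> E (Suc i)"
    by (rule res_syzygies[OF x]) blast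
  have dT: "res_diff B x i \<in> Hom B (res_obj B x (Suc i)) (res_obj B x i)" for i
    using K[of i] E[of "Suc i"] d[of i] by auto
  have "res_diff B x i \<cdot> res_diff B x (Suc i) = Zero B (res_obj B x (Suc (Suc i))) (res_obj B x i)"
    unfolding d using K[of i] E[of "Suc i"] K[of "Suc i"] E[of "Suc (Suc i)"]
      ses_zero(2)[OF s K E, of "E (Suc (Suc i))" "Suc i"] by auto
  then have "FM F (res_diff B x i) \<cdot> FM F (res_diff B x (Suc i)) =
      Zero B (FO F (res_obj B x (Suc (Suc i)))) (FO F (res_obj B x i))"
    using F_comp[of "res_diff B x (Suc i)" "res_diff B x i"] dT[of i] dT[of "Suc i"] by simp
  then show ?thesis
    using homology_zero_exact[of "FM F (res_diff B x (Suc i))" _ _ "FM F (res_diff B x i)"] z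
      dT[of i] dT[of "Suc i"] by auto
qed

text \<open>Right exactness identifies \<open>F\<close> of a syzygy with a cokernel, so the vanishing of
  \<open>L\<^sub>i\<^sub>+\<^sub>1 F\<close> is the injectivity of \<open>F\<close> on the inclusion of the \<open>(i + 1)\<close>-st syzygy.\<close>

lemma syzygies_F_mono:
  assumes x: "x \<in> Obj B"
  obtains W K E where "\<And>i. ses B (K i) (E i)" "\<And>i. K i \<in> Hom B (W (Suc i)) (res_obj B x i)"
    "\<And>i. E i \<in> Hom B (res_obj B x i) (W i)" "W 0 = x" "\<And>i. projective B (res_obj B x i)"
    "\<And>i. is_zero B (left_derived B B F (Suc i) x) \<Longrightarrow> is_mono B (FM F (K i))"
proof -
  obtain W K E where s: "\<And>i. ses B (K i) (E i)" and K: "\<And>i. K i \<in> Hom B (W (Suc i)) (res_obj B x i)"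
    and E: "\<And>i. E i \<in> Hom B (res_obj B x i) (W i)" and W: "W 0 = x"
    and d: "\<And>i. res_diff B x i = K i \<cdot> E (Suc i)" and P: "\<And>i. projective B (res_obj B x i)"
    by (rule res_syzygies[OF x]) blast
  let ?P = "res_obj B x"
  have "is_mono B (FM F (K i))" if "is_zero B (left_derived B B F (Suc i) x)" for i
  proof (rule mono_elemI[of _ "FO F (W (Suc i))" "FO F (?P i)"])
    note ex = derived_zero_exact[OF x that]
    note T = K[of i] E[of "Suc i"] K[of "Suc i"] E[of "Suc (Suc i)"]
    fix p z assume p: "projective B p" and z: "z \<in> Hom B p (FO F (W (Suc i)))" "FM F (K i) \<cdot> z = Zero B p (FO F (?P i))"
    obtain y where y: "y \<in> Hom B p (FO F (?P (Suc i)))" "FM F (E (Suc i)) \<cdot> y = z"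
      by (rule projective_lift[OF p F_ses(2)[OF s[of "Suc i"]], of z]) (use z T in auto)
    have "FM F (res_diff B x i) \<cdot> y = FM F (K i) \<cdot> (FM F (E (Suc i)) \<cdot> y)"
      unfolding d using T y(1) by simp
    then have 1: "FM F (res_diff B x i) \<cdot> y = Zero B p (FO F (?P i))" using y(2) z(2) by simp
    obtain v where v: "v \<in> Hom B p (FO F (?P (Suc (Suc i))))" "FM F (res_diff B x (Suc i)) \<cdot> v = y"
      by (rule exact_elemD[OF ex p, of y]) (use y 1 T in \<open>auto simp: d\<close>)
    have "FM F (E (Suc i) \<cdot> K (Suc i)) = Zero B (FO F (W (Suc (Suc i)))) (FO F (W (Suc i)))"
      using ses_zero(1)[OF s[of "Suc i"] K E] T by simp
    then have FEK: "FM F (E (Suc i)) \<cdot> FM F (K (Suc i)) = Zero B (FO F (W (Suc (Suc i)))) (FO F (W (Suc i)))"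
      using T by simp
    have "z = FM F (E (Suc i)) \<cdot> (FM F (K (Suc i)) \<cdot> (FM F (E (Suc (Suc i))) \<cdot> v))"
      unfolding y(2)[symmetric] v(2)[symmetric] d using T v(1) by simp
    also have "\<dots> = (FM F (E (Suc i)) \<cdot> FM F (K (Suc i))) \<cdot> (FM F (E (Suc (Suc i))) \<cdot> v)"
      using T v(1) by simp
    also have "\<dots> = Zero B p (FO F (W (Suc i)))" unfolding FEK using T v(1) by simp
    finally show "z = Zero B p (FO F (W (Suc i)))" .
  qed (use K[of i] in auto)
  then show ?thesis using that s K E W P by blast
qed

lemma F_mono_of_derived_zero:
  assumes s: "ses B f g" and f: "f \<in> Hom B a b" and g: "g \<in> Hom B b c"
    and z: "is_zero B (left_derived B B F 1 c)"
  shows "is_mono B (FM F f)"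
proof -
  have c: "c \<in> Obj B" using g by auto
  obtain W K E where s': "\<And>i. ses B (K i) (E i)" and K': "\<And>i. K i \<in> Hom B (W (Suc i)) (res_obj B c i)"
    and E': "\<And>i. E i \<in> Hom B (res_obj B c i) (W i)" and W: "W 0 = c" and P: "\<And>i. projective B (res_obj B c i)"
    and m: "\<And>i. is_zero B (left_derived B B F (Suc i) c) \<Longrightarrow> is_mono B (FM F (K i))"
    by (rule syzygies_F_mono[OF c]) blast
  define k e w p where "k = K 0" and "e = E 0" and "w = W (Suc 0)" and "p = res_obj B c 0"
  have ke: "ses B k e" and k: "k \<in> Hom B w p" and e: "e \<in> Hom B p c" and p: "projective B p"
    and Fk: "is_mono B (FM F k)"
    using s'[of 0] K'[of 0] E'[of 0] W P[of 0] m[of 0] z unfolding k_def e_def w_def p_def by simp_all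
  note zs = ses_zero[OF s f g] and zk = ses_zero[OF ke k e]
  obtain \<sigma> where \<sigma>: "\<sigma> \<in> Hom B p b" "g \<cdot> \<sigma> = e" by (rule ses_lift[OF s g p e])
  have g\<sigma>: "g \<cdot> (\<sigma> \<cdot> y) = e \<cdot> y" if "y \<in> Arr B" "Cod B y = p" for y
    using assoc_eq[OF \<sigma>(2), of y] \<sigma>(1) g that by auto
  have "g \<cdot> (\<sigma> \<cdot> k) = Zero B w c" using g\<sigma>[of k] k zk by auto
  then obtain \<tau> where \<tau>: "\<tau> \<in> Hom B w a" "f \<cdot> \<tau> = \<sigma> \<cdot> k"
    by (rule ses_ker_fact[OF s f g, rotated]) (use \<sigma> k in auto)
  have f\<tau>: "f \<cdot> (\<tau> \<cdot> y) = \<sigma> \<cdot> (k \<cdot> y)" if "y \<in> Arr B" "Cod B y = w" for y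
    using assoc_eq[OF \<tau>(2), of y] \<tau>(1) f k \<sigma>(1) that by auto
  have ob: "a \<in> Obj B" "p \<in> Obj B" using f k by auto
  obtain S i1 i2 p1 p2 where S: "is_biprod B a p (S, i1, i2, p1, p2)"
    using ex_biprod[OF ob] by (metis prod_cases5)
  note R = biprodE[OF S] and RR = biprod_rules[OF S]
  let ?\<kappa> = "(i1 \<cdot> \<tau>) \<boxplus> neg (i2 \<cdot> k)" and ?\<phi> = "(f \<cdot> p1) \<boxplus> (\<sigma> \<cdot> p2)"
  have \<kappa>T: "?\<kappa> \<in> Hom B w S" and \<phi>T: "?\<phi> \<in> Hom B S b" using \<tau>(1) \<sigma>(1) f k R(1-15) by auto
  have "ses B ?\<kappa> ?\<phi>"
  proof (rule ses_elemI[OF \<kappa>T \<phi>T])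
    show "?\<phi> \<cdot> ?\<kappa> = Zero B w b" using \<tau> \<sigma>(1) f k R(1-15) RR(1-4) by simp
  next
    fix q y assume q: "projective B q" and y: "y \<in> Hom B q w" "?\<kappa> \<cdot> y = Zero B q S"
    have "p2 \<cdot> (?\<kappa> \<cdot> y) = neg (k \<cdot> y)" using y(1) \<tau>(1) k R(1-15) RR(1-4) by simp
    then have "neg (k \<cdot> y) = Zero B q p" unfolding y(2) using R(1-15) y(1) by simp
    then have "neg (neg (k \<cdot> y)) = Zero B q p" using y(1) ob by simp
    then have "k \<cdot> y = Zero B q p" using y(1) k by simp
    then show "y = Zero B q w" by (rule mono_elemD[OF ses_arr(5)[OF ke] k y(1)])
  next
    fix q y assume q: "projective B q" and y: "y \<in> Hom B q S" "?\<phi> \<cdot> y = Zero B q b"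
    have eq: "(f \<cdot> (p1 \<cdot> y)) \<boxplus> (\<sigma> \<cdot> (p2 \<cdot> y)) = Zero B q b" using y f \<sigma>(1) R(1-15) by simp
    have "g \<cdot> ((f \<cdot> (p1 \<cdot> y)) \<boxplus> (\<sigma> \<cdot> (p2 \<cdot> y))) = e \<cdot> (p2 \<cdot> y)"
      using y(1) f g \<sigma>(1) R(1-15) zs(2) g\<sigma>[of "p2 \<cdot> y"] e by simp
    then have "e \<cdot> (p2 \<cdot> y) = Zero B q c" unfolding eq using g y(1) by simp
    then obtain v where v: "v \<in> Hom B q w" "k \<cdot> v = p2 \<cdot> y"
      by (rule ses_ker_fact[OF ke k e, rotated]) (use y R(1-15) in auto)
    have "f \<cdot> ((p1 \<cdot> y) \<boxplus> (\<tau> \<cdot> v)) = Zero B q b"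
      using eq f\<tau>[of v] v f \<tau>(1) y(1) R(1-15) by simp
    then have "(p1 \<cdot> y) \<boxplus> (\<tau> \<cdot> v) = Zero B q a"
      by (rule mono_elemD[OF ses_arr(5)[OF s] f, rotated]) (use y v \<tau> R(1-15) in auto)
    then have "\<tau> \<cdot> v = neg (p1 \<cdot> y)"
      by - (rule neg_unique, use y v \<tau> R(1-15) in auto)
    then have "?\<kappa> \<cdot> neg v = y"
      using biprod_eqI[OF S, of "?\<kappa> \<cdot> neg v" q y] v y(1) \<tau>(1) k R(1-15) RR(1-4) by simp
    then show "\<exists>v\<in>Hom B q w. ?\<kappa> \<cdot> v = y" using v(1) by (intro bexI[of _ "neg v"]) auto
  next
    fix q y assume q: "projective B q" and y: "y \<in> Hom B q b"
    have gy: "g \<cdot> y \<in> Hom B q c" using y g by auto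
    obtain u where u: "u \<in> Hom B q p" "e \<cdot> u = g \<cdot> y" by (rule ses_lift[OF ke e q gy])
    have "g \<cdot> (y \<boxplus> neg (\<sigma> \<cdot> u)) = Zero B q c" using y g \<sigma>(1) u g\<sigma>[of u] by simp
    then obtain v where v: "v \<in> Hom B q a" "f \<cdot> v = y \<boxplus> neg (\<sigma> \<cdot> u)"
      by (rule ses_ker_fact[OF s f g, rotated]) (use y \<sigma>(1) u in auto)
    have "?\<phi> \<cdot> ((i1 \<cdot> v) \<boxplus> (i2 \<cdot> u)) = y"
      using v u(1) f \<sigma>(1) y R(1-15) RR(1-4) by (simp add: add_assoc)
    then show "\<exists>v\<in>Hom B q S. ?\<phi> \<cdot> v = y"
      using v(1) u(1) R(1-15) by (intro bexI[of _ "(i1 \<cdot> v) \<boxplus> (i2 \<cdot> u)"]) auto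
  qed
  then have ex: "exact_at B (FM F ?\<kappa>) (FM F ?\<phi>)" by (rule F_ses(1))
  note FRR = biprod_rules[OF F_biprod[OF S]]
  show ?thesis
  proof (rule mono_elemI[of _ "FO F a" "FO F b"])
    fix q y assume q: "projective B q" and y: "y \<in> Hom B q (FO F a)" "FM F f \<cdot> y = Zero B q (FO F b)"
    have \<phi>y: "FM F ?\<phi> \<cdot> (FM F i1 \<cdot> y) = Zero B q (FO F b)"
      using y f \<sigma>(1) R(1-15) FRR(1-4)[of y] by simp
    obtain v where v: "v \<in> Hom B q (FO F w)" "FM F ?\<kappa> \<cdot> v = FM F i1 \<cdot> y"
      by (rule exact_lift[OF ex q _ _ _ \<phi>y, of "FO F w" "FO F S"])
        (use \<kappa>T \<phi>T y(1) R(1-15) in \<open>auto simp del: F_add comp_add_arr\<close>)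
    have "FM F p2 \<cdot> (FM F ?\<kappa> \<cdot> v) = neg (FM F k \<cdot> v)"
      using v(1) \<tau>(1) k R(1-15) FRR(1-4) by simp
    then have "neg (FM F k \<cdot> v) = Zero B q (FO F p)" unfolding v(2) using y(1) R(1-15) FRR(1-4)[of y] by simp
    then have "neg (neg (FM F k \<cdot> v)) = Zero B q (FO F p)" using y(1) ob by simp
    then have "FM F k \<cdot> v = Zero B q (FO F p)" using v(1) k by simp
    then have "v = Zero B q (FO F w)"
      by (rule mono_elemD[OF Fk _ v(1), rotated]) (use k in auto)
    then have "FM F i1 \<cdot> y = Zero B q (FO F S)" using v(2) \<kappa>T y(1) by simp
    then have "FM F p1 \<cdot> (FM F i1 \<cdot> y) = Zero B q (FO F a)" using R(1-15) y(1) by simp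
    then show "y = Zero B q (FO F a)" using FRR(1)[of y] y(1) by simp
  qed (use f in auto)
qed

end

section \<open>Lifting a right cotorsion pair\<close>

locale eta_extension_enough = eta_extension +
  assumes enough_proj_A: "enough_projectives A"
    and enough_inj_A: "enough_injectives A"

sublocale eta_extension_enough \<subseteq> A: abelian_enough A
  by (intro abelian_enough.intro abelian_A abelian_enough_axioms.intro enough_proj_A enough_inj_A)

context eta_extension_enough
begin

declare A.Hom_iff [simp del]

lemma T_projective:
  assumes p: "projective B p"
  shows "projective A (T p)"
  unfolding projective_def
proof (intro conjI allI impI ballI)
  have po: "p \<in> Obj B" by (rule projective_obj[OF p])
  note R = biprodE[OF T_biprod[OF po]]
  show "T p \<in> Obj A" by (rule T_obj_props(1)[OF po])
  fix e f assume e: "is_epi A e" and f: "f \<in> Hom A (T p) (Cod A e)"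
  obtain a \<alpha> b where e': "e = (a, \<alpha>, b)" "(a, \<alpha>, b) \<in> Hom A a b" "a \<in> Obj A" "b \<in> Obj A"
    "\<alpha> \<in> Hom B (fst a) (fst b)" by (metis ArrA_E A.epi_arr[OF e])
  obtain \<phi> where f': "f = (T p, \<phi>, b)" "(T p, \<phi>, b) \<in> Hom A (T p) b" "\<phi> \<in> Hom B (fst (T p)) (fst b)"
    using HomA_E[of f "T p" b] f e'(1) by simp blast
  have "is_epi B \<alpha>" using e epi_A_iff[OF e'(2)] e'(1) by simp
  then obtain h where h: "h \<in> Hom B p (fst a)" "\<alpha> \<cdot> h = \<phi> \<cdot> Ti1 p"
    by (rule projective_lift[OF p, of \<alpha> "\<phi> \<cdot> Ti1 p"]) (use e'(5) f'(3) R(1-15) in auto)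
  obtain \<psi> where \<psi>: "(T p, \<psi>, a) \<in> Hom A (T p) a" "\<psi> \<cdot> Ti1 p = h" by (rule T_univ[OF po e'(3) h(1)])
  have \<psi>T: "\<psi> \<in> Hom B (fst (T p)) (fst a)" using \<psi>(1) unfolding HomA_iff by blast
  have "(T p, \<alpha> \<cdot> \<psi>, b) \<in> Hom A (T p) b" using A.comp_hom[OF \<psi>(1) e'(2)] by simp
  then have "\<alpha> \<cdot> \<psi> = \<phi>"
    by (rule T_ext[OF po _ f'(2)]) (use \<psi>(2) \<psi>T h(2) e'(5) R(1-15) in simp)
  then show "\<exists>g\<in>Hom A (T p) (Dom A e). Comp A e g = f"
    using \<psi>(1) e' f'(1) by (intro bexI[of _ "(T p, \<psi>, a)"]) auto
qed

lemma T_ext1_zero: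
  assumes s: "ses B k e" and k: "k \<in> Hom B w p" and e: "e \<in> Hom B p x" and p: "projective B p"
    and Fk: "is_mono B (FM F k)" and a: "a \<in> Obj A" and E: "ext1_zero x (fst a)"
  shows "A.ext1_zero (T x) a"
proof -
  note M = Tmor_hom[OF k] Tmor_hom[OF e]
  have ob: "w \<in> Obj B" "p \<in> Obj B" using k by auto
  note R = biprodE[OF T_biprod[OF ob(1)]] and R' = biprodE[OF T_biprod[OF ob(2)]] and U = Tu_props[OF k]
  have s': "ses A (T w, Tu k, T p) (T p, Tu e, T x)" using T_ses[OF s k e Fk] M by simp
  show ?thesis
  proof (rule A.ext1_zero_projI[OF s' M(2,4) T_projective[OF p] a])
    fix h assume "h \<in> Hom A (T w) a"
    then obtain \<phi> where h: "h = (T w, \<phi>, a)" "(T w, \<phi>, a) \<in> Hom A (T w) a" "\<phi> \<in> Hom B (fst (T w)) (fst a)"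
      by (metis HomA_E)
    have "\<phi> \<cdot> Ti1 w \<in> Hom B w (fst a)" using h(3) R(1-15) by auto
    then obtain l where l: "l \<in> Hom B p (fst a)" "l \<cdot> k = \<phi> \<cdot> Ti1 w" by (rule ext1_zeroD[OF E s k e])
    obtain \<psi> where \<psi>: "(T p, \<psi>, a) \<in> Hom A (T p) a" "\<psi> \<cdot> Ti1 p = l" by (rule T_univ[OF ob(2) a l(1)])
    have \<psi>T: "\<psi> \<in> Hom B (fst (T p)) (fst a)" using \<psi>(1) unfolding HomA_iff by blast
    have c: "(T w, \<psi> \<cdot> Tu k, a) \<in> Hom A (T w) a" using A.comp_hom[OF M(2) \<psi>(1)] by simp
    have "(\<psi> \<cdot> Tu k) \<cdot> Ti1 w = \<psi> \<cdot> (Ti1 p \<cdot> k)"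
      using U(1,2) \<psi>T R(1-15) by simp
    also have "\<dots> = l \<cdot> k"
      by (rule assoc_eq[OF \<psi>(2)]) (use \<psi>T R'(1-15) k in simp_all)
    finally have "(\<psi> \<cdot> Tu k) \<cdot> Ti1 w = l \<cdot> k" .
    then have "\<psi> \<cdot> Tu k = \<phi>" using l(2) by (intro T_ext[OF ob(1) c h(2)]) simp
    then show "\<exists>l\<in>Hom A (T p) a. Comp A l (T w, Tu k, T p) = h"
      using \<psi>(1) h(1) by (intro bexI[of _ "(T p, \<psi>, a)"]) auto
  qed
qed

lemma T_ext_zero:
  assumes x: "x \<in> Obj B" and a: "a \<in> Obj A"
    and L: "\<And>i. i \<le> n \<Longrightarrow> is_zero B (left_derived B B F (Suc i) x)" and E0: "ext_zero n x (fst a)"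
  shows "A.ext_zero n (T x) a"
proof -
  obtain W K E where s: "\<And>i. ses B (K i) (E i)" and K: "\<And>i. K i \<in> Hom B (W (Suc i)) (res_obj B x i)"
    and E: "\<And>i. E i \<in> Hom B (res_obj B x i) (W i)" and W: "W 0 = x" and P: "\<And>i. projective B (res_obj B x i)"
    and m: "\<And>i. is_zero B (left_derived B B F (Suc i) x) \<Longrightarrow> is_mono B (FM F (K i))"
    by (rule syzygies_F_mono[OF x]) blast
  have fa: "fst a \<in> Obj B" using ObjA_D(1)[OF a] .
  have "A.ext_zero j (T (W i)) a" if "ext_zero j (W i) (fst a)" "i + j \<le> n" for i j
    using that
  proof (induction j arbitrary: i)
    case 0
    then show ?case using T_ext1_zero[OF s K E P m[OF L] a, of i] by simp
  next
    case (Suc j)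
    have "ext_zero j (W (Suc i)) (fst a)" using ext_zero_shift[OF s K E P fa] Suc.prems(1) by blast
    then have 1: "A.ext_zero j (T (W (Suc i))) a" using Suc by simp
    have Fk: "is_mono B (FM F (K i))" by (rule m[OF L]) (use Suc.prems in simp)
    note M = Tmor_hom[OF K[of i]] Tmor_hom[OF E[of i]]
    have "ses A (T (W (Suc i)), Tu (K i), T (res_obj B x i)) (T (res_obj B x i), Tu (E i), T (W i))"
      using T_ses[OF s K E Fk] M by simp
    then show ?case using A.ext_zero_shift[OF _ M(2,4) T_projective[OF P] a, of j] 1 by blast
  qed
  from this[of n 0] show ?thesis using E0 W by simp
qed

lemma T_class_additive:
  assumes X: "additive_subcat B X"
  shows "additive_subcat A (T_class B F \<eta> X)"
proof -
  note D = additive_subcatD[OF X]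
  show ?thesis
    unfolding additive_subcat_def
  proof (intro conjI ballI allI impI)
    show "T_class B F \<eta> X \<subseteq> Obj A" unfolding T_class_def isomorphic_def by auto
    obtain z where z: "z \<in> X" "is_zero B z" using D(2) by blast
    then have zo: "z \<in> Obj B" "Id B z = Zero B z z" by (auto simp: is_zero_iff)
    note R = biprodE[OF T_biprod[OF zo(1)]] and P = T_obj_props[OF zo(1)]
    have "FM F (Id B z) = FM F (Zero B z z)" using zo(2) by simp
    then have Fz: "is_zero B (FO F z)" using zo(1) by (auto simp: is_zero_iff)
    have "Tp1 z = Zero B (fst (T z)) z" "Tp2 z = Zero B (fst (T z)) (FO F z)"
      using zero_obj_arr(2)[OF z(2), of "Tp1 z" "fst (T z)"]
        zero_obj_arr(2)[OF Fz, of "Tp2 z" "fst (T z)"] R(1-15) by auto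
    then have "Id B (fst (T z)) = Zero B (fst (T z)) (fst (T z))" using R(1-15) R(20)[symmetric] by simp
    then have "is_zero A (T z)" using P(1) R(3) by (simp add: zero_A_iff is_zero_iff)
    moreover have "T z \<in> T_class B F \<eta> X" using z A.isomorphic_refl[OF P(1)] unfolding T_class_def by blast
    ultimately show "\<exists>z\<in>T_class B F \<eta> X. is_zero A z" by blast
  next
    fix a b s i1 i2 p1 p2
    assume "a \<in> T_class B F \<eta> X" "b \<in> T_class B F \<eta> X" and S: "is_biprod A a b (s, i1, i2, p1, p2)"
    then obtain x y where x: "x \<in> X" "isomorphic A a (T x)" and y: "y \<in> X" "isomorphic A b (T y)"
      unfolding T_class_def by blast
    obtain t j1 j2 q1 q2 where t: "is_biprod B x y (t, j1, j2, q1, q2)"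
      using ex_biprod[of x y] x y D(1) by (metis prod_cases5 subsetD)
    have "t \<in> X" by (rule D(4)[OF x(1) y(1) t])
    then show "s \<in> T_class B F \<eta> X"
      using A.biprod_iso[OF S T_preserves_biprod[OF t] x(2) y(2)] unfolding T_class_def by blast
  next
    fix a b assume "a \<in> T_class B F \<eta> X" "isomorphic A a b"
    then show "b \<in> T_class B F \<eta> X"
      unfolding T_class_def using A.isomorphic_sym A.isomorphic_trans by blast
  qed
qed

lemma isomorphic_A_D:
  assumes "isomorphic A a b"
  shows "isomorphic B (fst a) (fst b)"
proof -
  obtain f g where f: "f \<in> Hom A a b" "g \<in> Hom A b a" "Comp A g f = Id A a" "Comp A f g = Id A b"
    using assms unfolding isomorphic_def by blast
  obtain \<alpha> where \<alpha>: "f = (a, \<alpha>, b)" "\<alpha> \<in> Hom B (fst a) (fst b)" by (rule HomA_under[OF f(1)])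
  obtain \<beta> where \<beta>: "g = (b, \<beta>, a)" "\<beta> \<in> Hom B (fst b) (fst a)" by (rule HomA_under[OF f(2)])
  show ?thesis by (rule isomorphicI[OF \<alpha>(2) \<beta>(2)]) (use f(3,4) \<alpha> \<beta> in simp_all)
qed

lemma U_inv_additive:
  assumes Y: "additive_subcat B Y"
  shows "additive_subcat A (U_inv B F \<eta> Y)"
proof -
  note D = additive_subcatD[OF Y]
  show ?thesis
    unfolding additive_subcat_def
  proof (intro conjI ballI allI impI)
    show "U_inv B F \<eta> Y \<subseteq> Obj A" unfolding U_inv_def by auto
    obtain z where z: "is_zero A z" using A.ex_zero by blast
    obtain y where "y \<in> Y" "is_zero B y" using D(2) by blast
    then have "fst z \<in> Y"
      using D(3)[of y "fst z"] zero_objects_isomorphic[of y "fst z"] z zero_A_iff by blast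
    then show "\<exists>z\<in>U_inv B F \<eta> Y. is_zero A z"
      using z zero_A_iff unfolding U_inv_def by (intro bexI[of _ z]) auto
  next
    fix a b s i1 i2 p1 p2
    assume ab: "a \<in> U_inv B F \<eta> Y" "b \<in> U_inv B F \<eta> Y" and S: "is_biprod A a b (s, i1, i2, p1, p2)"
    have "is_biprod B (fst a) (fst b) (fst s, fst (snd i1), fst (snd i2), fst (snd p1), fst (snd p2))"
      by (rule biprod_A_D(1)[of a b s "fst i1" _ "snd (snd i1)" "fst i2" _ "snd (snd i2)"
            "fst p1" _ "snd (snd p1)" "fst p2" _ "snd (snd p2)"]) (use S in simp)
    then have "fst s \<in> Y" using D(4)[of "fst a" "fst b"] ab unfolding U_inv_def by blast
    then show "s \<in> U_inv B F \<eta> Y" using S unfolding U_inv_def is_biprod_def by auto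
  next
    fix a b assume "a \<in> U_inv B F \<eta> Y" "isomorphic A a b"
    then show "b \<in> U_inv B F \<eta> Y"
      using D(3)[OF _ isomorphic_A_D] unfolding U_inv_def isomorphic_def by blast
  qed
qed

lemma U_inv_summand_closed:
  assumes Y: "summand_closed B Y"
  shows "summand_closed A (U_inv B F \<eta> Y)"
  unfolding summand_closed_def
proof (intro allI impI, elim conjE)
  fix a b s i1 i2 p1 p2
  assume S: "is_biprod A a b (s, i1, i2, p1, p2)" and s: "s \<in> U_inv B F \<eta> Y"
  have "is_biprod B (fst a) (fst b) (fst s, fst (snd i1), fst (snd i2), fst (snd p1), fst (snd p2))"
    by (rule biprod_A_D(1)[of a b s "fst i1" _ "snd (snd i1)" "fst i2" _ "snd (snd i2)"
          "fst p1" _ "snd (snd p1)" "fst p2" _ "snd (snd p2)"]) (use S in simp)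
  then have "fst a \<in> Y" using Y s unfolding summand_closed_def U_inv_def by blast
  then show "a \<in> U_inv B F \<eta> Y" using S unfolding U_inv_def is_biprod_def by auto
qed

lemma lift_ses:
  assumes s: "ses B j p" and j: "j \<in> Hom B b y" and p: "p \<in> Hom B y x"
    and uv: "(u, v) = lift_seq B F \<eta> j p"
  obtains E i1 i2 p1 p2 where "ses A u v" "u \<in> Hom A (Z_obj B F b) E" "v \<in> Hom A E (T x)"
    "Dom A v = E" "is_biprod B y (FO F x) (fst E, i1, i2, p1, p2)"
proof -
  have ob: "b \<in> Obj B" "y \<in> Obj B" "x \<in> Obj B" using j p by auto
  obtain s i1 i2 p1 p2 where bp: "biprod B y (FO F x) = (s, i1, i2, p1, p2)" by (metis prod_cases5)
  have S: "is_biprod B y (FO F x) (s, i1, i2, p1, p2)" using biprod_spec[OF ob(2) F_obj[OF ob(3)]] bp by simp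
  define t where "t = (i2 \<cdot> FM F p \<cdot> FM F p1) \<boxplus> (i2 \<cdot> \<eta> x \<cdot> FM F p2)"
  define \<alpha> where "\<alpha> = i1 \<cdot> j"
  define \<beta> where "\<beta> = (Ti1 x \<cdot> p \<cdot> p1) \<boxplus> (Ti2 x \<cdot> p2)"
  have "lift_seq B F \<eta> j p = ((Z_obj B F b, \<alpha>, (s, t)), ((s, t), \<beta>, T x))"
    using bp j p
    by (simp add: lift_seq_def Let_def t_def \<alpha>_def \<beta>_def Ti1_def Ti2_def case_prod_beta)
  then have u: "u = (Z_obj B F b, \<alpha>, (s, t))" and v: "v = ((s, t), \<beta>, T x)" using uv by auto
  note R = biprodE[OF S] and RR = biprod_rules[OF S] and L = lift_obj[OF S p t_def]
  note FR = biprodE[OF F_biprod[OF S]]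
  note ST = T_biprod[OF ob(3)]
  note RT = biprodE[OF ST] and RRT = biprod_rules[OF ST] and P = T_obj_props[OF ob(3)]
  note z = ses_zero[OF \<open>ses B j p\<close> j p]
  have \<alpha>T: "\<alpha> \<in> Hom B b s" unfolding \<alpha>_def using j R(1-15) by auto
  have \<beta>T: "\<beta> \<in> Hom B s (fst (T x))" unfolding \<beta>_def using p R(1-15) RT(1-15) by auto
  have b1: "\<beta> \<cdot> i1 = Ti1 x \<cdot> p" and b2: "\<beta> \<cdot> i2 = Ti2 x"
    and q1: "Tp1 x \<cdot> \<beta> = p \<cdot> p1" and q2: "Tp2 x \<cdot> \<beta> = p2"
    unfolding \<beta>_def using p R RT(1-15) RRT(1-4) by simp_all
  have "FM F (p \<cdot> j) = Zero B (FO F b) (FO F x)" using z(1) ob by simp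
  then have Fz: "FM F p \<cdot> FM F j = Zero B (FO F b) (FO F x)" using p j by simp
  have Z: "Z_obj B F b \<in> Obj A" using ob by (auto simp: ObjA_iff Z_obj_def)
  have "t \<cdot> FM F \<alpha> = (t \<cdot> FM F i1) \<cdot> FM F j" unfolding \<alpha>_def using L(2) j R(1-15) by simp
  also have "\<dots> = Zero B (FO F b) s" unfolding L(3) using j p R(1-15) Fz by simp
  finally have uA: "u \<in> Hom A (Z_obj B F b) (s, t)"
    unfolding u HomA_iff using Z L(1) \<alpha>T ob by (simp add: Z_obj_def)
  have F\<beta>: "FM F \<beta> \<cdot> FM F i1 = FM F (Ti1 x) \<cdot> FM F p" "FM F \<beta> \<cdot> FM F i2 = FM F (Ti2 x)"
    using arg_cong[OF b1, of "FM F"] arg_cong[OF b2, of "FM F"] \<beta>T R(1-15) RT(1-15) p by simp_all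
  have "\<beta> \<cdot> t = snd (T x) \<cdot> FM F \<beta>"
  proof (rule biprod_coeqI[OF F_biprod[OF S], of _ "fst (T x)"])
    have "(\<beta> \<cdot> t) \<cdot> FM F i1 = (\<beta> \<cdot> i2) \<cdot> FM F p" using L \<beta>T R(1-15) p by simp
    also have "\<dots> = (snd (T x) \<cdot> FM F (Ti1 x)) \<cdot> FM F p" unfolding b2 P(3) ..
    also have "\<dots> = (snd (T x) \<cdot> FM F \<beta>) \<cdot> FM F i1" using F\<beta>(1) P(2) \<beta>T R(1-15) RT(1-15) p by simp
    finally show "(\<beta> \<cdot> t) \<cdot> FM F i1 = (snd (T x) \<cdot> FM F \<beta>) \<cdot> FM F i1" .
    have "(\<beta> \<cdot> t) \<cdot> FM F i2 = (\<beta> \<cdot> i2) \<cdot> \<eta> x" using L \<beta>T R(1-15) ob by simp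
    also have "\<dots> = snd (T x) \<cdot> FM F (Ti2 x)" unfolding b2 P(4) ..
    also have "\<dots> = (snd (T x) \<cdot> FM F \<beta>) \<cdot> FM F i2" using F\<beta>(2) P(2) \<beta>T R(1-15) RT(1-15) by simp
    finally show "(\<beta> \<cdot> t) \<cdot> FM F i2 = (snd (T x) \<cdot> FM F \<beta>) \<cdot> FM F i2" .
  qed (use L(2) \<beta>T P(2) in auto)
  then have vA: "v \<in> Hom A (s, t) (T x)" unfolding v HomA_iff using L(1) P(1) \<beta>T by simp
  have "ses B \<alpha> \<beta>"
  proof (rule ses_elemI[OF \<alpha>T \<beta>T])
    show "\<beta> \<cdot> \<alpha> = Zero B b (fst (T x))"
      unfolding \<alpha>_def using assoc_eq[OF b1, of j] \<beta>T R(1-15) RT(1-15) j p z by simp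
  next
    fix q y' assume q: "projective B q" and y': "y' \<in> Hom B q b" "\<alpha> \<cdot> y' = Zero B q s"
    have "p1 \<cdot> (\<alpha> \<cdot> y') = j \<cdot> y'" unfolding \<alpha>_def using RR(1)[of "j \<cdot> y'"] y'(1) j R(1-15) by simp
    then have "j \<cdot> y' = Zero B q y" unfolding y'(2) using y'(1) R(1-15) by simp
    then show "y' = Zero B q b" by (rule mono_elemD[OF ses_arr(5)[OF \<open>ses B j p\<close>] j y'(1)])
  next
    fix q z assume q: "projective B q" and z: "z \<in> Hom B q s" "\<beta> \<cdot> z = Zero B q (fst (T x))"
    have "p \<cdot> (p1 \<cdot> z) = Tp1 x \<cdot> (\<beta> \<cdot> z)" "p2 \<cdot> z = Tp2 x \<cdot> (\<beta> \<cdot> z)"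
      using assoc_eq[OF q1, of z] assoc_eq[OF q2, of z] z(1) \<beta>T R(1-15) RT(1-15) p by simp_all
    then have z': "p \<cdot> (p1 \<cdot> z) = Zero B q x" "p2 \<cdot> z = Zero B q (FO F x)"
      unfolding z(2) using z(1) RT(1-15) by simp_all
    obtain w where w: "w \<in> Hom B q b" "j \<cdot> w = p1 \<cdot> z"
      by (rule ses_ker_fact[OF \<open>ses B j p\<close> j p _ z'(1)]) (use z(1) R(1-15) in auto)
    have "\<alpha> \<cdot> w = z"
      by (rule biprod_eqI[OF S, of _ q])
        (use w z z' j R(1-15) RR(1,4)[of "j \<cdot> w"] in \<open>simp_all add: \<alpha>_def\<close>)
    then show "\<exists>w\<in>Hom B q b. \<alpha> \<cdot> w = z" using w by blast
  next
    fix q z assume q: "projective B q" and z: "z \<in> Hom B q (fst (T x))"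
    have z1: "Tp1 x \<cdot> z \<in> Hom B q x" using z RT(1-15) by auto
    obtain m where m: "m \<in> Hom B q y" "p \<cdot> m = Tp1 x \<cdot> z" by (rule ses_lift[OF \<open>ses B j p\<close> p q z1])
    have "\<beta> \<cdot> ((i1 \<cdot> m) \<boxplus> (i2 \<cdot> (Tp2 x \<cdot> z))) = z"
      using assoc_eq[OF b1, of m] assoc_eq[OF b2, of "Tp2 x \<cdot> z"] m z \<beta>T p R(1-15) RT(1-15) RRT(5)[of z] by simp
    then show "\<exists>w\<in>Hom B q s. \<beta> \<cdot> w = z"
      using m(1) z R(1-15) RT(1-15) by (intro bexI[of _ "(i1 \<cdot> m) \<boxplus> (i2 \<cdot> (Tp2 x \<cdot> z))"]) auto
  qed
  then have "ses A u v" using ses_A_iff[of "Z_obj B F b" \<alpha> "(s, t)" \<beta> "T x"] uA vA unfolding u v by simp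
  then show ?thesis using that[of "(s, t)"] uA vA S v by simp
qed

lemma I_ses:
  assumes a: "a \<in> Obj A"
  obtains f g where "ses A f g" "f \<in> Hom A (I_obj B F a) a" "g \<in> Hom A a (Z_obj B F (C_obj B a))"
proof -
  note O = ObjA_D[OF a]
  obtain q i where qi: "image_fact B (snd a) = (q, i)" by fastforce
  have "is_image_fact B (snd a) (q, i)"
    using someI_ex[OF image_fact_exists[OF O(2)]] qi unfolding image_fact_def by simp
  then have q: "is_epi B q" "is_mono B i" "q \<in> Hom B (FO F (fst a)) (Dom B i)" "i \<in> Hom B (Dom B i) (fst a)"
    and iq: "i \<cdot> q = snd a"
    using O by (auto simp: is_image_fact_def mono_arr epi_arr)
  define w where "w = Dom B i"
  define g where "g = q \<cdot> FM F i"
  have I: "I_obj B F a = (w, g)" by (simp add: I_obj_def qi w_def g_def)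
  have qT: "q \<in> Hom B (FO F (fst a)) w" and iT: "i \<in> Hom B w (fst a)" using q by (auto simp: w_def)
  have gT: "g \<in> Hom B (FO F w) w" unfolding g_def using qT iT by auto
  have ig: "i \<cdot> g = snd a \<cdot> FM F i"
    unfolding g_def using assoc_eq[OF iq, of "FM F i"] qT iT by simp
  have Fig: "FM F i \<cdot> FM F g = FM F (snd a) \<cdot> FM F (FM F i)"
    using arg_cong[OF ig, of "FM F"] gT iT O(1-4) by simp
  have "g \<cdot> FM F g = g \<cdot> \<eta> w"
  proof (rule mono_cancel[OF q(2), of _ "FO F (FO F w)"])
    have "i \<cdot> (g \<cdot> FM F g) = snd a \<cdot> (FM F i \<cdot> FM F g)" using assoc_eq[OF ig, of "FM F g"] gT iT O(1-4) by simp
    also have "\<dots> = (snd a \<cdot> FM F (snd a)) \<cdot> FM F (FM F i)" unfolding Fig using gT iT O(1-4) by simp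
    also have "\<dots> = snd a \<cdot> (\<eta> (fst a) \<cdot> FM F (FM F i))" unfolding O(5) using iT O(1-4) by simp
    also have "\<dots> = (snd a \<cdot> FM F i) \<cdot> \<eta> w" unfolding eta_nat[OF iT, symmetric] using iT O(1-4) by simp
    also have "\<dots> = i \<cdot> (g \<cdot> \<eta> w)" unfolding ig[symmetric] using iT gT by simp
    finally show "i \<cdot> (g \<cdot> FM F g) = i \<cdot> (g \<cdot> \<eta> w)" .
  qed (use gT iT in auto)
  then have Io: "(w, g) \<in> Obj A" using gT by (auto simp: ObjA_iff)
  obtain c where c: "is_cokernel B c (snd a)" "C_obj B a = Cod B c"
    using coker_obj_spec[OF O(2)] unfolding C_obj_def by metis
  have cT: "c \<in> Hom B (fst a) (Cod B c)" and cz: "c \<cdot> snd a = Zero B (FO F (fst a)) (Cod B c)"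
    using c(1) O unfolding is_cokernel_def by auto
  let ?Z = "Z_obj B F (Cod B c)"
  have Z: "?Z \<in> Obj A" using cT by (auto simp: ObjA_iff Z_obj_def)
  have iA: "((w, g), i, a) \<in> Hom A (w, g) a" using Io a iT ig by (simp add: HomA_iff)
  have cA: "(a, c, ?Z) \<in> Hom A a ?Z" using Z a cT cz by (simp add: HomA_iff Z_obj_def)
  have ci: "c \<cdot> i = Zero B w (Cod B c)"
  proof (rule epi_cancel[OF q(1), of _ "Cod B c"])
    show "(c \<cdot> i) \<cdot> q = Zero B w (Cod B c) \<cdot> q" using cT qT iT iq cz by simp
  qed (use cT iT qT in auto)
  have "is_cokernel B c i"
  proof (rule is_cokernelI[OF cokernel_epi[OF c(1)] cT iT ci])
    fix d t assume t: "t \<in> Hom B (fst a) d" "t \<cdot> i = Zero B w d"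
    have "t \<cdot> snd a = (t \<cdot> i) \<cdot> q" unfolding iq[symmetric] using t(1) qT iT by simp
    then have "t \<cdot> snd a = Zero B (FO F (fst a)) d" unfolding t(2) using qT t(1) by simp
    then obtain u where "u \<in> Hom B (Cod B c) d" "u \<cdot> c = t"
      by (rule coker_fact[OF c(1) cT _ t(1), rotated]) (use O in auto)
    then show "\<exists>u\<in>Hom B (Cod B c) d. u \<cdot> c = t" by blast
  qed
  then have "ses A ((w, g), i, a) (a, c, ?Z)"
    using cokernel_ses[OF q(2)] ses_A_iff[OF iA cA] by blast
  then show ?thesis using that[of "((w, g), i, a)" "(a, c, ?Z)"] iA cA I c(2) by simp
qed

lemma T_cores:
  assumes X: "X \<subseteq> Obj B" "z \<in> X" "is_zero B z"
    and L: "\<And>x. x \<in> cores X k \<Longrightarrow> is_zero B (left_derived B B F 1 x)"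
  shows "m \<le> k \<Longrightarrow> x \<in> cores X m \<Longrightarrow> T x \<in> A.cores (T_class B F \<eta> X) m"
proof (induction m arbitrary: x)
  case 0
  then show ?case using A.isomorphic_refl[OF T_obj_props(1)] X(1) unfolding T_class_def by auto
next
  case (Suc m)
  obtain f g b c where s: "ses B f g" and f: "f \<in> Hom B x b" and g: "g \<in> Hom B b c"
    and b: "b \<in> X" and c: "c \<in> cores X m" by (rule cores_SucE[OF Suc.prems(2)])
  have "c \<in> cores X k" by (rule cores_mono[OF X _ c]) (use Suc.prems in simp)
  then have "is_mono B (FM F f)" by (intro F_mono_of_derived_zero[OF s f g] L)
  then have s': "ses A (T x, Tu f, T b) (T b, Tu g, T c)"
    using T_ses[OF s f g] Tmor_hom(1)[OF f] Tmor_hom(1)[OF g] by simp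
  have "T b \<in> T_class B F \<eta> X"
    using b A.isomorphic_refl[OF T_obj_props(1)] X(1) unfolding T_class_def by blast
  moreover have "T c \<in> A.cores (T_class B F \<eta> X) m" using Suc.IH[OF _ c] Suc.prems by simp
  ultimately show ?case by (rule A.cores_SucI[OF s' Tmor_hom(2)[OF f] Tmor_hom(2)[OF g]])
qed

lemma loewy_zero:
  assumes "loewy_length B F \<eta> a = enat m"
  shows "is_zero A ((I_obj B F ^^ m) a)"
proof -
  let ?S = "{enat d | d. is_zero A ((I_obj B F ^^ d) a)}"
  have m: "Inf ?S = enat m" using assms unfolding loewy_length_def .
  have ne: "?S \<noteq> {}"
  proof
    assume "?S = {}"
    then have "Inf ?S = \<infinity>" by (simp only: Inf_enat_def simp_thms if_True)
    then show False using m by simp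
  qed
  then have "Inf ?S = (LEAST d. d \<in> ?S)" by (simp only: Inf_enat_def if_False)
  moreover have "(LEAST d. d \<in> ?S) \<in> ?S" using ne by (meson LeastI ex_in_conv)
  ultimately have "enat m \<in> ?S" using m by simp
  then show ?thesis by auto
qed

lemma I_iter_obj: "a \<in> Obj A \<Longrightarrow> (I_obj B F ^^ r) a \<in> Obj A"
proof (induction r)
  case (Suc r)
  then obtain f g where "f \<in> Hom A (I_obj B F ((I_obj B F ^^ r) a)) ((I_obj B F ^^ r) a)"
    by (metis I_ses)
  then show ?case unfolding A.Hom_iff by simp
qed simp

lemma C_iter_obj:
  assumes "a \<in> Obj A"
  shows "C_iter B F r a \<in> Obj B"
proof -
  have "snd ((I_obj B F ^^ r) a) \<in> Arr B" using ObjA_D[OF I_iter_obj[OF assms]] by blast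
  then show ?thesis
    unfolding C_iter_def C_obj_def
    by (metis coker_obj_spec is_cokernel_def obj_simps(2))
qed

end

locale compatible_pair = eta_extension_enough +
  fixes n :: nat and X Y :: "'a set"
  assumes n: "n \<ge> 1"
    and ct: "right_cotorsion_pair B n X Y"
    and compat: "F_compatible B F \<eta> n X Y"
begin

abbreviation TX where "TX \<equiv> T_class B F \<eta> X"
abbreviation UY where "UY \<equiv> U_inv B F \<eta> Y"

lemmas ctD = right_cotorsion_pairD[OF ct]
lemmas X_add = ctD(1) and Y_add = ctD(2)
lemmas TX_add = T_class_additive[OF X_add] and UY_add = U_inv_additive[OF Y_add]

lemma X_obj: "X \<subseteq> Obj B" and Y_obj: "Y \<subseteq> Obj B" and TX_obj: "TX \<subseteq> Obj A" and UY_obj: "UY \<subseteq> Obj A"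
  using additive_subcatD(1)[OF X_add] additive_subcatD(1)[OF Y_add] additive_subcatD(1)[OF TX_add]
    additive_subcatD(1)[OF UY_add] by auto

lemma TX_UY_ext_zero:
  assumes t: "t \<in> TX" and d: "d \<in> UY" and j: "j \<le> n"
  shows "A.ext_zero j t d"
proof -
  obtain x where x: "x \<in> X" "isomorphic A t (T x)" using t unfolding T_class_def by blast
  have dA: "d \<in> Obj A" and dY: "fst d \<in> Y" using d unfolding U_inv_def by auto
  have xo: "x \<in> Obj B" using x X_obj by blast
  have "Ext_vanishes B (Suc j) X Y"
  proof (cases "j = n")
    case True
    then show ?thesis using compat unfolding F_compatible_def by simp
  next
    case False
    then show ?thesis using ctD(4)[of "Suc j"] j by simp
  qed
  then have "ext_zero j x (fst d)" using Ext_vanishes_iff[OF X_obj Y_obj] x(1) dY by blast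
  moreover have "is_zero B (left_derived B B F (Suc i) x)" if "i \<le> j" for i
    using compat x(1) that j unfolding F_compatible_def by (auto simp del: left_derived.simps)
  ultimately have "A.ext_zero j (T x) d" by (intro T_ext_zero[OF xo dA])
  then show ?thesis by (rule A.ext_zero_iso[OF A.isomorphic_sym[OF x(2)]])
qed

lemma T_coresolved:
  assumes "x \<in> coresolved B X (n - 1)"
  shows "T x \<in> A.cores TX (n - 1)" "FO F x \<in> Y"
proof -
  obtain z where z: "z \<in> X" "is_zero B z" using additive_subcatD(2)[OF X_add] by blast
  show "T x \<in> A.cores TX (n - 1)"
    by (rule T_cores[OF X_obj z, of "n - 1"])
      (use assms compat coresolved_eq_cores[OF X_add] in \<open>auto simp: F_compatible_def\<close>)
  show "FO F x \<in> Y" using assms compat unfolding F_compatible_def by blast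
qed

lemma approximation:
  assumes "a \<in> Obj A" "is_zero A ((I_obj B F ^^ m) a)"
    and "\<And>r. r < m \<Longrightarrow> ses B (j r) (p r) \<and> Dom B (j r) = C_iter B F r a \<and> Dom B (p r) \<in> Y \<and>
      Cod B (p r) \<in> coresolved B X (n - 1) \<and> (u r, v r) = lift_seq B F \<eta> (j r) (p r)"
  shows "\<exists>f g. ses A f g \<and> Dom A f = a \<and> Cod A f \<in> UY \<and> Cod A g \<in> A.cores TX (n - 1) \<and>
    has_filtration A m (Cod A f) (\<lambda>r. Dom A (v r)) \<and>
    has_filtration A m (Cod A g) (\<lambda>r. T (Cod B (p r)))"
  using assms
proof (induction m arbitrary: a j p u v)
  case 0
  then have az: "is_zero A a" by simp
  obtain z where z: "z \<in> TX" "is_zero A z" using additive_subcatD(2)[OF TX_add] by blast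
  obtain y where y: "y \<in> UY" "is_zero A y" using additive_subcatD(2)[OF UY_add] by blast
  have aT: "a \<in> TX" and aU: "a \<in> UY"
    using additive_subcatD(3)[OF TX_add z(1)] additive_subcatD(3)[OF UY_add y(1)]
      A.zero_objects_isomorphic[OF z(2) az] A.zero_objects_isomorphic[OF y(2) az] by blast+
  have "a \<in> A.cores TX (n - 1)" by (rule A.cores_mono[OF TX_obj z, of 0]) (use aT in auto)
  moreover have "has_filtration A 0 a Q" for Q
    unfolding has_filtration_def using az by (intro exI[of _ "\<lambda>_. a"]) simp
  ultimately show ?case
    using A.ses_id_zero[OF 0(1) az] aU by (intro exI[of _ "Id A a"] exI[of _ "Zero A a a"]) simp
next
  case (Suc m)
  let ?Ia = "I_obj B F a"
  obtain i c where ic: "ses A i c" and i: "i \<in> Hom A ?Ia a" and c: "c \<in> Hom A a (Z_obj B F (C_obj B a))"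
    by (rule I_ses[OF Suc.prems(1)])
  have Io: "?Ia \<in> Obj A" using i unfolding A.Hom_iff by blast
  have shift: "(I_obj B F ^^ Suc r) a = (I_obj B F ^^ r) ?Ia" for r
    by (simp add: funpow_swap1)
  have Cshift: "C_iter B F (Suc r) a = C_iter B F r ?Ia" for r
    unfolding C_iter_def shift ..
  have "\<exists>f g. ses A f g \<and> Dom A f = ?Ia \<and> Cod A f \<in> UY \<and> Cod A g \<in> A.cores TX (n - 1) \<and>
    has_filtration A m (Cod A f) (\<lambda>r. Dom A (v (Suc r))) \<and>
    has_filtration A m (Cod A g) (\<lambda>r. T (Cod B (p (Suc r))))"
  proof (rule Suc.IH[OF Io, of "\<lambda>r. j (Suc r)" "\<lambda>r. p (Suc r)" "\<lambda>r. u (Suc r)"])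
    show "is_zero A ((I_obj B F ^^ m) ?Ia)" using Suc.prems(2) unfolding shift .
    fix r assume "r < m"
    then show "ses B (j (Suc r)) (p (Suc r)) \<and> Dom B (j (Suc r)) = C_iter B F r ?Ia \<and> Dom B (p (Suc r)) \<in> Y \<and>
      Cod B (p (Suc r)) \<in> coresolved B X (n - 1) \<and>
      (u (Suc r), v (Suc r)) = lift_seq B F \<eta> (j (Suc r)) (p (Suc r))"
      using Suc.prems(3)[of "Suc r"] Cshift[of r] by simp
  qed
  then obtain f g where fg: "ses A f g" "Dom A f = ?Ia" and fU: "Cod A f \<in> UY" and gT: "Cod A g \<in> A.cores TX (n - 1)"
    and Df: "has_filtration A m (Cod A f) (\<lambda>r. Dom A (v (Suc r)))"
    and Dg: "has_filtration A m (Cod A g) (\<lambda>r. T (Cod B (p (Suc r))))" by blast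
  have f: "f \<in> Hom A ?Ia (Cod A f)" and g: "g \<in> Hom A (Cod A f) (Cod A g)"
    using A.ses_arr[OF fg(1)] fg(2) Io unfolding A.Hom_iff by auto
  define y x where "y = Dom B (p 0)" and "x = Cod B (p 0)"
  have jp: "ses B (j 0) (p 0)" and y: "y \<in> Y" and x: "x \<in> coresolved B X (n - 1)"
    and uv: "(u 0, v 0) = lift_seq B F \<eta> (j 0) (p 0)" and j0: "Dom B (j 0) = C_obj B a"
    using Suc.prems(3)[of 0] unfolding x_def y_def by (simp_all add: C_iter_def)
  have jT: "j 0 \<in> Hom B (C_obj B a) y" and pT: "p 0 \<in> Hom B y x"
    using ses_arr[OF jp] j0 dom_obj[OF ses_arr(1)[OF jp]] unfolding x_def y_def by auto
  obtain E i1 i2 p1 p2 where s: "ses A (u 0) (v 0)" and u: "u 0 \<in> Hom A (Z_obj B F (C_obj B a)) E"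
    and v: "v 0 \<in> Hom A E (T x)" and vD: "Dom A (v 0) = E" and E: "is_biprod B y (FO F x) (fst E, i1, i2, p1, p2)"
    by (rule lift_ses[OF jp jT pT uv])
  note Tx = T_coresolved[OF x]
  have EY: "fst E \<in> Y" by (rule additive_subcatD(4)[OF Y_add y Tx(2) E])
  have van: "A.ext_zero 1 (T x) (Cod A f)"
  proof (rule A.ext_zero_cores[OF _ TX_obj Tx(1)])
    show "Cod A f \<in> Obj A" using fU UY_obj by blast
    fix j x assume "j \<le> 1 + (n - 1)" "x \<in> TX"
    then show "A.ext_zero j x (Cod A f)" using TX_UY_ext_zero[OF _ fU, of x j] n by simp
  qed
  obtain a' b w' w s' t d0 q0 where ab: "ses A a' b" and a': "a' \<in> Hom A a d0" and b: "b \<in> Hom A d0 q0"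
    and ww: "ses A w' w" and w': "w' \<in> Hom A (Cod A f) d0" and w: "w \<in> Hom A d0 E"
    and st: "ses A s' t" and s': "s' \<in> Hom A (Cod A g) q0" and t: "t \<in> Hom A q0 (T x)"
    by (rule A.ses_three_by_three[OF ic i c s u v fg(1) f g van])
  have Dab: "Dom A a' = a" "Cod A a' = d0" "Cod A b = q0" "Dom A w' = Cod A f" "Cod A w' = d0" "Cod A w = E"
    "Dom A s' = Cod A g" "Cod A s' = q0" "Cod A t = T x"
    using a' b w' w s' t unfolding A.Hom_iff by auto
  obtain \<omega>' where \<omega>': "w' = (Cod A f, \<omega>', d0)" "\<omega>' \<in> Hom B (fst (Cod A f)) (fst d0)" by (rule HomA_under[OF w'])
  obtain \<omega> where \<omega>: "w = (d0, \<omega>, E)" "\<omega> \<in> Hom B (fst d0) (fst E)" by (rule HomA_under[OF w])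
  have "ses B \<omega>' \<omega>" using ses_A_iff[of "Cod A f" \<omega>' d0 \<omega> E] ww w' w \<omega>'(1) \<omega>(1) by simp
  then have "fst d0 \<in> Y"
    by (rule right_cotorsion_extension[OF ct n _ \<omega>'(2) \<omega>(2) _ EY]) (use fU in \<open>simp add: U_inv_def\<close>)
  then have dU: "d0 \<in> UY" using a' unfolding U_inv_def A.Hom_iff by simp
  have "extension_closed A (A.cores TX (n - 1))"
    using compat A.coresolved_eq_cores[OF TX_add] unfolding F_compatible_def by simp
  then have qT: "q0 \<in> A.cores TX (n - 1)"
    using st gT Tx(1) unfolding extension_closed_def by (metis Dab(7-9))
  have "has_filtration A (Suc m) (Cod A w') (\<lambda>r. Dom A (v r))"
    by (rule A.filtration_Suc[OF ww, of m "\<lambda>r. Dom A (v (Suc r))"]) (use Df Dab vD in simp_all)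
  moreover have "has_filtration A (Suc m) (Cod A s') (\<lambda>r. T (Cod B (p r)))"
    by (rule A.filtration_Suc[OF st, of m "\<lambda>r. T (Cod B (p (Suc r)))"]) (use Dg Dab x_def in simp_all)
  ultimately show ?case using ab dU qT Dab by (intro exI[of _ a'] exI[of _ b]) simp
qed

lemma right_cotorsion_pair_A:
  assumes nil: "image_nilpotent B F \<eta>"
  shows "right_cotorsion_pair A n TX UY"
  unfolding right_cotorsion_pair_def
proof (intro conjI ballI TX_add UY_add U_inv_summand_closed[OF ctD(3)])
  fix i assume "i \<in> {1..n}"
  then obtain k where k: "i = Suc k" "k \<le> n" by (cases i) auto
  show "Ext_vanishes A i TX UY"
    unfolding k(1) A.Ext_vanishes_iff[OF TX_obj UY_obj] using TX_UY_ext_zero k(2) by blast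
next
  fix a assume a: "a \<in> Obj A"
  then obtain m where "loewy_length B F \<eta> a = enat m"
    using nil unfolding image_nilpotent_def by (metis less_infinityE)
  then have z: "is_zero A ((I_obj B F ^^ m) a)" by (rule loewy_zero)
  have "\<forall>r. \<exists>f g. ses B f g \<and> Dom B f = C_iter B F r a \<and> Cod B f \<in> Y \<and> Cod B g \<in> coresolved B X (n - 1)"
    using ctD(5)[OF C_iter_obj[OF a]] by blast
  then obtain j p where jp: "\<And>r. ses B (j r) (p r) \<and> Dom B (j r) = C_iter B F r a \<and> Cod B (j r) \<in> Y \<and>
    Cod B (p r) \<in> coresolved B X (n - 1)" by metis
  have "\<exists>f g. ses A f g \<and> Dom A f = a \<and> Cod A f \<in> UY \<and> Cod A g \<in> A.cores TX (n - 1) \<and>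
    has_filtration A m (Cod A f) (\<lambda>r. Dom A (snd (lift_seq B F \<eta> (j r) (p r)))) \<and>
    has_filtration A m (Cod A g) (\<lambda>r. T (Cod B (p r)))"
  proof (rule approximation[OF a z, of j p "\<lambda>r. fst (lift_seq B F \<eta> (j r) (p r))"])
    fix r
    have "Dom B (p r) = Cod B (j r)" using ses_arr(3) jp by blast
    then show "ses B (j r) (p r) \<and> Dom B (j r) = C_iter B F r a \<and> Dom B (p r) \<in> Y \<and>
      Cod B (p r) \<in> coresolved B X (n - 1) \<and>
      (fst (lift_seq B F \<eta> (j r) (p r)), snd (lift_seq B F \<eta> (j r) (p r))) = lift_seq B F \<eta> (j r) (p r)"
      using jp[of r] by simp
  qed
  then show "\<exists>f g. ses A f g \<and> Dom A f = a \<and> Cod A f \<in> UY \<and> Cod A g \<in> coresolved A TX (n - 1)"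
    unfolding A.coresolved_eq_cores[OF TX_add] by blast
qed

end

theorem theorem4p11:
  fixes B :: "('o, 'm) cat"
    and F :: "('o, 'm, 'o, 'm) funct"
    and \<eta> :: "'o \<Rightarrow> 'm"
    and n :: nat
    and X Y :: "'o set"
  assumes "eta_datum B F \<eta>"
    and "enough_projectives B" and "enough_injectives B"
    and "enough_projectives (eta_ext B F \<eta>)" and "enough_injectives (eta_ext B F \<eta>)"
    and "image_nilpotent B F \<eta>"
    and "n \<ge> 1"
    and "right_cotorsion_pair B n X Y"
    and "F_compatible B F \<eta> n X Y"
  shows "right_cotorsion_pair (eta_ext B F \<eta>) n (T_class B F \<eta> X) (U_inv B F \<eta> Y) \<and>
    U_inv B F \<eta> Y = perp (eta_ext B F \<eta>) (T_class B F \<eta> X) n \<and>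
    (\<forall>a\<in>Obj (eta_ext B F \<eta>). \<forall>m j p u v.
       loewy_length B F \<eta> a = enat m \<and>
       (\<forall>r<m. ses B (j r) (p r) \<and> Dom B (j r) = C_iter B F r a \<and>
          Dom B (p r) \<in> Y \<and> Cod B (p r) \<in> coresolved B X (n - 1) \<and>
          (u r, v r) = lift_seq B F \<eta> (j r) (p r)) \<longrightarrow>
       (\<exists>f g. ses (eta_ext B F \<eta>) f g \<and>
          Dom (eta_ext B F \<eta>) f = a \<and>
          Cod (eta_ext B F \<eta>) f \<in> U_inv B F \<eta> Y \<and>
          Cod (eta_ext B F \<eta>) g \<in> coresolved (eta_ext B F \<eta>) (T_class B F \<eta> X) (n - 1) \<and>
          has_filtration (eta_ext B F \<eta>) m (Cod (eta_ext B F \<eta>) f)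
            (\<lambda>r. Dom (eta_ext B F \<eta>) (v r)) \<and>
          has_filtration (eta_ext B F \<eta>) m (Cod (eta_ext B F \<eta>) g)
            (\<lambda>r. T_obj B F \<eta> (Cod B (p r)))))"
proof -
  have "abelian_category B" using assms(1) unfolding eta_datum_def by blast
  then interpret compatible_pair B F \<eta> n X Y
    using assms
    by (intro compatible_pair.intro eta_extension_enough.intro eta_extension.intro abelian_enough.intro
        abelian_enough_axioms.intro eta_extension_axioms.intro eta_extension_enough_axioms.intro
        compatible_pair_axioms.intro)
  note rc = right_cotorsion_pair_A[OF assms(6)]
  show ?thesis
  proof (intro conjI rc A.right_cotorsion_perp[OF rc n] ballI allI impI, elim conjE)
    fix a m j p u v
    assume a: "a \<in> Obj A" and m: "loewy_length B F \<eta> a = enat m"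
      and jp: "\<forall>r<m. ses B (j r) (p r) \<and> Dom B (j r) = C_iter B F r a \<and>
        Dom B (p r) \<in> Y \<and> Cod B (p r) \<in> coresolved B X (n - 1) \<and>
        (u r, v r) = lift_seq B F \<eta> (j r) (p r)"
    show "\<exists>f g. ses A f g \<and> Dom A f = a \<and> Cod A f \<in> UY \<and> Cod A g \<in> coresolved A TX (n - 1) \<and>
      has_filtration A m (Cod A f) (\<lambda>r. Dom A (v r)) \<and>
      has_filtration A m (Cod A g) (\<lambda>r. T (Cod B (p r)))"
      unfolding A.coresolved_eq_cores[OF TX_add]
      by (rule approximation[OF a loewy_zero[OF m], of j p u]) (use jp in blast)
  qed
qed

end
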